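(* For every integer $\ell \ge 3$ there exists $C>0$ such that for every $n$-vertex graph $G$, if $p \ge C\log n/n$ then asymptotically almost surely $G \cup G(n,p)$ contains $\min\{\delta(G), \lfloor n/\ell\rfloor\}$ pairwise vertex-disjoint copies of $C_\ell$.
   Context: $C_\ell$ denotes the cycle on $\ell$ vertices and $\delta(G)$ the minimum degree of $G$. $G(n,p)$ is the binomial random graph on the vertex set of $G$ (each pair is an edge independently with probability $p=p(n)$), and $G\cup G(n,p)$ is the graph on this vertex set whose edge set is the union of the two edge sets. "Asymptotically almost surely" means with probability tending to $1$ as $n\to\infty$, where $G=G_n$ is any sequence of $n$-vertex graphs. *)

theory Defs
  imports Complex_Main
begin

definition all_pairs :: "nat \<Rightarrow> nat set set" where
  "all_pairs n = {e. e \<subseteq> {0..<n} \<and> card e = 2}"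

definition is_graph :: "nat \<Rightarrow> nat set set \<Rightarrow> bool" where
  "is_graph n E \<longleftrightarrow> E \<subseteq> all_pairs n"

definition degree :: "nat set set \<Rightarrow> nat \<Rightarrow> nat" where
  "degree E v = card {e \<in> E. v \<in> e}"

definition min_degree :: "nat \<Rightarrow> nat set set \<Rightarrow> nat" where
  "min_degree n E = Min (degree E ` {0..<n})"

definition is_cycle_copy :: "nat set set \<Rightarrow> nat \<Rightarrow> nat list \<Rightarrow> bool" where
  "is_cycle_copy E l vs \<longleftrightarrow> length vs = l \<and> distinct vs \<and>
     (\<forall>i<l. {vs ! i, vs ! ((i + 1) mod l)} \<in> E)"

definition has_disjoint_cycles :: "nat set set \<Rightarrow> nat \<Rightarrow> nat \<Rightarrow> bool" where
  "has_disjoint_cycles E l k \<longleftrightarrow>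
     (\<exists>cs :: nat \<Rightarrow> nat list. (\<forall>j<k. is_cycle_copy E l (cs j)) \<and>
        (\<forall>i<k. \<forall>j<k. i \<noteq> j \<longrightarrow> set (cs i) \<inter> set (cs j) = {}))"

definition gnp_prob :: "nat \<Rightarrow> real \<Rightarrow> (nat set set \<Rightarrow> bool) \<Rightarrow> real" where
  "gnp_prob n p P = (\<Sum>F \<in> Pow (all_pairs n).
      (if P F then p ^ card F * (1 - p) ^ (card (all_pairs n) - card F) else 0))"

end

theory Submission
  imports "HOL-Probability.Probability" "HOL-Real_Asymp.Real_Asymp" Defs
begin

text \<open>
  Put \<open>k = min (min_degree n G) (n div l)\<close>. By the spread lemma it suffices to find a random family of \<open>k\<close>
  disjoint \<open>l\<close>-cycles, each using one edge of \<open>G\<close>, such that every set \<open>S\<close> of pairs is contained in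
  the set of the remaining cycle edges with probability at most \<open>(K / n) ^ card S\<close>.

  One edge of \<open>G\<close> per cycle is enough, so the deterministic graph only has to provide a random matching
  of size \<open>k\<close> with the same spread property; the \<open>l - 2\<close> other vertices of the cycles are filled in
  by uniformly random injections. If some set \<open>Y\<close> with fewer than \<open>k\<close> vertices meets almost all edges
  of \<open>G\<close>, almost all vertices of \<open>Y\<close> are hubs; the few edges not at hubs are chosen greedily at random
  and then every hub picks a random partner. If there is no such \<open>Y\<close>, a random subgraph of \<open>G\<close> of
  density \<open>D / n\<close> contains a matching of size \<open>k\<close> with probability at least one half: the
  structure of a smaller maximum matching would exhibit a dense part of \<open>G\<close> that the random subgraph misses.
\<close>

section \<open>Binomial random subsets\<close>

text \<open>At density of order log n / n the random graph has only polylogarithmically many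
  \<open>l\<close>-cycles in expectation, so nearly every cycle needs an edge of \<open>G\<close>.
  In a complete bipartite graph with parts of size k and n - k these edges are covered by k
  vertices, whence the bound by the minimum degree. A cycle without one edge is a path with l - 1
  edges on l vertices. Prescribing this path must cost (up to constants) a factor 1 / n per edge.
  The l - 2 filled-in vertices pay for all but one factor, and the last one must come from the edge
  of \<open>G\<close>: a fixed matching would not do, it has to be random and spread. In the
  bipartite example with k linear in n, a random subgraph of density D / n isolates a positive
  proportion of the k vertices, so it cannot provide the matching; these hubs have linearly many
  partners and can choose directly instead. Without a small set covering almost all edges, any
  failure is witnessed by one of at most 8^n triples of vertex sets, and each triple occurs with a
  probability small enough for a union bound.\<close>

definition bin_weight :: "'a set \<Rightarrow> real \<Rightarrow> 'a set \<Rightarrow> real" where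
  "bin_weight X p F = p ^ card F * (1 - p) ^ card (X - F)"

definition bin_prob :: "'a set \<Rightarrow> real \<Rightarrow> ('a set \<Rightarrow> bool) \<Rightarrow> real" where
  "bin_prob X p P = (\<Sum>F\<in>Pow X. bin_weight X p F * of_bool (P F))"

lemma bin_weight_nonneg: "0 \<le> p \<Longrightarrow> p \<le> 1 \<Longrightarrow> 0 \<le> bin_weight X p F"
  by (simp add: bin_weight_def)

lemma sum_Pow_prod:
  fixes a b :: "'a \<Rightarrow> real"
  assumes "finite X"
  shows "(\<Sum>F\<in>Pow X. (\<Prod>x\<in>F. a x) * (\<Prod>x\<in>X - F. b x)) = (\<Prod>x\<in>X. a x + b x)"
  using prod_add[OF assms, of a b] by simp

lemma sum_bin_weight: "finite X \<Longrightarrow> (\<Sum>F\<in>Pow X. bin_weight X p F) = 1"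
  using sum_Pow_prod[of X "\<lambda>_. p" "\<lambda>_. 1 - p"] by (simp add: bin_weight_def)

lemma bin_prob_le_1: "finite X \<Longrightarrow> 0 \<le> p \<Longrightarrow> p \<le> 1 \<Longrightarrow> bin_prob X p P \<le> 1"
  unfolding bin_prob_def
  by (subst sum_bin_weight[of X p, symmetric], assumption, intro sum_mono)
     (auto simp: bin_weight_nonneg)

lemma bin_prob_not:
  assumes "finite X"
  shows "bin_prob X p (\<lambda>F. \<not> P F) = 1 - bin_prob X p P"
proof -
  have "bin_prob X p (\<lambda>F. \<not> P F) + bin_prob X p P = (\<Sum>F\<in>Pow X. bin_weight X p F)"
    unfolding bin_prob_def sum.distrib[symmetric] by (intro sum.cong) auto
  then show ?thesis using sum_bin_weight[OF assms, of p] by simp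
qed

lemma bin_prob_mono:
  assumes "0 \<le> p" "p \<le> 1" "\<And>F. F \<subseteq> X \<Longrightarrow> P F \<Longrightarrow> Q F"
  shows "bin_prob X p P \<le> bin_prob X p Q"
  unfolding bin_prob_def using assms
  by (intro sum_mono mult_left_mono bin_weight_nonneg) auto

lemma sum_bin_weight_superset:
  assumes "finite X" "S \<subseteq> X"
  shows "(\<Sum>F\<in>{F\<in>Pow X. S \<subseteq> F}. bin_weight X p F) = p ^ card S"
proof -
  \<comment> \<open>\<open>?b\<close> is 0 on elements of \<open>S\<close> outside \<open>F\<close>,
    so the condition that \<open>F\<close> contains \<open>S\<close> becomes part of a product and
    the sum factorises over \<open>X\<close>.\<close>
  let ?b = "\<lambda>x. if x \<in> S then 0 else 1 - p"
  have *: "(\<Prod>x\<in>X - F. ?b x) = of_bool (S \<subseteq> F) * (1 - p) ^ card (X - F)" if "F \<subseteq> X" for F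
  proof (cases "S \<subseteq> F")
    case True
    then have "(\<Prod>x\<in>X - F. ?b x) = (\<Prod>x\<in>X - F. 1 - p)" by (intro prod.cong) auto
    with True show ?thesis by simp
  next
    case False
    then show ?thesis using assms by (auto intro!: prod_zero)
  qed
  have "(\<Sum>F\<in>{F\<in>Pow X. S \<subseteq> F}. bin_weight X p F)
      = (\<Sum>F\<in>Pow X. bin_weight X p F * of_bool (S \<subseteq> F))"
    using assms by (intro sum.mono_neutral_cong_left) auto
  also have "\<dots> = (\<Sum>F\<in>Pow X. (\<Prod>x\<in>F. p) * (\<Prod>x\<in>X - F. ?b x))"
    by (intro sum.cong refl) (subst *, auto simp: bin_weight_def)
  also have "\<dots> = (\<Prod>x\<in>X. p + ?b x)" by (rule sum_Pow_prod[OF assms(1)])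
  also have "\<dots> = (\<Prod>x\<in>X. if x \<in> S then p else 1)" by (intro prod.cong) auto
  also have "\<dots> = p ^ card S" using assms by (simp add: prod.If_cases Int_absorb1)
  finally show ?thesis .
qed

text \<open>An element is missed by both of two independent binomial sets with probability
  \<open>(1 - p) * (1 - q)\<close>, so their union is again binomial. Both sides factorise over the
  elements of \<open>X\<close>, hence the induction on \<open>X\<close>.\<close>

lemma bin_weight_union:
  assumes "finite X" "F \<subseteq> X"
  shows "(\<Sum>A\<in>Pow X. \<Sum>B\<in>Pow X. bin_weight X p A * bin_weight X q B * of_bool (A \<union> B = F))
    = bin_weight X (p + q - p * q) F"
  using assms
proof (induction X arbitrary: F rule: finite_induct)
  case empty
  then show ?case by (simp add: bin_weight_def)
next
  case (insert x X)
  have fin: "finite A" if "A \<in> Pow X" for A using that insert finite_subset by auto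
  have w1: "bin_weight (insert x X) r A = (1 - r) * bin_weight X r A" if "A \<in> Pow X" for A r
  proof -
    have "insert x X - A = insert x (X - A)" using that insert by auto
    then show ?thesis using insert fin[OF that] by (simp add: bin_weight_def)
  qed
  have w2: "bin_weight (insert x X) r (insert x A) = r * bin_weight X r A" if "A \<in> Pow X" for A r
  proof -
    have "insert x X - insert x A = X - A" "x \<notin> A" using that insert by auto
    then show ?thesis using insert fin[OF that] by (simp add: bin_weight_def)
  qed
  have inj: "inj_on (insert x) (Pow X)"
    using insert(2) by (auto simp: inj_on_def)
  have split: "(\<Sum>A\<in>Pow (insert x X). g A) = (\<Sum>A\<in>Pow X. g A + g (insert x A))"
    for g :: "'a set \<Rightarrow> real"
    unfolding Pow_insert sum.distrib using insert
    using inj by (subst sum.union_disjoint) (auto simp: sum.reindex)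
  let ?S = "\<lambda>F. (\<Sum>A\<in>Pow X. \<Sum>B\<in>Pow X. bin_weight X p A * bin_weight X q B * of_bool (A \<union> B = F))"
  show ?case
  proof (cases "x \<in> F")
    case False
    then have F: "F \<subseteq> X" using insert by auto
    have "(\<Sum>A\<in>Pow (insert x X). \<Sum>B\<in>Pow (insert x X).
        bin_weight (insert x X) p A * bin_weight (insert x X) q B * of_bool (A \<union> B = F))
      = (\<Sum>A\<in>Pow X. \<Sum>B\<in>Pow X. (1 - p) * (1 - q) * (bin_weight X p A * bin_weight X q B * of_bool (A \<union> B = F)))"
      unfolding split sum.distrib[symmetric] using False
      by (intro sum.cong refl) (auto simp: w1 w2)
    also have "\<dots> = (1 - p) * (1 - q) * ?S F" by (simp add: sum_distrib_left)
    also have "\<dots> = bin_weight (insert x X) (p + q - p * q) F"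
      using insert.IH[OF F] F by (simp add: w1 algebra_simps)
    finally show ?thesis .
  next
    case True
    define F' where "F' = F - {x}"
    have F: "F' \<subseteq> X" "F = insert x F'" "x \<notin> F'" using insert True by (auto simp: F'_def)
    have e: "insert x A = insert x F' \<longleftrightarrow> A = F'" "A \<noteq> insert x F'" if "A \<subseteq> X" for A
      using that F insert by (metis insert_ident subset_iff, auto)
    \<comment> \<open>For \<open>x\<close> in \<open>F\<close> three placements survive:
      \<open>x\<close> only in \<open>A\<close>, only in \<open>B\<close>, or in both.\<close>
    have "(\<Sum>A\<in>Pow (insert x X). \<Sum>B\<in>Pow (insert x X).
        bin_weight (insert x X) p A * bin_weight (insert x X) q B * of_bool (A \<union> B = F))
      = (\<Sum>A\<in>Pow X. \<Sum>B\<in>Pow X. ((1 - p) * q + p * (1 - q) + p * q) * (bin_weight X p A * bin_weight X q B * of_bool (A \<union> B = F')))"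
      unfolding split sum.distrib[symmetric] F(2)
    proof (intro sum.cong refl, goal_cases)
      case (1 A B)
      then have "A \<union> B \<subseteq> X" by auto
      note e = e[OF this]
      show ?case
        by (cases "A \<union> B = F'") (use 1 e in \<open>simp_all add: w1 w2 ring_distribs mult_ac\<close>)
    qed
    also have "\<dots> = ((1 - p) * q + p * (1 - q) + p * q) * ?S F'" by (simp add: sum_distrib_left)
    also have "\<dots> = bin_weight (insert x X) (p + q - p * q) F"
      using insert.IH[OF F(1)] F by (simp add: w2 algebra_simps)
    finally show ?thesis .
  qed
qed

lemma bin_prob_union:
  assumes "finite X"
  shows "(\<Sum>A\<in>Pow X. bin_weight X p A * bin_prob X q (\<lambda>B. P (A \<union> B))) = bin_prob X (p + q - p * q) P"
proof -
  let ?w = "\<lambda>A B. bin_weight X p A * bin_weight X q B"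
  have "bin_prob X (p + q - p * q) P
     = (\<Sum>F\<in>Pow X. \<Sum>A\<in>Pow X. \<Sum>B\<in>Pow X. ?w A B * of_bool (A \<union> B = F) * of_bool (P F))"
    unfolding bin_prob_def
    by (intro sum.cong refl) (subst bin_weight_union[OF assms, symmetric], auto simp: sum_distrib_right)
  also have "\<dots> = (\<Sum>A\<in>Pow X. \<Sum>B\<in>Pow X. \<Sum>F\<in>Pow X. ?w A B * of_bool (A \<union> B = F) * of_bool (P F))"
    by (rule trans[OF sum.swap]) (intro sum.cong refl sum.swap)
  also have "\<dots> = (\<Sum>A\<in>Pow X. \<Sum>B\<in>Pow X. ?w A B * of_bool (P (A \<union> B)))"
  proof (intro sum.cong refl, goal_cases)
    case (1 A B)
    have "(\<Sum>F\<in>Pow X. ?w A B * of_bool (A \<union> B = F) * of_bool (P F))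
       = (\<Sum>F\<in>Pow X. if A \<union> B = F then ?w A B * of_bool (P (A \<union> B)) else 0)"
      by (intro sum.cong) auto
    also have "\<dots> = ?w A B * of_bool (P (A \<union> B))" using assms 1 by simp
    finally show ?case .
  qed
  also have "\<dots> = (\<Sum>A\<in>Pow X. bin_weight X p A * bin_prob X q (\<lambda>B. P (A \<union> B)))"
    unfolding bin_prob_def by (intro sum.cong refl) (simp add: sum_distrib_left mult.assoc)
  finally show ?thesis by simp
qed

text \<open>Coupling by sprinkling: a set of density \<open>p\<close> is enlarged by an independent
  set of density \<open>q\<close>, which preserves \<open>P\<close>. Here \<open>q\<close> is chosen
  to give the union density exactly \<open>p'\<close>; the division by \<open>1 - p\<close> makes
  \<open>p = 1\<close> a separate case.\<close>

lemma bin_prob_mono_p: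
  assumes "finite X" "0 \<le> p" "p \<le> p'" "p' \<le> 1"
    and up: "\<And>A B. A \<subseteq> B \<Longrightarrow> B \<subseteq> X \<Longrightarrow> P A \<Longrightarrow> P B"
  shows "bin_prob X p P \<le> bin_prob X p' P"
proof (cases "p = 1")
  case True
  then show ?thesis using assms by simp
next
  case False
  define q where "q = (p' - p) / (1 - p)"
  have q: "0 \<le> q" "q \<le> 1"
    using assms False unfolding q_def by (auto simp: field_simps)
  have "p + q - p * q = p + q * (1 - p)" by (simp add: algebra_simps)
  with False have q3: "p + q - p * q = p'" by (simp add: q_def)
  have "bin_prob X p P = (\<Sum>A\<in>Pow X. bin_weight X p A * (\<Sum>B\<in>Pow X. bin_weight X q B * of_bool (P A)))"
    unfolding bin_prob_def sum_distrib_right[symmetric] sum_bin_weight[OF assms(1)] by simp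
  also have "\<dots> \<le> (\<Sum>A\<in>Pow X. bin_weight X p A * bin_prob X q (\<lambda>B. P (A \<union> B)))"
  proof (intro sum_mono mult_left_mono)
    fix A assume A: "A \<in> Pow X"
    show "(\<Sum>B\<in>Pow X. bin_weight X q B * of_bool (P A)) \<le> bin_prob X q (\<lambda>B. P (A \<union> B))"
      unfolding bin_prob_def
    proof (intro sum_mono mult_left_mono)
      fix B assume "B \<in> Pow X"
      with A show "(of_bool (P A) :: real) \<le> of_bool (P (A \<union> B))"
        using up[of A "A \<union> B"] by auto
    qed (use q in \<open>auto simp: bin_weight_nonneg\<close>)
  qed (use assms in \<open>auto simp: bin_weight_nonneg\<close>)
  also have "\<dots> = bin_prob X p' P" using bin_prob_union[OF assms(1), of p q P] q3 by simp
  finally show ?thesis .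
qed

text \<open>Two rounds of exposure use density \<open>p + q - p * q\<close>; rounding up to
  \<open>p + q\<close> allows the densities of many rounds to be added.\<close>

lemma bin_prob_two_rounds:
  assumes "finite X" "0 \<le> p" "0 \<le> q" "p + q \<le> p'" "p' \<le> 1"
    and up: "\<And>A B. A \<subseteq> B \<Longrightarrow> B \<subseteq> X \<Longrightarrow> P A \<Longrightarrow> P B"
  shows "(\<Sum>A\<in>Pow X. bin_weight X p A * bin_prob X q (\<lambda>B. P (A \<union> B))) \<le> bin_prob X p' P"
proof -
  have a: "0 \<le> p * (1 - q)" and b: "0 \<le> p * q" using assms by simp_all
  have "0 \<le> p + q - p * q" "p + q - p * q \<le> p'"
    using a assms(3) apply (simp add: algebra_simps) using b assms by linarith
  from bin_prob_mono_p[of X, OF assms(1) this assms(5), of P] up show ?thesis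
    unfolding bin_prob_union[OF assms(1)] by blast
qed

section \<open>The spread lemma\<close>

text \<open>The weights need not sum to 1: every round of the spread lemma discards the members with
  large fragments, and the surviving total weight is what is tracked.\<close>

definition spread :: "'i set \<Rightarrow> ('i \<Rightarrow> 'a set) \<Rightarrow> ('i \<Rightarrow> real) \<Rightarrow> real \<Rightarrow> bool" where
  "spread I h w q \<longleftrightarrow> finite I \<and> (\<forall>i\<in>I. 0 \<le> w i) \<and>
     (\<forall>S. finite S \<longrightarrow> (\<Sum>i\<in>{i\<in>I. S \<subseteq> h i}. w i) \<le> q ^ card S)"

text \<open>The minimum fragment known from proofs of the Kahn-Kalai conjecture: what the cheapest
  member inside \<open>W \<union> h i\<close> still lacks. The index \<open>i\<close> itself
  competes, so a minimiser exists.\<close>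

definition fragment :: "'i set \<Rightarrow> ('i \<Rightarrow> 'a set) \<Rightarrow> 'a set \<Rightarrow> 'i \<Rightarrow> 'a set" where
  "fragment I h W i = h (arg_min (\<lambda>j. card (h j - W)) (\<lambda>j. j \<in> I \<and> h j \<subseteq> W \<union> h i)) - W"

lemma fragment_obtain:
  assumes "i \<in> I"
  obtains j where "j \<in> I" "h j \<subseteq> W \<union> h i" "fragment I h W i = h j - W"
    "\<And>g. g \<in> I \<Longrightarrow> h g \<subseteq> W \<union> h i \<Longrightarrow> card (h j - W) \<le> card (h g - W)"
  using arg_min_nat_lemma[of "\<lambda>j. j \<in> I \<and> h j \<subseteq> W \<union> h i" i "\<lambda>j. card (h j - W)"] assms
  unfolding fragment_def by blast

lemma fragment_subset: "i \<in> I \<Longrightarrow> fragment I h W i \<subseteq> h i"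
  by (rule fragment_obtain[of i I h W]) auto

text \<open>Fragments only shrink the sets and the restriction only drops nonnegative weights, so
  \<open>q\<close> does not deteriorate. This makes the halving step iterable.\<close>

lemma spread_fragment:
  assumes "spread I h w q"
  shows "spread {i\<in>I. P i} (fragment I h W) w q"
  unfolding spread_def
proof (intro conjI allI impI ballI)
  fix S :: "'b set" assume "finite S"
  have "(\<Sum>i\<in>{i\<in>{i\<in>I. P i}. S \<subseteq> fragment I h W i}. w i) \<le> (\<Sum>i\<in>{i\<in>I. S \<subseteq> h i}. w i)"
  proof (rule sum_mono2)
    show "{i\<in>{i\<in>I. P i}. S \<subseteq> fragment I h W i} \<subseteq> {i\<in>I. S \<subseteq> h i}"
      using fragment_subset[of _ I h W] by blast
  qed (use assms in \<open>auto simp: spread_def\<close>)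
  also have "\<dots> \<le> q ^ card S" using assms \<open>finite S\<close> by (auto simp: spread_def)
  finally show "(\<Sum>i\<in>{i\<in>{i\<in>I. P i}. S \<subseteq> fragment I h W i}. w i) \<le> q ^ card S" .
qed (use assms in \<open>auto simp: spread_def\<close>)

text \<open>
  The pair \<open>(W, T)\<close>, with \<open>T\<close> the fragment, is encoded by \<open>(Z, T)\<close> with \<open>Z = W \<union> T\<close>. By minimality,
  \<open>T\<close> is contained in every \<open>h g \<subseteq> Z\<close>, hence in one that is picked from \<open>Z\<close> alone, which leaves at most
  \<open>r choose t\<close> choices for \<open>T\<close>.
\<close>

lemma sum_fragment_card_eq:
  assumes sp: "spread I h w q" and X: "finite X" "\<And>i. i \<in> I \<Longrightarrow> h i \<subseteq> X"
    and r: "\<And>i. i \<in> I \<Longrightarrow> card (h i) \<le> r" and d: "0 < d" "d \<le> 1" and q: "0 \<le> q"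
  shows "(\<Sum>W\<in>Pow X. bin_weight X d W * (\<Sum>i\<in>{i\<in>I. card (fragment I h W i) = t}. w i))
    \<le> real (r choose t) * (q / d) ^ t"
proof -
  have fI: "finite I" using sp by (auto simp: spread_def)
  define fr where "fr W = fragment I h W ` {i\<in>I. card (fragment I h W i) = t}" for W
  define pick where "pick Z = (SOME j. j \<in> I \<and> h j \<subseteq> Z)" for Z
  define cand where "cand Z = (if \<exists>j\<in>I. h j \<subseteq> Z then {T. T \<subseteq> h (pick Z) \<and> card T = t} else {})" for Z
  have pick: "pick Z \<in> I \<and> h (pick Z) \<subseteq> Z" if "\<exists>j\<in>I. h j \<subseteq> Z" for Z
    using someI_ex[of "\<lambda>j. j \<in> I \<and> h j \<subseteq> Z"] that by (auto simp: pick_def)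
  have fin_h: "finite (h i)" if "i \<in> I" for i using X that finite_subset by blast
  have fin_fr: "finite (fr W)" for W using fI by (simp add: fr_def)
  have card_cand: "finite (cand Z) \<and> card (cand Z) \<le> r choose t" for Z
  proof (cases "\<exists>j\<in>I. h j \<subseteq> Z")
    case True
    have "card {T. T \<subseteq> h (pick Z) \<and> card T = t} = card (h (pick Z)) choose t"
      using fin_h pick[OF True] by (intro n_subsets) auto
    also have "\<dots> \<le> r choose t" using r pick[OF True] by (auto intro: binomial_right_mono)
    finally show ?thesis using True fin_h pick[OF True] by (auto simp: cand_def)
  qed (auto simp: cand_def)
  have fr_props: "T \<subseteq> X \<and> T \<inter> W = {} \<and> card T = t \<and> T \<in> cand (W \<union> T)" if T: "T \<in> fr W" for T W
  proof -
    obtain i where i: "i \<in> I" "T = fragment I h W i" "card T = t" using T by (auto simp: fr_def)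
    obtain j where j: "j \<in> I" "h j \<subseteq> W \<union> h i" "T = h j - W"
      "\<And>g. g \<in> I \<Longrightarrow> h g \<subseteq> W \<union> h i \<Longrightarrow> card T \<le> card (h g - W)"
    proof (rule fragment_obtain[OF i(1), of h W])
      fix j assume "j \<in> I" "h j \<subseteq> W \<union> h i" "fragment I h W i = h j - W"
        "\<And>g. g \<in> I \<Longrightarrow> h g \<subseteq> W \<union> h i \<Longrightarrow> card (h j - W) \<le> card (h g - W)"
      with i(2) that[of j] show thesis by simp
    qed
    have ex: "\<exists>j\<in>I. h j \<subseteq> W \<union> T" using j by auto
    let ?g = "pick (W \<union> T)"
    have g: "?g \<in> I" "h ?g \<subseteq> W \<union> T" using pick[OF ex] by auto
    have "T \<subseteq> h i" using i fragment_subset by metis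
    \<comment> \<open>\<open>h ?g\<close> lies in \<open>W \<union> h i\<close>, so it competed in
      the minimisation and cannot lack fewer elements than \<open>T\<close>.\<close>
    then have "card T \<le> card (h ?g - W)" using g by (intro j) auto
    moreover have "h ?g - W \<subseteq> T" using g by auto
    moreover have "finite T" using j fin_h by auto
    ultimately have "h ?g - W = T" using card_seteq by blast
    then show ?thesis using i(3) j ex X(2)[OF j(1)] by (auto simp: cand_def)
  qed
  have "(\<Sum>W\<in>Pow X. bin_weight X d W * (\<Sum>i\<in>{i\<in>I. card (fragment I h W i) = t}. w i))
     \<le> (\<Sum>W\<in>Pow X. bin_weight X d W * (\<Sum>T\<in>fr W. q ^ t))"
  proof (intro sum_mono mult_left_mono)
    fix W assume "W \<in> Pow X"
    have "(\<Sum>i\<in>{i\<in>I. card (fragment I h W i) = t}. w i)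
       = (\<Sum>T\<in>fr W. \<Sum>i\<in>{i\<in>{i\<in>I. card (fragment I h W i) = t}. fragment I h W i = T}. w i)"
      unfolding fr_def using fI by (intro sum.image_gen) auto
    also have "\<dots> \<le> (\<Sum>T\<in>fr W. \<Sum>i\<in>{i\<in>I. T \<subseteq> h i}. w i)"
    proof (intro sum_mono sum_mono2)
      fix T
      show "{i\<in>{i\<in>I. card (fragment I h W i) = t}. fragment I h W i = T} \<subseteq> {i\<in>I. T \<subseteq> h i}"
        using fragment_subset[of _ I h W] by blast
    qed (use fI sp in \<open>auto simp: spread_def\<close>)
    also have "\<dots> \<le> (\<Sum>T\<in>fr W. q ^ t)"
    proof (intro sum_mono)
      fix T assume T: "T \<in> fr W"
      then have "finite T" using fr_props[OF T] X finite_subset by blast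
      then show "(\<Sum>i\<in>{i\<in>I. T \<subseteq> h i}. w i) \<le> q ^ t"
        using sp fr_props[OF T] unfolding spread_def by metis
    qed
    finally show "(\<Sum>i\<in>{i\<in>I. card (fragment I h W i) = t}. w i) \<le> (\<Sum>T\<in>fr W. q ^ t)" .
  qed (use d in \<open>auto simp: bin_weight_nonneg\<close>)
  also have "\<dots> = (\<Sum>(W, T)\<in>(SIGMA W:Pow X. fr W). bin_weight X d W * q ^ t)"
    using X fin_fr by (subst sum.Sigma[symmetric]) (auto simp: mult_ac)
  also have "\<dots> \<le> (\<Sum>(W, T)\<in>(SIGMA W:Pow X. fr W). bin_weight X d (W \<union> T) * (q / d) ^ t)"
  proof (intro sum_mono, clarify)
    fix W T assume W: "W \<subseteq> X" and T: "T \<in> fr W"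
    have fin: "finite W" "finite T" using W fr_props[OF T] X finite_subset by blast+
    have c: "card (W \<union> T) = card W + t"
      using fr_props[OF T] fin by (subst card_Un_disjoint) auto
    \<comment> \<open>Moving the \<open>t\<close> elements of \<open>T\<close> into the random set
      loses at most a factor \<open>d ^ t\<close> of weight, since the factors \<open>1 - d\<close>
      that disappear only help. Combined with the spread bound \<open>q ^ t\<close> this yields
      \<open>(q / d) ^ t\<close>.\<close>
    have "(1 - d) ^ card (X - W) \<le> (1 - d) ^ card (X - (W \<union> T))"
      using d X by (intro power_decreasing card_mono) auto
    then have "bin_weight X d W * d ^ t \<le> bin_weight X d (W \<union> T)"
      using d by (simp add: bin_weight_def c power_add mult_ac)
    then have "bin_weight X d W * d ^ t * (q / d) ^ t \<le> bin_weight X d (W \<union> T) * (q / d) ^ t"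
      using d q by (intro mult_right_mono) auto
    then show "bin_weight X d W * q ^ t \<le> bin_weight X d (W \<union> T) * (q / d) ^ t"
      using d by (simp add: power_divide)
  qed
  also have "\<dots> = (\<Sum>(Z, T)\<in>(\<lambda>(W, T). (W \<union> T, T)) ` (SIGMA W:Pow X. fr W). bin_weight X d Z * (q / d) ^ t)"
  proof (subst sum.reindex)
    show "inj_on (\<lambda>(W, T). (W \<union> T, T)) (SIGMA W:Pow X. fr W)"
    proof (rule inj_onI)
      fix a b assume a: "a \<in> (SIGMA W:Pow X. fr W)" and b: "b \<in> (SIGMA W:Pow X. fr W)"
        and eq: "(\<lambda>(W, T). (W \<union> T, T)) a = (\<lambda>(W, T). (W \<union> T, T)) b"
      obtain W T W' T' where ab: "a = (W, T)" "b = (W', T')" by (cases a, cases b) auto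
      have "T \<inter> W = {}" "T \<inter> W' = {}" "T' = T" "W \<union> T = W' \<union> T"
        using fr_props[of T W] fr_props[of T' W'] a b eq by (auto simp: ab)
      then have "W = W'" by blast
      with \<open>T' = T\<close> ab show "a = b" by simp
    qed
  qed (auto intro!: sum.cong)
  also have "\<dots> \<le> (\<Sum>(Z, T)\<in>(SIGMA Z:Pow X. cand Z). bin_weight X d Z * (q / d) ^ t)"
  proof (rule sum_mono2)
    show "finite (SIGMA Z:Pow X. cand Z)" using X card_cand by blast
    show "(\<lambda>(W, T). (W \<union> T, T)) ` (SIGMA W:Pow X. fr W) \<subseteq> (SIGMA Z:Pow X. cand Z)"
    proof clarify
      fix W T x assume "W \<subseteq> X" "T \<in> fr W"
      then show "W \<union> T \<in> Pow X \<and> T \<in> cand (W \<union> T)" using fr_props[of T W] by blast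
    qed
  qed (use d q in \<open>auto simp: bin_weight_nonneg\<close>)
  also have "\<dots> = (\<Sum>Z\<in>Pow X. bin_weight X d Z * (real (card (cand Z)) * (q / d) ^ t))"
    using X card_cand by (subst sum.Sigma[symmetric]) (auto simp: mult_ac)
  also have "\<dots> \<le> (\<Sum>Z\<in>Pow X. bin_weight X d Z * (real (r choose t) * (q / d) ^ t))"
    using card_cand d q
    by (intro sum_mono mult_left_mono mult_right_mono) (auto simp: bin_weight_nonneg)
  also have "\<dots> = real (r choose t) * (q / d) ^ t"
    using X by (simp add: sum_distrib_right[symmetric] sum_bin_weight)
  finally show ?thesis .
qed

lemma sum_fragment_card_ge:
  assumes sp: "spread I h w q" and X: "finite X" "\<And>i. i \<in> I \<Longrightarrow> h i \<subseteq> X"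
    and r: "\<And>i. i \<in> I \<Longrightarrow> card (h i) \<le> r" and d: "0 < d" "d \<le> 1" and q: "0 \<le> q"
  shows "(\<Sum>W\<in>Pow X. bin_weight X d W * (\<Sum>i\<in>{i\<in>I. card (fragment I h W i) > m}. w i))
    \<le> (\<Sum>t\<in>{m<..r}. real (r choose t) * (q / d) ^ t)"
proof -
  have fI: "finite I" using sp by (auto simp: spread_def)
  have c: "card (fragment I h W i) \<le> r" if "i \<in> I" for W i
    using that r[OF that] fragment_subset[OF that, of h W] X finite_subset[OF X(2)[OF that]]
    by (meson card_mono le_trans)
  have "(\<Sum>i\<in>{i\<in>I. card (fragment I h W i) > m}. w i)
     = (\<Sum>t\<in>{m<..r}. \<Sum>i\<in>{i\<in>I. card (fragment I h W i) = t}. w i)" for W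
  proof -
    have "(\<Sum>i\<in>{i\<in>I. card (fragment I h W i) > m}. w i)
      = (\<Sum>t\<in>{m<..r}. \<Sum>i\<in>{i\<in>{i\<in>I. card (fragment I h W i) > m}. card (fragment I h W i) = t}. w i)"
      using fI c by (intro sum.group[symmetric]) auto
    also have "\<dots> = (\<Sum>t\<in>{m<..r}. \<Sum>i\<in>{i\<in>I. card (fragment I h W i) = t}. w i)"
      by (intro sum.cong) auto
    finally show ?thesis .
  qed
  then have "(\<Sum>W\<in>Pow X. bin_weight X d W * (\<Sum>i\<in>{i\<in>I. card (fragment I h W i) > m}. w i))
     = (\<Sum>t\<in>{m<..r}. \<Sum>W\<in>Pow X. bin_weight X d W * (\<Sum>i\<in>{i\<in>I. card (fragment I h W i) = t}. w i))"
    by (subst sum.swap) (simp add: sum_distrib_left)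
  also have "\<dots> \<le> (\<Sum>t\<in>{m<..r}. real (r choose t) * (q / d) ^ t)"
    using sum_fragment_card_eq[OF sp X r d q] by (intro sum_mono) auto
  finally show ?thesis .
qed

text \<open>If \<open>W\<close> contains no member then every fragment is nonempty, so the full
  weight sits on fragments of size at least 1. The expected weight of those is at most the binomial
  sum without its term for \<open>t = 0\<close>.\<close>

lemma spread_final_round:
  assumes sp: "spread I h w q" and X: "finite X" "\<And>i. i \<in> I \<Longrightarrow> h i \<subseteq> X"
    and r: "\<And>i. i \<in> I \<Longrightarrow> card (h i) \<le> r" and d: "0 < d" "d \<le> 1" and q: "0 \<le> q"
  shows "sum w I - ((1 + q / d) ^ r - 1) \<le> bin_prob X d (\<lambda>F. \<exists>i\<in>I. h i \<subseteq> F)"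
proof -
  let ?P = "\<lambda>F. \<exists>i\<in>I. h i \<subseteq> F"
  \<comment> \<open>The upper bound is the spread condition for the empty set.\<close>
  have wI: "0 \<le> sum w I" "sum w I \<le> 1"
  proof -
    have "(\<Sum>i\<in>{i\<in>I. {} \<subseteq> h i}. w i) \<le> q ^ card ({} :: 'b set)"
      using sp unfolding spread_def by blast
    then show "sum w I \<le> 1" by simp
  qed (use sp in \<open>auto simp: spread_def intro: sum_nonneg\<close>)
  have "(\<Sum>t\<in>{0<..r}. real (r choose t) * (q / d) ^ t) = (\<Sum>t\<le>r. real (r choose t) * (q / d) ^ t) - 1"
  proof -
    have "{..r} = insert 0 {0<..r}" by auto
    then show ?thesis by simp
  qed
  also have "(\<Sum>t\<le>r. real (r choose t) * (q / d) ^ t) = (1 + q / d) ^ r"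
    by (subst add.commute, subst binomial_ring) simp
  finally have err: "(\<Sum>t\<in>{0<..r}. real (r choose t) * (q / d) ^ t) = (1 + q / d) ^ r - 1" .
  have "(1 - bin_prob X d ?P) * sum w I = (\<Sum>W\<in>Pow X. bin_weight X d W * (of_bool (\<not> ?P W) * sum w I))"
    unfolding bin_prob_not[OF X(1), symmetric] by (simp add: bin_prob_def sum_distrib_right mult.assoc)
  also have "\<dots> \<le> (\<Sum>W\<in>Pow X. bin_weight X d W * (\<Sum>i\<in>{i\<in>I. card (fragment I h W i) > 0}. w i))"
  proof (intro sum_mono mult_left_mono)
    fix W assume "W \<in> Pow X"
    show "of_bool (\<not> ?P W) * sum w I \<le> (\<Sum>i\<in>{i\<in>I. card (fragment I h W i) > 0}. w i)"
    proof (cases "?P W")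
      case True
      then show ?thesis using sp by (auto simp: spread_def intro!: sum_nonneg)
    next
      case False
      have "card (fragment I h W i) > 0" if i: "i \<in> I" for i
      proof -
        obtain j where j: "j \<in> I" "fragment I h W i = h j - W" using fragment_obtain[OF i, of h W] by metis
        then have "fragment I h W i \<noteq> {}" using False by auto
        moreover have "finite (h j - W)" using X(2)[OF j(1)] X(1) finite_subset by blast
        ultimately show ?thesis using j by (simp add: card_gt_0_iff)
      qed
      then have "{i\<in>I. card (fragment I h W i) > 0} = I" by auto
      with False show ?thesis by simp
    qed
  qed (use d in \<open>auto simp: bin_weight_nonneg\<close>)
  also have "\<dots> \<le> (1 + q / d) ^ r - 1"
    using sum_fragment_card_ge[OF sp X r d q, of 0] err by simp
  finally have "sum w I - ((1 + q / d) ^ r - 1) \<le> bin_prob X d ?P * sum w I" by (simp add: algebra_simps)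
  also have "\<dots> \<le> bin_prob X d ?P * 1"
    using wI d by (intro mult_left_mono) (auto simp: bin_prob_def intro!: sum_nonneg mult_nonneg_nonneg bin_weight_nonneg)
  finally show ?thesis by simp
qed

text \<open>16 is the ratio between the density of a halving round and \<open>q\<close>. Beyond
  \<open>r / 2\<close> it makes \<open>(1 / 16) ^ t\<close> at most \<open>(1 / 4) ^ r\<close>,
  which beats the \<open>2 ^ r\<close> subsets and leaves \<open>(1 / 2) ^ r\<close>.\<close>

lemma binomial_tail_half:
  "(\<Sum>t\<in>{r div 2<..r}. real (r choose t) * (1 / 16) ^ t) \<le> (1 / 2) ^ r"
proof -
  have "(\<Sum>t\<in>{r div 2<..r}. real (r choose t) * (1 / 16) ^ t)
     \<le> (\<Sum>t\<in>{r div 2<..r}. real (r choose t) * (1 / 4) ^ r)"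
  proof (intro sum_mono mult_left_mono)
    fix t assume "t \<in> {r div 2<..r}"
    then have "r \<le> 2 * t" by auto
    have "(1 / 16 :: real) ^ t = (1 / 4) ^ (2 * t)" by (simp add: power_mult power_divide)
    also have "\<dots> \<le> (1 / 4) ^ r" using \<open>r \<le> 2 * t\<close> by (intro power_decreasing) auto
    finally show "(1 / 16 :: real) ^ t \<le> (1 / 4) ^ r" .
  qed auto
  also have "\<dots> \<le> (\<Sum>t\<le>r. real (r choose t) * (1 / 4) ^ r)"
    by (intro sum_mono2) auto
  also have "\<dots> = real (\<Sum>t\<le>r. r choose t) * (1 / 4) ^ r" by (simp add: sum_distrib_right)
  also have "\<dots> = (1 / 2) ^ r"
    by (subst choose_row_sum) (simp add: power_mult_distrib[symmetric])
  finally show ?thesis .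
qed

text \<open>
  Each of \<open>j\<close> rounds of density \<open>16 * q\<close> halves the size of all but a small proportion of the fragments;
  a last round of the larger density \<open>d\<close> covers fragments of size at most \<open>s\<close> completely.
\<close>

theorem spread_lemma:
  fixes h :: "'i \<Rightarrow> 'a set"
  assumes "spread I h w q" "finite X" "\<And>i. i \<in> I \<Longrightarrow> h i \<subseteq> X"
    and "\<And>i. i \<in> I \<Longrightarrow> card (h i) \<le> s * 2 ^ j"
    and "0 < d" "0 < q" "d + real j * (16 * q) \<le> p" "p \<le> 1"
  shows "sum w I - real j * (1 / 2) ^ s - ((1 + q / d) ^ s - 1) \<le> bin_prob X p (\<lambda>F. \<exists>i\<in>I. h i \<subseteq> F)"
proof -
  have "sum w I - real j * (1 / 2) ^ s - ((1 + q / d) ^ s - 1) \<le> bin_prob X p (\<lambda>F. \<exists>i\<in>I. h i \<subseteq> F)"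
    if "spread I h w q" "\<And>i. i \<in> I \<Longrightarrow> h i \<subseteq> X" "\<And>i. i \<in> I \<Longrightarrow> card (h i) \<le> r"
      "r \<le> s * 2 ^ j" "d + real j * (16 * q) \<le> p" "p \<le> 1"
    for I r p and h :: "'i \<Rightarrow> 'a set"
    using that
  proof (induction j arbitrary: I h r p)
    case 0
    have "sum w I - ((1 + q / d) ^ s - 1) \<le> bin_prob X d (\<lambda>F. \<exists>i\<in>I. h i \<subseteq> F)"
    proof (rule spread_final_round)
      show "card (h i) \<le> s" if "i \<in> I" for i using "0.prems"(3)[OF that] "0.prems"(4) by simp
    qed (use "0.prems" assms in auto)
    also have "\<dots> \<le> bin_prob X p (\<lambda>F. \<exists>i\<in>I. h i \<subseteq> F)"
    proof (rule bin_prob_mono_p)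
      fix A B :: "'a set" assume "A \<subseteq> B" "\<exists>i\<in>I. h i \<subseteq> A"
      then show "\<exists>i\<in>I. h i \<subseteq> B" by blast
    qed (use 0 assms in auto)
    finally show ?case by simp
  next
    case (Suc j)
    show ?case
    proof (cases "r \<le> s")
      case True
      then have "r \<le> s * 2 ^ j" by (metis Suc.prems(4) le_trans mult.right_neutral mult_le_mono2 one_le_numeral one_le_power)
      moreover have "d + real j * (16 * q) \<le> p" using Suc.prems(5) assms(6) by (simp add: algebra_simps)
      ultimately have "sum w I - real j * (1 / 2) ^ s - ((1 + q / d) ^ s - 1) \<le> bin_prob X p (\<lambda>F. \<exists>i\<in>I. h i \<subseteq> F)"
        using Suc.prems by (intro Suc.IH[where r = r]) auto
      moreover have "real j * (1 / 2) ^ s \<le> real (Suc j) * (1 / 2) ^ s" by (intro mult_right_mono) auto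
      ultimately show ?thesis by linarith
    next
      case False
      define m where "m = r div 2"
      define e where "e = real j * (1 / 2) ^ s + ((1 + q / d) ^ s - 1)"
      let ?h = "fragment I h" and ?I = "\<lambda>W. {i\<in>I. card (fragment I h W i) \<le> m}"
      have p: "16 * q \<le> 1" "d + real j * (16 * q) \<le> p - 16 * q" "0 \<le> p - 16 * q" "p - 16 * q \<le> 1"
      proof -
        have "0 \<le> real j * (16 * q)" using assms(6) by simp
        moreover have "d + 16 * q + real j * (16 * q) \<le> p" using Suc.prems(5) by (simp add: algebra_simps)
        ultimately show "16 * q \<le> 1" "d + real j * (16 * q) \<le> p - 16 * q" "0 \<le> p - 16 * q" "p - 16 * q \<le> 1"
          using Suc.prems(6) assms(5,6) by linarith+
      qed
      have nn: "\<forall>i\<in>I. 0 \<le> w i" and fI: "finite I" using Suc.prems(1) by (auto simp: spread_def)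
      have IH: "sum w (?I W) - e \<le> bin_prob X (p - 16 * q) (\<lambda>F. \<exists>i\<in>?I W. ?h W i \<subseteq> F)" for W
      proof -
        have "sum w (?I W) - real j * (1 / 2) ^ s - ((1 + q / d) ^ s - 1)
          \<le> bin_prob X (p - 16 * q) (\<lambda>F. \<exists>i\<in>?I W. ?h W i \<subseteq> F)"
        proof (rule Suc.IH[where r = m])
          show "?h W i \<subseteq> X" if "i \<in> ?I W" for i
            using that fragment_subset[of i I h W] Suc.prems(2)[of i] by auto
          show "m \<le> s * 2 ^ j" using Suc.prems(4) by (simp add: m_def)
        qed (use spread_fragment[OF Suc.prems(1)] p in auto)
        then show ?thesis by (simp add: e_def algebra_simps)
      qed
      have "(\<Sum>W\<in>Pow X. bin_weight X (16 * q) W * (\<Sum>i\<in>{i\<in>I. card (?h W i) > m}. w i))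
         \<le> (\<Sum>t\<in>{m<..r}. real (r choose t) * (q / (16 * q)) ^ t)"
        using Suc.prems assms p by (intro sum_fragment_card_ge) auto
      also have "\<dots> \<le> (1 / 2) ^ r" using binomial_tail_half[of r] assms(6) by (simp add: m_def)
      also have "\<dots> \<le> (1 / 2) ^ s" using False by (intro power_decreasing) auto
      finally have lost: "(\<Sum>W\<in>Pow X. bin_weight X (16 * q) W * (\<Sum>i\<in>{i\<in>I. card (?h W i) > m}. w i)) \<le> (1 / 2) ^ s" .
      have split: "sum w I - e = (\<Sum>i\<in>{i\<in>I. card (?h W i) > m}. w i) + (sum w (?I W) - e)" for W
      proof -
        have "I = {i\<in>I. card (?h W i) > m} \<union> ?I W" by auto
        then have "sum w I = sum w ({i\<in>I. card (?h W i) > m} \<union> ?I W)" by simp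
        also have "\<dots> = sum w {i\<in>I. card (?h W i) > m} + sum w (?I W)"
          using fI by (intro sum.union_disjoint) auto
        finally show ?thesis by simp
      qed
      have "sum w I - e = (\<Sum>W\<in>Pow X. bin_weight X (16 * q) W * (sum w I - e))"
        using sum_bin_weight[OF assms(2), of "16 * q"] by (simp add: sum_distrib_right[symmetric])
      also have "\<dots> = (\<Sum>W\<in>Pow X. bin_weight X (16 * q) W * (\<Sum>i\<in>{i\<in>I. card (?h W i) > m}. w i))
          + (\<Sum>W\<in>Pow X. bin_weight X (16 * q) W * (sum w (?I W) - e))"
        unfolding sum.distrib[symmetric] distrib_left[symmetric]
        by (intro sum.cong refl arg_cong2[where f = "(*)"] split)
      also have "\<dots> \<le> (1 / 2) ^ s
          + (\<Sum>W\<in>Pow X. bin_weight X (16 * q) W * bin_prob X (p - 16 * q) (\<lambda>F. \<exists>i\<in>I. h i \<subseteq> W \<union> F))"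
      proof (intro add_mono lost sum_mono mult_left_mono)
        fix W assume "W \<in> Pow X"
        show "sum w (?I W) - e \<le> bin_prob X (p - 16 * q) (\<lambda>F. \<exists>i\<in>I. h i \<subseteq> W \<union> F)"
        proof (rule order.trans[OF IH bin_prob_mono])
          fix F assume "\<exists>i\<in>?I W. ?h W i \<subseteq> F"
          then obtain i where i: "i \<in> I" "?h W i \<subseteq> F" by auto
          \<comment> \<open>The fragment of \<open>i\<close> is the missing part of some member
            \<open>g\<close>, so adding it to \<open>W\<close> completes \<open>h g\<close>,
            possibly not \<open>h i\<close>.\<close>
          obtain g where "g \<in> I" "?h W i = h g - W" using fragment_obtain[OF i(1), of h W] by metis
          then show "\<exists>i\<in>I. h i \<subseteq> W \<union> F" using i by auto
        qed (use p in auto)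
      qed (use p assms in \<open>auto simp: bin_weight_nonneg\<close>)
      also have "(\<Sum>W\<in>Pow X. bin_weight X (16 * q) W * bin_prob X (p - 16 * q) (\<lambda>F. \<exists>i\<in>I. h i \<subseteq> W \<union> F))
          \<le> bin_prob X p (\<lambda>F. \<exists>i\<in>I. h i \<subseteq> F)"
      proof (rule bin_prob_two_rounds)
        fix A B :: "'a set" assume "A \<subseteq> B" "\<exists>i\<in>I. h i \<subseteq> A"
        then show "\<exists>i\<in>I. h i \<subseteq> B" by blast
      qed (use assms p Suc.prems in auto)
      finally show ?thesis by (simp add: e_def algebra_simps)
    qed
  qed
  from this[of I h "s * 2 ^ j" p] assms show ?thesis by auto
qed

section \<open>Random matchings built edge by edge\<close>

text \<open>Total probability with the conditional probability bounded by a combination of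
  indicators. Nonnegative integrals avoid any integrability side condition.\<close>

lemma prob_bind_pmf_le:
  assumes "finite J" "\<And>j. j \<in> J \<Longrightarrow> 0 \<le> c j"
    and "\<And>x. x \<in> set_pmf p \<Longrightarrow> measure_pmf.prob (f x) A \<le> (\<Sum>j\<in>J. c j * indicator (B j) x)"
  shows "measure_pmf.prob (bind_pmf p f) A \<le> (\<Sum>j\<in>J. c j * measure_pmf.prob p (B j))"
proof -
  have "ennreal (measure_pmf.prob (bind_pmf p f) A) = (\<integral>\<^sup>+x. ennreal (measure_pmf.prob (f x) A) \<partial>measure_pmf p)"
    by (simp add: measure_pmf.emeasure_eq_measure[symmetric])
  also have "\<dots> \<le> (\<integral>\<^sup>+x. (\<Sum>j\<in>J. ennreal (c j) * indicator (B j) x) \<partial>measure_pmf p)"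
  proof (rule nn_integral_mono_AE, rule AE_pmfI)
    fix x assume "x \<in> set_pmf p"
    then have "ennreal (measure_pmf.prob (f x) A) \<le> ennreal (\<Sum>j\<in>J. c j * indicator (B j) x)"
      using assms(3) by (intro ennreal_leI) auto
    also have "\<dots> = (\<Sum>j\<in>J. ennreal (c j * indicator (B j) x))"
      using assms(2) by (intro sum_ennreal[symmetric]) auto
    also have "\<dots> = (\<Sum>j\<in>J. ennreal (c j) * indicator (B j) x)"
      by (intro sum.cong refl) (auto simp: indicator_def)
    finally show "ennreal (measure_pmf.prob (f x) A) \<le> (\<Sum>j\<in>J. ennreal (c j) * indicator (B j) x)" .
  qed
  also have "\<dots> = (\<Sum>j\<in>J. ennreal (c j) * emeasure (measure_pmf p) (B j))"
    by (simp add: nn_integral_sum nn_integral_cmult)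
  also have "\<dots> = (\<Sum>j\<in>J. ennreal (c j * measure_pmf.prob p (B j)))"
    using assms(2) by (intro sum.cong refl) (simp add: measure_pmf.emeasure_eq_measure ennreal_mult)
  also have "\<dots> = ennreal (\<Sum>j\<in>J. c j * measure_pmf.prob p (B j))"
    using assms(2) by (intro sum_ennreal) auto
  finally show ?thesis
    using assms(2) by (subst (asm) ennreal_le_iff) (auto intro: sum_nonneg)
qed

text \<open>The bound may depend on the edge, because inserting random edges one at a time raises it
  only for the edges that were candidates.\<close>

definition spread_pmf :: "'e set pmf \<Rightarrow> ('e \<Rightarrow> real) \<Rightarrow> bool" where
  "spread_pmf P Q \<longleftrightarrow> (\<forall>S. finite S \<longrightarrow> measure_pmf.prob P {M. S \<subseteq> M} \<le> prod Q S)"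

lemma spread_pmf_return_empty:
  assumes "\<And>e. 0 \<le> Q e"
  shows "spread_pmf (return_pmf {}) Q"
proof -
  have "indicator {M. S \<subseteq> M} {} \<le> prod Q S" for S :: "'a set"
    using assms by (cases "S = {}") (auto intro: prod_nonneg)
  then show ?thesis by (auto simp: spread_pmf_def)
qed

text \<open>A set contained in no matching of the support has probability 0, so the bounds have to
  be compared only on edges that occur.\<close>

lemma spread_pmf_mono:
  assumes "spread_pmf P Q" "\<And>e. 0 \<le> Q e" "\<And>e M. M \<in> set_pmf P \<Longrightarrow> e \<in> M \<Longrightarrow> Q e \<le> Q' e" "\<And>e. 0 \<le> Q' e"
  shows "spread_pmf P Q'"
  unfolding spread_pmf_def
proof (intro allI impI)
  fix S :: "'a set" assume S: "finite S"
  show "measure_pmf.prob P {M. S \<subseteq> M} \<le> prod Q' S"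
  proof (cases "\<exists>M\<in>set_pmf P. S \<subseteq> M")
    case True
    have "measure_pmf.prob P {M. S \<subseteq> M} \<le> prod Q S" using assms(1) S by (auto simp: spread_pmf_def)
    also have "\<dots> \<le> prod Q' S" using True assms by (intro prod_mono) blast
    finally show ?thesis .
  next
    case False
    then have "measure_pmf.prob P {M. S \<subseteq> M} = 0" by (auto simp: measure_pmf_zero_iff)
    then show ?thesis using assms by (simp add: prod_nonneg)
  qed
qed

text \<open>Expanding the product on the right gives nonnegative terms; the left side keeps those
  with at most one factor \<open>b\<close>.\<close>

lemma prod_add_ge_linear:
  fixes Q b :: "'e \<Rightarrow> real"
  assumes "finite S" "\<And>e. 0 \<le> Q e" "\<And>e. 0 \<le> b e"
  shows "prod Q S + (\<Sum>e\<in>S. b e * prod Q (S - {e})) \<le> (\<Prod>e\<in>S. Q e + b e)"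
  using assms(1)
proof (induction S)
  case (insert x S)
  have "(\<Sum>e\<in>S. b e * prod Q (insert x S - {e})) = (\<Sum>e\<in>S. Q x * (b e * prod Q (S - {e})))"
  proof (intro sum.cong refl)
    fix e assume "e \<in> S"
    then have "insert x S - {e} = insert x (S - {e})" "x \<notin> S - {e}" using insert by auto
    then show "b e * prod Q (insert x S - {e}) = Q x * (b e * prod Q (S - {e}))"
      using insert by simp
  qed
  then have "prod Q (insert x S) + (\<Sum>e\<in>insert x S. b e * prod Q (insert x S - {e}))
     = Q x * (prod Q S + (\<Sum>e\<in>S. b e * prod Q (S - {e}))) + b x * prod Q S"
    using insert by (simp add: sum_distrib_left algebra_simps)
  also have "\<dots> \<le> Q x * (\<Prod>e\<in>S. Q e + b e) + b x * (\<Prod>e\<in>S. Q e + b e)"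
    using insert assms by (intro add_mono mult_left_mono prod_mono) auto
  also have "\<dots> = (\<Prod>e\<in>insert x S. Q e + b e)" using insert by (simp add: algebra_simps)
  finally show ?case .
qed auto

text \<open>If \<open>S\<close> is covered after the insertion, then either it was covered before,
  or exactly one edge \<open>e\<close> was missing and was drawn, which has conditional probability
  at most \<open>1 / a\<close>. Summing over \<open>e\<close> gives the linear part of the product
  of the increased bounds.\<close>

lemma spread_pmf_insert_random:
  fixes P :: "'e set pmf"
  assumes P: "spread_pmf P Q" "\<And>e. 0 \<le> Q e"
    and cand: "\<And>M. M \<in> set_pmf P \<Longrightarrow> finite (C M)" "\<And>M. M \<in> set_pmf P \<Longrightarrow> C M \<subseteq> F"
      "\<And>M. M \<in> set_pmf P \<Longrightarrow> a \<le> real (card (C M))" and a: "0 < a"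
  obtains P' where "set_pmf P' = {insert e M |e M. M \<in> set_pmf P \<and> e \<in> C M}"
    "spread_pmf P' (\<lambda>e. Q e + indicator F e / a)"
proof
  define P' where "P' = bind_pmf P (\<lambda>M. map_pmf (\<lambda>e. insert e M) (pmf_of_set (C M)))"
  have ne: "C M \<noteq> {}" if "M \<in> set_pmf P" for M using cand(3)[OF that] a by auto
  show "set_pmf P' = {insert e M |e M. M \<in> set_pmf P \<and> e \<in> C M}"
    using ne cand(1) by (fastforce simp: P'_def)
  show "spread_pmf P' (\<lambda>e. Q e + indicator F e / a)"
    unfolding spread_pmf_def
  proof (intro allI impI)
    fix S :: "'e set" assume S: "finite S"
    let ?b = "\<lambda>e. indicator F e / a"
    \<comment> \<open>\<open>None\<close> stands for the event that \<open>S\<close> is already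
      covered, \<open>Some e\<close> for the event that at most \<open>e\<close> is missing.\<close>
    let ?c = "\<lambda>x. case x of None \<Rightarrow> 1 | Some e \<Rightarrow> ?b e"
    let ?B = "\<lambda>x. case x of None \<Rightarrow> {M. S \<subseteq> M} | Some e \<Rightarrow> {M. S - {e} \<subseteq> M}"
    have sum_opt: "(\<Sum>j\<in>insert None (Some ` S). g j) = g None + (\<Sum>e\<in>S. g (Some e))" for g :: "'e option \<Rightarrow> real"
      using S by (subst sum.insert) (auto simp: sum.reindex)
    have b: "0 \<le> ?b e" for e using a by simp
    have "measure_pmf.prob P' {M. S \<subseteq> M} \<le> (\<Sum>j\<in>insert None (Some ` S). ?c j * measure_pmf.prob P (?B j))"
      unfolding P'_def
    proof (rule prob_bind_pmf_le)
      fix M assume M: "M \<in> set_pmf P"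
      let ?p = "measure_pmf.prob (map_pmf (\<lambda>e. insert e M) (pmf_of_set (C M))) {M'. S \<subseteq> M'}"
      show "?p \<le> (\<Sum>j\<in>insert None (Some ` S). ?c j * indicator (?B j) M)"
      proof (cases "S \<subseteq> M")
        case True
        have "?p \<le> 1" by simp
        also have "\<dots> \<le> (\<Sum>j\<in>insert None (Some ` S). ?c j * indicator (?B j) M)"
          unfolding sum_opt using True a by (auto intro!: sum_nonneg)
        finally show ?thesis .
      next
        case False
        have p: "?p = real (card {e\<in>C M. S \<subseteq> insert e M}) / real (card (C M))"
          using ne[OF M] cand(1)[OF M]
          by (simp add: measure_map_pmf measure_pmf_of_set vimage_def Int_def)
        show ?thesis
        proof (cases "\<exists>e\<in>C M. S \<subseteq> insert e M")
          case True
          then obtain e where e: "e \<in> C M" "S \<subseteq> insert e M" by auto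
          then have "e \<in> S" "e \<notin> M" using False by auto
          \<comment> \<open>If \<open>S\<close> is not contained in \<open>M\<close>, only one
            candidate can complete it.\<close>
          have "{e\<in>C M. S \<subseteq> insert e M} \<subseteq> {e}" using \<open>e \<in> S\<close> \<open>e \<notin> M\<close> by auto
          then have "card {e\<in>C M. S \<subseteq> insert e M} \<le> 1" using card_mono[of "{e}"] by fastforce
          then have "?p \<le> 1 / a"
            unfolding p using cand(3)[OF M] a by (intro frac_le) auto
          also have "\<dots> = ?b e * indicator {M. S - {e} \<subseteq> M} M"
          proof -
            have "e \<in> F" "S - {e} \<subseteq> M" using e cand(2)[OF M] by auto
            then show ?thesis by simp
          qed
          also have "\<dots> \<le> (\<Sum>e\<in>S. ?b e * indicator {M. S - {e} \<subseteq> M} M)"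
            using \<open>e \<in> S\<close> S a by (intro member_le_sum) auto
          finally show ?thesis unfolding sum_opt using False by simp
        next
          case no: False
          then have "{e\<in>C M. S \<subseteq> insert e M} = {}" by blast
          then have "?p = 0" unfolding p by (simp only: card.empty of_nat_0 div_0)
          then show ?thesis unfolding sum_opt using a by (auto intro!: add_nonneg_nonneg sum_nonneg)
        qed
      qed
    qed (use S b in auto)
    also have "\<dots> = measure_pmf.prob P {M. S \<subseteq> M} + (\<Sum>e\<in>S. ?b e * measure_pmf.prob P {M. S - {e} \<subseteq> M})"
      unfolding sum_opt by simp
    also have "\<dots> \<le> prod Q S + (\<Sum>e\<in>S. ?b e * prod Q (S - {e}))"
      using P S b by (intro add_mono sum_mono mult_left_mono) (auto simp: spread_pmf_def)
    also have "\<dots> \<le> (\<Prod>e\<in>S. Q e + ?b e)"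
      using S P(2) b by (rule prod_add_ge_linear)
    finally show "measure_pmf.prob P' {M. S \<subseteq> M} \<le> (\<Prod>e\<in>S. Q e + ?b e)" .
  qed
qed

definition matching :: "'a set set \<Rightarrow> bool" where
  "matching M \<longleftrightarrow> (\<forall>e\<in>M. \<forall>f\<in>M. e \<noteq> f \<longrightarrow> e \<inter> f = {})"

lemma matching_insert: "matching M \<Longrightarrow> e \<inter> \<Union>M = {} \<Longrightarrow> matching (insert e M)"
  unfolding matching_def by blast

lemma card_Union_le:
  assumes "finite M" "\<And>e. e \<in> M \<Longrightarrow> card e = 2"
  shows "finite (\<Union>M)" "card (\<Union>M) \<le> 2 * card M"
proof -
  have fin: "finite e" if "e \<in> M" for e using assms(2)[OF that] by (simp add: card_ge_0_finite)
  then show "finite (\<Union>M)" using assms(1) by auto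
  have "card (\<Union>M) \<le> (\<Sum>e\<in>M. card e)" using card_Union_le_sum_card by blast
  also have "\<dots> = 2 * card M" using assms by simp
  finally show "card (\<Union>M) \<le> 2 * card M" .
qed

text \<open>The at most \<open>2 * m\<close> vertices used so far meet at most
  \<open>2 * m * D\<close> edges, so every choice has at least \<open>m * a\<close> candidates and
  contributes \<open>1 / (m * a)\<close>. A complete run contributes \<open>1 / a\<close>, whatever
  the positive number \<open>m\<close> is.\<close>

lemma greedy_matching_pmf:
  fixes E :: "'a set set"
  assumes E: "finite E" "\<And>e. e \<in> E \<Longrightarrow> card e = 2"
    and deg: "\<And>v. real (card {e\<in>E. v \<in> e}) \<le> D"
    and many: "real m * (2 * D + a) \<le> real (card E)" and a: "0 < a" and D: "0 \<le> D" and i: "i \<le> m"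
  shows "\<exists>P. set_pmf P \<subseteq> {M. M \<subseteq> E \<and> matching M \<and> card M = i} \<and> spread_pmf P (\<lambda>_. real i / (real m * a))"
  using i
proof (induction i)
  case 0
  then show ?case
    by (intro exI[of _ "return_pmf {}"]) (auto simp: spread_pmf_return_empty matching_def)
next
  case (Suc i)
  then obtain P where P: "set_pmf P \<subseteq> {M. M \<subseteq> E \<and> matching M \<and> card M = i}"
    "spread_pmf P (\<lambda>_. real i / (real m * a))" by auto
  define C where "C M = {e\<in>E. e \<inter> \<Union>M = {}}" for M
  have m: "0 < m" using Suc by simp
  have big: "real m * a \<le> real (card (C M))" if "M \<in> set_pmf P" for M
  proof -
    have M: "M \<subseteq> E" "card M = i" using that P by auto
    then have "finite M" using E finite_subset by blast
    then have U: "finite (\<Union>M)" "card (\<Union>M) \<le> 2 * i" using card_Union_le[of M] M E(2) by auto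
    have "E - C M = (\<Union>v\<in>\<Union>M. {e\<in>E. v \<in> e})" by (auto simp: C_def)
    then have "real (card (E - C M)) \<le> (\<Sum>v\<in>\<Union>M. real (card {e\<in>E. v \<in> e}))"
      using card_UN_le[OF U(1), of "\<lambda>v. {e\<in>E. v \<in> e}"] by (simp flip: of_nat_sum)
    also have "\<dots> \<le> (\<Sum>v\<in>\<Union>M. D)" by (intro sum_mono deg)
    also have "\<dots> \<le> real (2 * m) * D" using U(2) Suc.prems D by (simp add: mult_right_mono)
    finally have "real (card (E - C M)) \<le> 2 * real m * D" by simp
    moreover have "real (card (E - C M)) = real (card E) - real (card (C M))"
      using E by (subst card_Diff_subset) (auto simp: C_def card_mono of_nat_diff)
    ultimately show ?thesis using many by (simp add: algebra_simps)
  qed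
  obtain P' where P': "set_pmf P' = {insert e M |e M. M \<in> set_pmf P \<and> e \<in> C M}"
    "spread_pmf P' (\<lambda>e. real i / (real m * a) + indicator UNIV e / (real m * a))"
  proof (rule spread_pmf_insert_random[OF P(2), where C = C and F = UNIV and a = "real m * a"])
    show "finite (C M)" for M using E by (auto simp: C_def)
  qed (use big m a in auto)
  have "set_pmf P' \<subseteq> {M. M \<subseteq> E \<and> matching M \<and> card M = Suc i}"
  proof
    fix M' assume "M' \<in> set_pmf P'"
    then obtain e M where eM: "M' = insert e M" "M \<in> set_pmf P" "e \<in> C M" using P' by auto
    then have M: "M \<subseteq> E" "matching M" "card M = i" "finite M" using P E finite_subset by blast+
    have e: "e \<in> E" "e \<inter> \<Union>M = {}" using eM by (auto simp: C_def)
    have "e \<noteq> {}" using E(2)[OF e(1)] by auto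
    then have "e \<notin> M" using e by auto
    then show "M' \<in> {M. M \<subseteq> E \<and> matching M \<and> card M = Suc i}"
      using eM M e by (auto intro: matching_insert)
  qed
  moreover have "spread_pmf P' (\<lambda>_. real (Suc i) / (real m * a))"
    using P'(2) by (simp add: add_divide_distrib add.commute)
  ultimately show ?case by blast
qed

text \<open>The hubs choose partners one after another. \<open>T h\<close> loses at most
  \<open>2 * i\<close> vertices to the initial matching and one to each earlier hub, as it contains
  no hubs itself; so \<open>a\<close> partners stay free. All candidates of \<open>h\<close> contain
  \<open>h\<close>, so only edges through \<open>h\<close> gain \<open>1 / a\<close>, and this
  accumulates to \<open>card (e \<inter> H) / a\<close>.\<close>

lemma hub_matching_pmf:
  fixes E :: "'a set set"
  assumes E: "finite E" "\<And>e. e \<in> E \<Longrightarrow> card e = 2"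
    and P0: "set_pmf P0 \<subseteq> {M. M \<subseteq> E \<and> matching M \<and> card M = i \<and> \<Union>M \<inter> H = {}}"
    and sp: "spread_pmf P0 Q" and Q: "\<And>e. 0 \<le> Q e" and a: "0 < a"
    and H: "finite H" and T: "\<And>h. h \<in> H \<Longrightarrow> finite (T h)" "\<And>h. h \<in> H \<Longrightarrow> T h \<inter> H = {}"
      "\<And>h x. h \<in> H \<Longrightarrow> x \<in> T h \<Longrightarrow> {h, x} \<in> E"
      "\<And>h. h \<in> H \<Longrightarrow> 2 * real i + real (card H) + a \<le> real (card (T h))"
  shows "\<exists>P. set_pmf P \<subseteq> {M. M \<subseteq> E \<and> matching M \<and> card M = i + card H} \<and>
    spread_pmf P (\<lambda>e. Q e + real (card (e \<inter> H)) / a)"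
proof -
  have "\<exists>P. set_pmf P \<subseteq> {M. M \<subseteq> E \<and> matching M \<and> card M = i + card G \<and> \<Union>M \<inter> H \<subseteq> G \<and>
        (\<forall>h\<in>H. card (\<Union>M \<inter> T h) \<le> 2 * i + card G)} \<and>
      spread_pmf P (\<lambda>e. Q e + real (card (e \<inter> G)) / a)" if "G \<subseteq> H" for G
    using finite_subset[OF that H] that
  proof (induction G rule: finite_induct)
    case empty
    have "card (\<Union>M \<inter> T h) \<le> 2 * i" if "M \<in> set_pmf P0" for M h
    proof -
      have M: "M \<subseteq> E" "card M = i" using that P0 by auto
      then have "finite M" using E finite_subset by blast
      then have U: "finite (\<Union>M)" "card (\<Union>M) \<le> 2 * i" using card_Union_le[of M] M E(2) by auto
      then show ?thesis by (meson Int_lower1 card_mono le_trans)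
    qed
    moreover have "M \<subseteq> E" "matching M" "card M = i" "\<Union>M \<inter> H = {}" if "M \<in> set_pmf P0" for M
      using P0 that by auto
    ultimately have *: "M \<in> {M. M \<subseteq> E \<and> matching M \<and> card M = i + card {} \<and> \<Union>M \<inter> H \<subseteq> {} \<and>
        (\<forall>h\<in>H. card (\<Union>M \<inter> T h) \<le> 2 * i + card {})}" if "M \<in> set_pmf P0" for M
      using that by simp
    show ?case
    proof (intro exI conjI)
      show "spread_pmf P0 (\<lambda>e. Q e + real (card (e \<inter> {})) / a)" using sp by simp
    qed (use * in blast)
  next
    case (insert h G)
    then obtain P where P: "set_pmf P \<subseteq> {M. M \<subseteq> E \<and> matching M \<and> card M = i + card G \<and> \<Union>M \<inter> H \<subseteq> G \<and>
        (\<forall>h\<in>H. card (\<Union>M \<inter> T h) \<le> 2 * i + card G)}"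
      "spread_pmf P (\<lambda>e. Q e + real (card (e \<inter> G)) / a)" by auto
    have h: "h \<in> H" "h \<notin> G" using insert by auto
    define C where "C M = (\<lambda>x. {h, x}) ` (T h - \<Union>M)" for M
    have cardG: "card G < card H"
      using h insert H by (intro psubset_card_mono) auto
    have big: "a \<le> real (card (C M))" if "M \<in> set_pmf P" for M
    proof -
      have "inj_on (\<lambda>x. {h, x}) (T h - \<Union>M)" by (auto simp: inj_on_def doubleton_eq_iff)
      then have "card (C M) = card (T h - \<Union>M)" unfolding C_def by (rule card_image)
      also have "\<dots> = card (T h) - card (\<Union>M \<inter> T h)"
        using T(1)[OF h(1)] by (subst card_Diff_subset_Int) (auto simp: Int_commute)
      finally have "real (card (T h)) \<le> real (card (C M)) + real (card (\<Union>M \<inter> T h))" by linarith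
      moreover have "card (\<Union>M \<inter> T h) \<le> 2 * i + card G" using that P h by auto
      ultimately show ?thesis using T(4)[OF h(1)] cardG by linarith
    qed
    obtain P' where P': "set_pmf P' = {insert e M |e M. M \<in> set_pmf P \<and> e \<in> C M}"
      "spread_pmf P' (\<lambda>e. Q e + real (card (e \<inter> G)) / a + indicator {e. h \<in> e} e / a)"
    proof (rule spread_pmf_insert_random[OF P(2), where C = C and F = "{e. h \<in> e}" and a = a])
      show "finite (C M)" for M using T(1)[OF h(1)] by (auto simp: C_def)
    qed (use big a Q in \<open>auto simp: C_def\<close>)
    have "set_pmf P' \<subseteq> {M. M \<subseteq> E \<and> matching M \<and> card M = i + card (insert h G) \<and> \<Union>M \<inter> H \<subseteq> insert h G \<and>
        (\<forall>g\<in>H. card (\<Union>M \<inter> T g) \<le> 2 * i + card (insert h G))}"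
    proof
      fix M' assume "M' \<in> set_pmf P'"
      then obtain e M where eM: "M' = insert e M" "M \<in> set_pmf P" "e \<in> C M" using P' by auto
      then obtain x where x: "x \<in> T h" "x \<notin> \<Union>M" "e = {h, x}" by (auto simp: C_def)
      have "M \<in> {M. M \<subseteq> E \<and> matching M \<and> card M = i + card G \<and> \<Union>M \<inter> H \<subseteq> G \<and>
        (\<forall>h\<in>H. card (\<Union>M \<inter> T h) \<le> 2 * i + card G)}" using eM P by auto
      then have M: "M \<subseteq> E" "matching M" "card M = i + card G" "\<Union>M \<inter> H \<subseteq> G"
        "\<And>h. h \<in> H \<Longrightarrow> card (\<Union>M \<inter> T h) \<le> 2 * i + card G" by auto
      have fM: "finite M" using M E finite_subset by blast
      have "h \<notin> \<Union>M" using M(4) h by auto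
      then have e: "e \<inter> \<Union>M = {}" "e \<notin> M" using x by auto
      have "x \<notin> H" using T(2)[OF h(1)] x by auto
      have "card (\<Union>M' \<inter> T g) \<le> Suc (card (\<Union>M \<inter> T g))" if g: "g \<in> H" for g
      proof -
        have "h \<notin> T g" using T(2)[OF g] h by auto
        then have "\<Union>M' \<inter> T g \<subseteq> insert x (\<Union>M \<inter> T g)" using eM(1) x(3) by auto
        moreover have fin: "finite (\<Union>M \<inter> T g)" using T(1)[OF g] by auto
        ultimately have "card (\<Union>M' \<inter> T g) \<le> card (insert x (\<Union>M \<inter> T g))" by (intro card_mono) auto
        also have "\<dots> \<le> Suc (card (\<Union>M \<inter> T g))" using fin by (simp add: card_insert_if)
        finally show ?thesis .
      qed
      note step = this
      have "card (\<Union>M' \<inter> T g) \<le> 2 * i + card (insert h G)" if "g \<in> H" for g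
        using step[OF that] M(5)[OF that] insert(1,2) by simp
      moreover have "M' \<subseteq> E" using eM(1) M(1) T(3)[OF h(1) x(1)] x(3) by simp
      moreover have "matching M'" unfolding eM(1) using M(2) e(1) by (rule matching_insert)
      moreover have "card M' = i + card (insert h G)" using eM(1) e(2) fM M(3) insert(1,2) by simp
      moreover have "\<Union>M' \<inter> H \<subseteq> insert h G" using M(4) eM(1) x(3) \<open>x \<notin> H\<close> by auto
      ultimately show "M' \<in> {M. M \<subseteq> E \<and> matching M \<and> card M = i + card (insert h G) \<and> \<Union>M \<inter> H \<subseteq> insert h G \<and>
        (\<forall>g\<in>H. card (\<Union>M \<inter> T g) \<le> 2 * i + card (insert h G))}"
        by (intro CollectI conjI ballI)
    qed
    moreover have "Q e + real (card (e \<inter> G)) / a + indicator {e. h \<in> e} e / a = Q e + real (card (e \<inter> insert h G)) / a" for e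
    proof (cases "h \<in> e")
      case True
      then have "e \<inter> insert h G = insert h (e \<inter> G)" by auto
      then show ?thesis using True h insert by (simp add: add_divide_distrib)
    qed auto
    then have "spread_pmf P' (\<lambda>e. Q e + real (card (e \<inter> insert h G)) / a)" using P'(2) by presburger
    ultimately show ?case by blast
  qed
  from this[of H] show ?thesis by fast
qed

section \<open>Spread matchings in graphs of given minimum degree\<close>

definition nbrs :: "'a set set \<Rightarrow> 'a \<Rightarrow> 'a set" where
  "nbrs E v = {x. {v, x} \<in> E}"

definition induced :: "'a set set \<Rightarrow> 'a set \<Rightarrow> 'a set set" where
  "induced E A = {e\<in>E. e \<subseteq> A}"

locale fin_graph =
  fixes V :: "'a set" and E :: "'a set set"
  assumes finV: "finite V" and edges: "\<And>e. e \<in> E \<Longrightarrow> e \<subseteq> V \<and> card e = 2"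
begin

lemma finE: "finite E"
  using finV edges by (intro finite_subset[of E "Pow V"]) auto

lemma nbrs_subset: "nbrs E v \<subseteq> V"
  using edges by (auto simp: nbrs_def)

lemma finite_nbrs: "finite (nbrs E v)"
  using nbrs_subset finV finite_subset by blast

lemma card_nbrs: "card (nbrs E v) = card {e\<in>E. v \<in> e}"
proof -
  have "{e\<in>E. v \<in> e} = (\<lambda>x. {v, x}) ` nbrs E v"
  proof (intro set_eqI iffI)
    fix e assume e: "e \<in> {e\<in>E. v \<in> e}"
    then have "card e = 2" using edges by blast
    then obtain a b where "e = {a, b}" by (auto simp: card_2_iff)
    with e show "e \<in> (\<lambda>x. {v, x}) ` nbrs E v" by (auto simp: nbrs_def insert_commute)
  qed (auto simp: nbrs_def)
  moreover have "inj_on (\<lambda>x. {v, x}) (nbrs E v)" by (auto simp: inj_on_def doubleton_eq_iff)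
  ultimately show ?thesis by (simp add: card_image)
qed

lemma subgraph: "F \<subseteq> E \<Longrightarrow> fin_graph V F"
  using finV edges by unfold_locales auto

lemma handshake: "(\<Sum>v\<in>V. card (nbrs E v)) = 2 * card E"
proof -
  have "(\<Sum>v\<in>V. card (nbrs E v)) = (\<Sum>v\<in>V. \<Sum>e\<in>E. of_bool (v \<in> e))"
    using finE by (simp add: card_nbrs Int_def)
  also have "\<dots> = (\<Sum>e\<in>E. card {v\<in>V. v \<in> e})"
    using finV by (subst sum.swap) (simp add: Int_def)
  also have "\<dots> = (\<Sum>e\<in>E. 2)"
  proof (intro sum.cong refl)
    fix e assume "e \<in> E"
    then have "{v\<in>V. v \<in> e} = e" using edges by auto
    then show "card {v\<in>V. v \<in> e} = 2" using edges \<open>e \<in> E\<close> by simp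
  qed
  finally show ?thesis by simp
qed

lemma handshake_le:
  assumes "A \<subseteq> V"
  shows "(\<Sum>v\<in>A. card (nbrs E v)) \<le> 2 * card E"
  unfolding handshake[symmetric] using assms finV by (intro sum_mono2) auto

lemma nbrs_induced: "v \<in> A \<Longrightarrow> nbrs (induced E A) v = nbrs E v \<inter> A"
  by (auto simp: nbrs_def induced_def)

lemma induced_graph: "fin_graph V (induced E A)"
  by (rule subgraph) (auto simp: induced_def)

lemma sum_nbrs_within:
  assumes "A \<subseteq> V"
  shows "(\<Sum>v\<in>A. card (nbrs E v \<inter> A)) = 2 * card (induced E A)"
proof -
  interpret I: fin_graph V "induced E A" by (rule induced_graph)
  have "(\<Sum>v\<in>A. card (nbrs E v \<inter> A)) = (\<Sum>v\<in>A. card (nbrs (induced E A) v))"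
    by (intro sum.cong refl) (simp add: nbrs_induced)
  also have "\<dots> = (\<Sum>v\<in>V. card (nbrs (induced E A) v))"
  proof (intro sum.mono_neutral_left finV assms ballI)
    fix v assume "v \<in> V - A"
    then have "nbrs (induced E A) v = {}" by (auto simp: nbrs_def induced_def)
    then show "card (nbrs (induced E A) v) = 0" by simp
  qed
  finally show ?thesis using I.handshake by simp
qed

section \<open>Extremal case: few vertices meeting almost all edges\<close>

text \<open>Write n for \<open>card V\<close>. A vertex outside \<open>Y\<close> has degree at least
  \<open>k\<close> but on average few neighbours outside \<open>Y\<close>; hence
  \<open>k - card Y\<close> is at most n / 10000. As \<open>card Y \<le> k\<close>, such a vertex
  misses no more vertices of \<open>Y\<close> than it has neighbours outside \<open>Y\<close>. Each
  vertex of \<open>Y - H\<close> is missed by more than n / 100 vertices, so double counting the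
  missing pairs gives \<open>card (Y - H)\<close> at most n / 150.\<close>

lemma extremal_hubs:
  fixes k :: nat
  assumes deg: "\<And>v. v \<in> V \<Longrightarrow> k \<le> card (nbrs E v)" and k: "3 * k \<le> card V" and V: "V \<noteq> {}"
    and Y: "Y \<subseteq> V" "card Y \<le> k" and sparse: "30000 * real (card (induced E (V - Y))) \<le> real (card V) ^ 2"
  defines "H \<equiv> {y\<in>Y. 100 * card ((V - Y) - nbrs E y) \<le> card V}"
  shows "100 * (k - card H) \<le> card V"
proof -
  let ?W = "V - Y" and ?n = "real (card V)"
  have n: "0 < ?n" using V finV by (simp add: card_gt_0_iff)
  have finY: "finite Y" and finW: "finite ?W" using Y finV finite_subset by auto
  have cW: "card ?W = card V - card Y" using finY Y by (simp add: card_Diff_subset)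
  have W23: "2 * card V \<le> 3 * card ?W" using cW Y k by linarith
  have two: "15000 * real (\<Sum>w\<in>?W. card (nbrs E w \<inter> ?W)) \<le> ?n ^ 2"
    using sum_nbrs_within[of ?W] sparse by simp
  have nb: "card (nbrs E w) = card (nbrs E w \<inter> ?W) + card (nbrs E w \<inter> Y)" for w
  proof -
    have "nbrs E w = (nbrs E w \<inter> ?W) \<union> (nbrs E w \<inter> Y)" using nbrs_subset by auto
    then have "card (nbrs E w) = card ((nbrs E w \<inter> ?W) \<union> (nbrs E w \<inter> Y))" by simp
    also have "\<dots> = card (nbrs E w \<inter> ?W) + card (nbrs E w \<inter> Y)"
      using finite_nbrs finY by (intro card_Un_disjoint) auto
    finally show ?thesis .
  qed
  have "card ?W * (k - card Y) = (\<Sum>w\<in>?W. k - card Y)" by simp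
  also have "\<dots> \<le> (\<Sum>w\<in>?W. card (nbrs E w \<inter> ?W))"
  proof (intro sum_mono)
    fix w assume "w \<in> ?W"
    then have "k \<le> card (nbrs E w)" using deg by auto
    moreover have "card (nbrs E w \<inter> Y) \<le> card Y" using finY by (intro card_mono) auto
    ultimately show "k - card Y \<le> card (nbrs E w \<inter> ?W)" using nb[of w] by linarith
  qed
  finally have "15000 * real (card ?W * (k - card Y)) \<le> ?n ^ 2" using two by (meson le_trans mult_left_mono of_nat_mono order.trans zero_le_numeral of_nat_le_iff)
  moreover have "?n * (10000 * real (k - card Y)) \<le> 15000 * real (card ?W * (k - card Y))"
  proof -
    have "2 * ?n \<le> 3 * real (card ?W)" using W23 by linarith
    then have "5000 * (2 * ?n) * real (k - card Y) \<le> 5000 * (3 * real (card ?W)) * real (k - card Y)"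
      by (intro mult_right_mono mult_left_mono) auto
    then show ?thesis by (simp add: mult_ac)
  qed
  ultimately have "?n * (10000 * real (k - card Y)) \<le> ?n * ?n" by (simp add: power2_eq_square)
  then have A: "10000 * real (k - card Y) \<le> ?n" using n by simp
  have "real (card (Y - H)) * ?n = (\<Sum>y\<in>Y - H. ?n)" by simp
  also have "\<dots> \<le> (\<Sum>y\<in>Y - H. 100 * real (card (?W - nbrs E y)))"
  proof (intro sum_mono)
    fix y assume "y \<in> Y - H"
    then have "card V < 100 * card (?W - nbrs E y)" by (auto simp: H_def)
    then show "?n \<le> 100 * real (card (?W - nbrs E y))" by linarith
  qed
  also have "\<dots> \<le> (\<Sum>y\<in>Y. 100 * real (card (?W - nbrs E y)))"
    using finY by (intro sum_mono2) auto
  also have "\<dots> = 100 * real (\<Sum>y\<in>Y. \<Sum>w\<in>?W. of_bool (w \<notin> nbrs E y))"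
  proof -
    have "card (?W - nbrs E y) = (\<Sum>w\<in>?W. of_bool (w \<notin> nbrs E y))" for y
      using finW by (simp add: Int_def set_diff_eq)
    then show ?thesis by (simp add: sum_distrib_left)
  qed
  also have "(\<Sum>y\<in>Y. \<Sum>w\<in>?W. of_bool (w \<notin> nbrs E y)) = (\<Sum>w\<in>?W. card (Y - nbrs E w))"
  proof (subst sum.swap, intro sum.cong refl)
    fix w
    have "(\<Sum>y\<in>Y. of_bool (w \<notin> nbrs E y)) = (\<Sum>y\<in>Y. (of_bool (y \<notin> nbrs E w) :: nat))"
      by (intro sum.cong refl) (simp add: nbrs_def insert_commute)
    also have "\<dots> = card (Y - nbrs E w)" using finY by (simp add: Int_def set_diff_eq)
    finally show "(\<Sum>y\<in>Y. of_bool (w \<notin> nbrs E y)) = card (Y - nbrs E w)" .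
  qed
  also have "real (\<Sum>w\<in>?W. card (Y - nbrs E w)) \<le> real (\<Sum>w\<in>?W. card (nbrs E w \<inter> ?W))"
  proof (intro of_nat_mono sum_mono)
    fix w assume "w \<in> ?W"
    then have "k \<le> card (nbrs E w)" using deg by auto
    moreover have "card (Y - nbrs E w) = card Y - card (nbrs E w \<inter> Y)"
      using finY by (subst card_Diff_subset_Int) (auto simp: Int_commute)
    ultimately show "card (Y - nbrs E w) \<le> card (nbrs E w \<inter> ?W)" using nb[of w] Y by linarith
  qed
  finally have "150 * (real (card (Y - H)) * ?n) \<le> ?n ^ 2" using two by simp
  then have "?n * (150 * real (card (Y - H))) \<le> ?n * ?n" by (simp add: power2_eq_square mult_ac)
  then have B: "150 * real (card (Y - H)) \<le> ?n" using n by simp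
  have "card H = card Y - card (Y - H)"
  proof -
    have "H \<subseteq> Y" by (auto simp: H_def)
    then show ?thesis using finY finite_subset[of H Y] card_mono[of Y H] by (simp add: card_Diff_subset)
  qed
  then have "k - card H \<le> (k - card Y) + card (Y - H)" by linarith
  then have "300 * real (k - card H) \<le> 3 * ?n" using A B by linarith
  then show ?thesis by linarith
qed

text \<open>The hubs \<open>H\<close> supply all but \<open>m\<close> edges. Without them the graph
  still has minimum degree at least \<open>m\<close>, but a greedy choice also needs bounded
  degrees, so up to \<open>m\<close> vertices of degree at least \<open>?n / 10\<close> become
  secondary hubs \<open>H'\<close>. The hubs have the most freedom and choose last, after the greedy
  edges and the secondary hubs.\<close>

lemma extremal_spread_matching:
  fixes k :: nat
  assumes deg: "\<And>v. v \<in> V \<Longrightarrow> k \<le> card (nbrs E v)" and k: "3 * k \<le> card V" and V: "V \<noteq> {}"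
    and Y: "Y \<subseteq> V" "card Y \<le> k" and sparse: "30000 * real (card (induced E (V - Y))) \<le> real (card V) ^ 2"
  shows "\<exists>P. set_pmf P \<subseteq> {M. M \<subseteq> E \<and> matching M \<and> card M = k} \<and> spread_pmf P (\<lambda>_. 100 / real (card V))"
proof -
  let ?n = "real (card V)" and ?W = "V - Y"
  define H where "H = {y\<in>Y. 100 * card (?W - nbrs E y) \<le> card V}"
  define m where "m = k - card H"
  have m: "100 * m \<le> card V" using extremal_hubs[OF assms] by (simp add: m_def H_def)
  have n: "0 < ?n" using V finV by (simp add: card_gt_0_iff)
  have HY: "H \<subseteq> Y" by (auto simp: H_def)
  have finY: "finite Y" using Y finV finite_subset by auto
  have finH: "finite H" using HY finY finite_subset by auto
  have cH: "card H \<le> k" "card H + m = k" using card_mono[OF finY HY] Y by (auto simp: m_def)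
  \<comment> \<open>Every hub of either kind will have at least \<open>a\<close> free partners, and
    the greedy phase \<open>m' * a\<close> free edges. One greedy contribution \<open>1 / a\<close>
    and two for the endpoints in each kind of hub add up to \<open>5 / a = 100 / ?n\<close>.\<close>
  define a where "a = ?n / 20"
  have a: "0 < a" using n by (simp add: a_def)
  define V1 where "V1 = V - H"
  interpret G1: fin_graph V "induced E V1" by (rule induced_graph)
  have deg1: "m \<le> card (nbrs (induced E V1) v)" if v: "v \<in> V1" for v
  proof -
    have "nbrs E v - H \<subseteq> nbrs E v \<inter> V1" using nbrs_subset by (auto simp: V1_def)
    then have "card (nbrs E v - H) \<le> card (nbrs (induced E V1) v)"
      using v finite_nbrs by (auto simp: nbrs_induced intro!: card_mono)
    moreover have "card (nbrs E v) - card H \<le> card (nbrs E v - H)" using finH by (rule diff_card_le_card_Diff)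
    ultimately show ?thesis using deg[of v] v cH by (auto simp: V1_def)
  qed
  define B where "B = {v\<in>V1. ?n / 10 \<le> real (card (nbrs (induced E V1) v))}"
  \<comment> \<open>If \<open>B\<close> has at least \<open>m\<close> vertices then
    \<open>m'\<close> becomes 0 and there is no greedy phase; otherwise \<open>H'\<close> is all of
    \<open>B\<close> and the degrees that remain are below \<open>?n / 10\<close>.\<close>
  obtain H' where H': "H' \<subseteq> B" "card H' = min m (card B)" "finite H'"
    using obtain_subset_with_card_n[of "min m (card B)" B] by auto
  define m' where "m' = m - card H'"
  have cm: "card H' + m' = m" using H' by (auto simp: m'_def)
  define V2 where "V2 = V1 - H'"
  interpret G2: fin_graph V "induced E V2" by (rule induced_graph)
  have H'V1: "H' \<subseteq> V1" using H' by (auto simp: B_def)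
  have sub21: "induced E V2 \<subseteq> induced E V1" by (auto simp: induced_def V2_def)
  have c1: "card V1 = card V - card H" using HY Y finH by (auto simp: V1_def card_Diff_subset)
  have c2: "card V2 = card V1 - card H'" using H'V1 H' by (auto simp: V2_def card_Diff_subset)
  have "\<exists>P. set_pmf P \<subseteq> {M. M \<subseteq> induced E V2 \<and> matching M \<and> card M = m'} \<and> spread_pmf P (\<lambda>_. real m' / (real m' * a))"
  proof (cases "m' = 0")
    case True
    then show ?thesis
      by (intro exI[of _ "return_pmf {}"]) (auto simp: spread_pmf_return_empty matching_def)
  next
    case False
    then have "H' = B" using H' cm
      by (intro card_subset_eq) (auto simp: B_def V1_def finV)
    have nb2: "nbrs (induced E V2) v \<subseteq> nbrs (induced E V1) v" for v
      using sub21 by (auto simp: nbrs_def)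
    show ?thesis
    proof (rule greedy_matching_pmf[where D = "?n / 10"])
      fix v
      show "real (card {e\<in>induced E V2. v \<in> e}) \<le> ?n / 10"
      proof (cases "v \<in> V2")
        case True
        then have "\<not> ?n / 10 \<le> real (card (nbrs (induced E V1) v))"
          using \<open>H' = B\<close> by (auto simp: V2_def B_def)
        moreover have "card (nbrs (induced E V2) v) \<le> card (nbrs (induced E V1) v)"
          using nb2 G1.finite_nbrs by (intro card_mono) auto
        ultimately show ?thesis using G2.card_nbrs[of v] by linarith
      next
        case False
        then have "{e\<in>induced E V2. v \<in> e} = {}" by (auto simp: induced_def)
        then have "card {e\<in>induced E V2. v \<in> e} = 0" by (simp only: card.empty)
        then show ?thesis using n by linarith
      qed
    next
      have d2: "m' \<le> card (nbrs E v \<inter> V2)" if v: "v \<in> V2" for v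
      proof -
        have v1: "v \<in> V1" using v by (auto simp: V2_def)
        have "nbrs E v \<inter> V2 = nbrs (induced E V1) v - H'"
          using v1 by (auto simp: nbrs_induced V2_def)
        moreover have "card (nbrs (induced E V1) v) - card H' \<le> card (nbrs (induced E V1) v - H')"
          using H'(3) by (rule diff_card_le_card_Diff)
        ultimately show ?thesis using deg1[OF v1] by (simp add: m'_def)
      qed
      have "card V2 * m' \<le> (\<Sum>v\<in>V2. card (nbrs E v \<inter> V2))"
        using sum_mono[of V2 "\<lambda>_. m'" "\<lambda>v. card (nbrs E v \<inter> V2)"] d2 by simp
      also have "\<dots> = 2 * card (induced E V2)"
        by (rule sum_nbrs_within) (auto simp: V2_def V1_def)
      finally have "real (card V2) * real m' \<le> 2 * real (card (induced E V2))"
        by (metis of_nat_le_iff of_nat_mult of_nat_numeral)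
      moreover have "2 * ?n / 3 * real m' \<le> real (card V2) * real m'"
      proof (intro mult_right_mono)
        \<comment> \<open>At most \<open>card H + m = k\<close> vertices have been removed, no more
          than a third of \<open>V\<close>.\<close>
        have "2 * card V \<le> 3 * card V2" using c1 c2 cH cm k by linarith
        then show "2 * ?n / 3 \<le> real (card V2)" by linarith
      qed auto
      ultimately have "?n * real m' \<le> 3 * real (card (induced E V2))" by simp
      moreover have "real m' * (2 * (?n / 10) + a) = ?n * real m' / 4" by (simp add: a_def algebra_simps)
      moreover have "0 \<le> ?n * real m'" by simp
      ultimately show "real m' * (2 * (?n / 10) + a) \<le> real (card (induced E V2))" by linarith
    qed (use G2.finE G2.edges a n in auto)
  qed
  then obtain P0 where P0: "set_pmf P0 \<subseteq> {M. M \<subseteq> induced E V2 \<and> matching M \<and> card M = m'}"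
    "spread_pmf P0 (\<lambda>_. real m' / (real m' * a))" by blast
  have "\<exists>P. set_pmf P \<subseteq> {M. M \<subseteq> induced E V1 \<and> matching M \<and> card M = m' + card H'} \<and>
    spread_pmf P (\<lambda>e. real m' / (real m' * a) + real (card (e \<inter> H')) / a)"
  proof (rule hub_matching_pmf[where T = "\<lambda>h. nbrs (induced E V1) h - H'"])
    show "set_pmf P0 \<subseteq> {M. M \<subseteq> induced E V1 \<and> matching M \<and> card M = m' \<and> \<Union>M \<inter> H' = {}}"
    proof
      fix M assume "M \<in> set_pmf P0"
      then have M: "M \<subseteq> induced E V2" "matching M" "card M = m'" using P0 by auto
      then have "\<Union>M \<subseteq> V2" by (auto simp: induced_def)
      then show "M \<in> {M. M \<subseteq> induced E V1 \<and> matching M \<and> card M = m' \<and> \<Union>M \<inter> H' = {}}"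
        using M sub21 by (auto simp: V2_def)
    qed
    fix h assume h: "h \<in> H'"
    have "card (nbrs (induced E V1) h) \<le> card (nbrs (induced E V1) h - H') + card H'"
      using H'(3) diff_card_le_card_Diff[of H' "nbrs (induced E V1) h"] by linarith
    then have "real (card (nbrs (induced E V1) h)) \<le> real (card (nbrs (induced E V1) h - H')) + real (card H')"
      by (simp flip: of_nat_add)
    moreover have "?n / 10 \<le> real (card (nbrs (induced E V1) h))" using h H' by (auto simp: B_def)
    moreover have "real (100 * (card H' + m')) \<le> ?n" using m cm by (simp only: of_nat_le_iff)
    then have "100 * real (card H') + 100 * real m' \<le> ?n" by simp
    ultimately show "2 * real m' + real (card H') + a \<le> real (card (nbrs (induced E V1) h - H'))"
      unfolding a_def by linarith
  qed (use G1.finE G1.edges G1.finite_nbrs a P0 H' in \<open>auto simp: nbrs_def\<close>)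
  then obtain P1 where P1: "set_pmf P1 \<subseteq> {M. M \<subseteq> induced E V1 \<and> matching M \<and> card M = m}"
    "spread_pmf P1 (\<lambda>e. real m' / (real m' * a) + real (card (e \<inter> H')) / a)"
    using cm by (auto simp: add.commute)
  have "\<exists>P. set_pmf P \<subseteq> {M. M \<subseteq> E \<and> matching M \<and> card M = m + card H} \<and>
    spread_pmf P (\<lambda>e. (real m' / (real m' * a) + real (card (e \<inter> H')) / a) + real (card (e \<inter> H)) / a)"
  proof (rule hub_matching_pmf[where T = "\<lambda>h. ?W \<inter> nbrs E h", OF _ _ _ P1(2)])
    show "set_pmf P1 \<subseteq> {M. M \<subseteq> E \<and> matching M \<and> card M = m \<and> \<Union>M \<inter> H = {}}"
    proof
      fix M assume "M \<in> set_pmf P1"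
      then have M: "M \<subseteq> induced E V1" "matching M" "card M = m" using P1 by auto
      then have "\<Union>M \<subseteq> V1" "M \<subseteq> E" by (auto simp: induced_def)
      then show "M \<in> {M. M \<subseteq> E \<and> matching M \<and> card M = m \<and> \<Union>M \<inter> H = {}}"
        using M by (auto simp: V1_def)
    qed
    fix h assume h: "h \<in> H"
    have "card ?W = card (?W \<inter> nbrs E h) + card (?W - nbrs E h)"
      using finV by (subst card_Un_disjoint[symmetric]) (auto intro: arg_cong[where f = card])
    moreover have "100 * card (?W - nbrs E h) \<le> card V" using h by (auto simp: H_def)
    moreover have "card ?W = card V - card Y" using finY Y by (simp add: card_Diff_subset)
    ultimately have "100 * real (card (?W \<inter> nbrs E h)) \<ge> 99 * ?n - 100 * real k" using Y by linarith
    then show "2 * real m + real (card H) + a \<le> real (card (?W \<inter> nbrs E h))"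
      using m cH k unfolding a_def by linarith
  qed (use finE edges finV finH a HY in \<open>auto simp: nbrs_def\<close>)
  then obtain P where P: "set_pmf P \<subseteq> {M. M \<subseteq> E \<and> matching M \<and> card M = k}"
    "spread_pmf P (\<lambda>e. (real m' / (real m' * a) + real (card (e \<inter> H')) / a) + real (card (e \<inter> H)) / a)"
    using cH by (auto simp: add.commute)
  have "spread_pmf P (\<lambda>_. 100 / ?n)"
  proof (rule spread_pmf_mono[OF P(2)])
    fix e M assume "M \<in> set_pmf P" "e \<in> M"
    then have "e \<in> E" using P(1) by auto
    then have "card e = 2" using edges by blast
    then have "finite e" by (simp add: card_ge_0_finite)
    then have "card (e \<inter> H') \<le> 2" "card (e \<inter> H) \<le> 2" using \<open>card e = 2\<close> card_mono[of e] by (metis Int_lower1)+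
    then have "real (card (e \<inter> H')) / a \<le> 2 / a" "real (card (e \<inter> H)) / a \<le> 2 / a"
      using a by (auto intro!: divide_right_mono)
    moreover have "real m' / (real m' * a) \<le> 1 / a" using a by (cases "m' = 0") auto
    moreover have "1 / a + 2 / a + 2 / a = 100 / ?n" by (simp add: a_def)
    ultimately show "real m' / (real m' * a) + real (card (e \<inter> H')) / a + real (card (e \<inter> H)) / a \<le> 100 / ?n"
      by linarith
  qed (use a in auto)
  with P(1) show ?thesis by blast
qed

end

section \<open>Structure of maximum matchings\<close>

lemma matching_subset: "matching M \<Longrightarrow> M' \<subseteq> M \<Longrightarrow> matching M'"
  unfolding matching_def by blast

lemma augment_matching:
  assumes M: "matching M" "finite M" and N: "matching N" "finite N" "{} \<notin> N"
    and R: "R \<subseteq> M" and disj: "\<Union>N \<inter> \<Union>(M - R) = {}"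
  shows "matching (M - R \<union> N)" "card (M - R \<union> N) = card M - card R + card N"
proof -
  have "e \<inter> f = {}" if "e \<in> N" "f \<in> M - R" for e f using that disj by auto
  then show "matching (M - R \<union> N)" using M(1) N(1) unfolding matching_def by (metis DiffD1 Int_commute Un_iff)
  have "(M - R) \<inter> N = {}"
  proof (rule ccontr)
    assume "(M - R) \<inter> N \<noteq> {}"
    then obtain e where "e \<in> M - R" "e \<in> N" by auto
    then have "e \<subseteq> \<Union>N \<inter> \<Union>(M - R)" by auto
    then show False using disj N(3) \<open>e \<in> N\<close> by auto
  qed
  then show "card (M - R \<union> N) = card M - card R + card N"
    using M N R finite_subset[OF R] by (subst card_Un_disjoint) (auto simp: card_Diff_subset)
qed

lemma other_element:
  assumes "2 \<le> card A"
  obtains x where "x \<in> A" "x \<noteq> y"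
proof -
  have "A \<noteq> {}" "\<not> A \<subseteq> {y}" using assms card_mono[of "{y}" A] by auto
  then show thesis using that by blast
qed

context fin_graph begin

lemma edge_neq: "{a, b} \<in> E \<Longrightarrow> a \<noteq> b"
  using edges[of "{a, b}"] by auto

text \<open>
  \<open>U\<close> is the set of unmatched vertices, \<open>Y\<close> consists of the matched vertices with at least two neighbours
  in \<open>U\<close>, and \<open>I - U\<close> of their partners; an edge inside \<open>I\<close> would yield an augmentation of \<open>M\<close>.
\<close>

lemma gallai_edmonds_weak:
  assumes M: "M \<subseteq> E" "matching M" and max: "\<And>M'. M' \<subseteq> E \<Longrightarrow> matching M' \<Longrightarrow> card M' \<le> card M"
  obtains U I Z Y where "U \<subseteq> I" "V = I \<union> Z \<union> Y" "I \<inter> Z = {}" "Y \<inter> (I \<union> Z) = {}"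
    "card U = card V - 2 * card M" "card Z + 2 * card Y \<le> 2 * card M"
    "induced E I = {}" "\<And>z. z \<in> Z \<Longrightarrow> card (nbrs E z \<inter> U) \<le> 1"
proof -
  have finM: "finite M" using M finE finite_subset by auto
  have medges: "e \<subseteq> V" "card e = 2" if "e \<in> M" for e using M edges that by auto
  define U where "U = V - \<Union>M"
  have UM: "\<Union>M \<subseteq> V" "finite (\<Union>M)" using medges finV finite_subset[of "\<Union>M" V] by auto
  \<comment> \<open>All augmentations have this form: \<open>R\<close> is exchanged for a matching
    \<open>N\<close> with one more edge that only uses vertices of \<open>R\<close> and unmatched
    ones.\<close>
  have no_aug: False if R: "R \<subseteq> M" and N: "N \<subseteq> E" "matching N" "card N = Suc (card R)" "\<Union>N \<subseteq> \<Union>R \<union> U" for R N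
  proof -
    have "\<Union>N \<inter> \<Union>(M - R) = {}"
    proof (rule ccontr)
      assume "\<Union>N \<inter> \<Union>(M - R) \<noteq> {}"
      then obtain x e where x: "x \<in> \<Union>N" "x \<in> e" "e \<in> M - R" by auto
      then have "x \<notin> U" by (auto simp: U_def)
      then obtain f where "f \<in> R" "x \<in> f" using N(4) x(1) by blast
      then have "e \<in> M" "f \<in> M" "e \<noteq> f" "e \<inter> f \<noteq> {}" using x R by auto
      then show False using M(2) by (simp add: matching_def)
    qed
    moreover have "{} \<notin> N" using N(1) edges[of "{}"] by auto
    moreover have "finite N" using N(1) finE finite_subset by auto
    ultimately have "matching (M - R \<union> N)" "card (M - R \<union> N) = card M - card R + card N"
      using augment_matching[of M N R] M finM R N by auto
    moreover have "M - R \<union> N \<subseteq> E" using M N by auto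
    moreover have "card R \<le> card M" using R finM by (intro card_mono)
    ultimately show False using max[of "M - R \<union> N"] N(3) by linarith
  qed
  \<comment> \<open>The augmenting path u, y, z, u'.\<close>
  have augA: False if "{y, z} \<in> M" "{y, u} \<in> E" "{z, u'} \<in> E" "u \<in> U" "u' \<in> U" "u \<noteq> u'" for y z u u'
  proof (rule no_aug[of "{{y, z}}" "{{y, u}, {z, u'}}"])
    have d: "y \<noteq> z" "y \<notin> U" "z \<notin> U" using that(1) M edge_neq by (auto simp: U_def)
    then have "{y, u} \<inter> {z, u'} = {}" using that by auto
    then show "matching {{y, u}, {z, u'}}" by (auto simp: matching_def)
    have "{y, u} \<noteq> {z, u'}" using \<open>{y, u} \<inter> {z, u'} = {}\<close> by auto
    then show "card {{y, u}, {z, u'}} = Suc (card {{y, z}})" by simp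
  qed (use that in auto)
  \<comment> \<open>The augmenting path u, y, z, z', y', u'.\<close>
  have augB: False if "{y, z} \<in> M" "{y', z'} \<in> M" "{y, z} \<noteq> {y', z'}" "{z, z'} \<in> E"
    "{y, u} \<in> E" "{y', u'} \<in> E" "u \<in> U" "u' \<in> U" "u \<noteq> u'" for y z y' z' u u'
  proof (rule no_aug[of "{{y, z}, {y', z'}}" "{{z, z'}, {y, u}, {y', u'}}"])
    have "{y, z} \<inter> {y', z'} = {}" using M(2) that(1-3) by (auto simp: matching_def)
    moreover have "y \<noteq> z" "y' \<noteq> z'" using that(1,2) M(1) edge_neq[of y z] edge_neq[of y' z'] by auto
    moreover have "y \<notin> U" "z \<notin> U" "y' \<notin> U" "z' \<notin> U" using that(1,2) by (auto simp: U_def)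
    moreover note \<open>u \<in> U\<close> \<open>u' \<in> U\<close> \<open>u \<noteq> u'\<close>
    ultimately have "z \<noteq> y" "z \<noteq> u" "z' \<noteq> y" "z' \<noteq> u" "z \<noteq> y'" "z \<noteq> u'" "z' \<noteq> y'" "z' \<noteq> u'"
      "y \<noteq> y'" "y \<noteq> u'" "u \<noteq> y'" "u \<noteq> u'"
      by blast+
    then have d: "{z, z'} \<inter> {y, u} = {}" "{z, z'} \<inter> {y', u'} = {}" "{y, u} \<inter> {y', u'} = {}"
      by simp_all
    then show "matching {{z, z'}, {y, u}, {y', u'}}" by (auto simp: matching_def)
    have "{z, z'} \<noteq> {y, u}" "{z, z'} \<noteq> {y', u'}" "{y, u} \<noteq> {y', u'}" using d by auto
    then show "card {{z, z'}, {y, u}, {y', u'}} = Suc (card {{y, z}, {y', z'}})" using that(3) by simp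
  qed (use that in auto)
  have augC: False if "{u, u'} \<in> E" "u \<in> U" "u' \<in> U" for u u'
    by (rule no_aug[of "{}" "{{u, u'}}"]) (use that in \<open>auto simp: matching_def\<close>)
  define Y where "Y = {y\<in>\<Union>M. 2 \<le> card (nbrs E y \<inter> U)}"
  define Z1 where "Z1 = {z. \<exists>y\<in>Y. {y, z} \<in> M}"
  define Z where "Z = \<Union>M - Y - Z1"
  have nb: "{y, u} \<in> E" "u \<in> U" if "u \<in> nbrs E y \<inter> U" for u y using that by (auto simp: nbrs_def)
  \<comment> \<open>Requiring two neighbours in \<open>U\<close> guarantees distinct endpoints for
    the augmenting path; so no edge of \<open>M\<close> has both ends in \<open>Y\<close>.\<close>
  have Z1Y: "False" if z: "z \<in> Z1" "z \<in> Y" for z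
  proof -
    obtain y where y: "y \<in> Y" "{y, z} \<in> M" using z by (auto simp: Z1_def)
    obtain u where u: "u \<in> nbrs E y \<inter> U" using y other_element[of "nbrs E y \<inter> U"] by (auto simp: Y_def)
    obtain u' where u': "u' \<in> nbrs E z \<inter> U" "u' \<noteq> u" using z other_element[of "nbrs E z \<inter> U"] by (auto simp: Y_def)
    show False using augA[OF y(2), of u u'] nb u u' by auto
  qed
  have Z1M: "Z1 \<subseteq> \<Union>M" by (auto simp: Z1_def)
  have YM: "Y \<subseteq> \<Union>M" by (auto simp: Y_def)
  have "card Y \<le> card Z1"
  proof -
    have ex: "\<exists>z. {y, z} \<in> M" if y: "y \<in> Y" for y
    proof -
      obtain e where e: "e \<in> M" "y \<in> e" using y YM by blast
      then obtain a b where "e = {a, b}" using medges(2)[OF e(1)] by (auto simp: card_2_iff)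
      then show ?thesis using e by (auto simp: insert_commute)
    qed
    then obtain g where g: "\<And>y. y \<in> Y \<Longrightarrow> {y, g y} \<in> M" by metis
    have "inj_on g Y"
    proof (rule inj_onI)
      fix a b assume ab: "a \<in> Y" "b \<in> Y" "g a = g b"
      then have "{a, g a} = {b, g a}" using g[of a] g[of b] M(2) unfolding matching_def by fastforce
      then show "a = b" by (auto simp: doubleton_eq_iff)
    qed
    moreover have "g ` Y \<subseteq> Z1" using g by (auto simp: Z1_def)
    ultimately show ?thesis using Z1M UM finite_subset[of Z1] by (intro card_inj_on_le) auto
  qed
  have finYZ: "finite Y" "finite Z1" using YM Z1M UM(2) by (auto intro: finite_subset)
  have "card (\<Union>M) = 2 * card M"
  proof -
    have "card (\<Union>M) = (\<Sum>e\<in>M. card e)"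
      using M(2) medges(2) by (intro card_Union_disjoint) (auto simp: matching_def pairwise_def disjnt_def intro: card_ge_0_finite)
    then show ?thesis using medges(2) by simp
  qed
  show thesis
  proof (rule that[of U "U \<union> Z1" Z Y])
    show "card U = card V - 2 * card M"
      unfolding U_def using UM \<open>card (\<Union>M) = 2 * card M\<close> by (simp add: card_Diff_subset)
    have "card Z = card (\<Union>M) - card Y - card Z1"
      unfolding Z_def using finYZ YM Z1M Z1Y UM
      by (subst card_Diff_subset) (auto simp: card_Diff_subset)
    moreover have "card (Y \<union> Z1) \<le> card (\<Union>M)" using UM YM Z1M by (intro card_mono) auto
    moreover have "card (Y \<union> Z1) = card Y + card Z1" using finYZ Z1Y by (intro card_Un_disjoint) auto
    ultimately show "card Z + 2 * card Y \<le> 2 * card M"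
      using \<open>card Y \<le> card Z1\<close> \<open>card (\<Union>M) = 2 * card M\<close> by linarith
    show "card (nbrs E z \<inter> U) \<le> 1" if "z \<in> Z" for z
      using that by (auto simp: Z_def Y_def)
    show "induced E (U \<union> Z1) = {}"
    proof (rule ccontr)
      assume "induced E (U \<union> Z1) \<noteq> {}"
      then obtain e where e: "e \<in> E" "e \<subseteq> U \<union> Z1" by (auto simp: induced_def)
      then obtain a b where ab: "e = {a, b}" using edges[OF e(1)] by (auto simp: card_2_iff)
      have UZ: False if uz: "{u, z} \<in> E" "u \<in> U" "z \<in> Z1" for u z
      proof -
        obtain y where y: "y \<in> Y" "{y, z} \<in> M" using uz by (auto simp: Z1_def)
        obtain u' where u': "u' \<in> nbrs E y \<inter> U" "u' \<noteq> u" using y other_element[of "nbrs E y \<inter> U"] by (auto simp: Y_def)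
        show False using augA[OF y(2), of u' u] nb[OF u'(1)] u' uz by (auto simp: insert_commute)
      qed
      have ZZ: False if z: "z \<in> Z1" "z' \<in> Z1" and zz: "{z, z'} \<in> E" for z z'
      proof -
        obtain y where y: "y \<in> Y" "{y, z} \<in> M" using z by (auto simp: Z1_def)
        obtain y' where y': "y' \<in> Y" "{y', z'} \<in> M" using z by (auto simp: Z1_def)
        obtain u where u: "u \<in> nbrs E y \<inter> U" using y other_element[of "nbrs E y \<inter> U"] by (auto simp: Y_def)
        obtain u' where u': "u' \<in> nbrs E y' \<inter> U" "u' \<noteq> u" using y' other_element[of "nbrs E y' \<inter> U"] by (auto simp: Y_def)
        have "z \<noteq> z'" using zz edge_neq by auto
        have "{y, z} \<noteq> {y', z'}"
        proof
          assume "{y, z} = {y', z'}"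
          then have "y = z'" using \<open>z \<noteq> z'\<close> by (auto simp: doubleton_eq_iff)
          then show False using Z1Y y z by auto
        qed
        then show False using augB[OF y(2) y'(2) _ zz, of u u'] nb u u' by auto
      qed
      show False using e ab augC[of a b] UZ[of a b] UZ[of b a] ZZ[of a b] by (auto simp: insert_commute)
    qed
  qed (use Z1Y Z1M YM UM in \<open>auto simp: U_def Z_def\<close>)
qed

text \<open>Write n for \<open>card V\<close> and \<open>F\<close> for the union of edge sets in the
  conclusion. A graph \<open>G\<close> without a matching of size \<open>k\<close> has no edge
  inside \<open>I\<close> and at most one edge from each \<open>z\<close> in \<open>Z\<close> to
  \<open>U\<close>, so it meets \<open>F\<close> in at most n edges. But \<open>E\<close> has many
  edges there: every \<open>u\<close> in \<open>U\<close> has at least \<open>k - card Y\<close> of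
  them and \<open>U\<close> contains a third of \<open>V\<close>, so \<open>n * (k - card Y)\<close>
  is at most \<open>6 * card F\<close>. Since \<open>card Z\<close> is at most
  \<open>2 * (k - card Y)\<close>, the edges at \<open>Z\<close> number at most
  \<open>12 * card F\<close>. Every edge avoiding \<open>Y\<close> is in \<open>F\<close> or meets
  \<open>Z\<close>, which gives the factor 13 in 390000 = 13 * 30000.\<close>

lemma dense_witness:
  fixes k :: nat
  assumes G: "G \<subseteq> E" and no: "\<And>M. M \<subseteq> G \<Longrightarrow> matching M \<Longrightarrow> card M \<noteq> k"
    and deg: "\<And>v. v \<in> V \<Longrightarrow> k \<le> card (nbrs E v)" and k: "3 * k \<le> card V"
    and dense: "\<And>Y. Y \<subseteq> V \<Longrightarrow> card Y < k \<Longrightarrow> card V ^ 2 < 30000 * card (induced E (V - Y))"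
  obtains U I Z where "U \<subseteq> V" "I \<subseteq> V" "Z \<subseteq> V"
    "card V ^ 2 < 390000 * card (induced E I \<union> {e\<in>E. \<exists>u\<in>U. \<exists>z\<in>Z. e = {u, z}})"
    "card (G \<inter> (induced E I \<union> {e\<in>E. \<exists>u\<in>U. \<exists>z\<in>Z. e = {u, z}})) \<le> card V"
proof -
  interpret G: fin_graph V G using G by (rule subgraph)
  have "\<exists>M. (M \<subseteq> G \<and> matching M) \<and> (\<forall>M'. M' \<subseteq> G \<and> matching M' \<longrightarrow> card M' \<le> card M)"
  proof (rule ex_has_greatest_nat[where k = "{}" and b = "Suc (card G)"])
    show "{} \<subseteq> G \<and> matching {}" by (auto simp: matching_def)
    show "\<forall>M. M \<subseteq> G \<and> matching M \<longrightarrow> card M < Suc (card G)"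
      using G.finE by (auto intro: card_mono simp: less_Suc_eq_le)
  qed
  then obtain M where M: "M \<subseteq> G" "matching M" and max: "\<And>M'. M' \<subseteq> G \<Longrightarrow> matching M' \<Longrightarrow> card M' \<le> card M" by auto
  have "card M < k"
  proof (rule ccontr)
    assume "\<not> card M < k"
    then obtain M' where "M' \<subseteq> M" "card M' = k" by (meson not_less obtain_subset_with_card_n)
    then show False using no[of M'] M matching_subset[of M M'] by blast
  qed
  obtain U I Z Y where W: "U \<subseteq> I" "V = I \<union> Z \<union> Y" "I \<inter> Z = {}" "Y \<inter> (I \<union> Z) = {}"
    "card U = card V - 2 * card M" "card Z + 2 * card Y \<le> 2 * card M"
    "induced G I = {}" "\<And>z. z \<in> Z \<Longrightarrow> card (nbrs G z \<inter> U) \<le> 1"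
    using G.gallai_edmonds_weak[OF M max] by metis
  define F where "F = induced E I \<union> {e\<in>E. \<exists>u\<in>U. \<exists>z\<in>Z. e = {u, z}}"
  have FE: "F \<subseteq> E" by (auto simp: F_def induced_def)
  interpret F: fin_graph V F using FE by (rule subgraph)
  have fin: "finite I" "finite Z" "finite Y" "finite U" using finV W finite_subset[of U I] by auto
  have "G \<inter> F \<subseteq> (\<Union>z\<in>Z. (\<lambda>u. {z, u}) ` (nbrs G z \<inter> U))"
  proof
    fix e assume e: "e \<in> G \<inter> F"
    then have "e \<notin> induced E I" using W(7) by (auto simp: induced_def)
    then obtain u z where "u \<in> U" "z \<in> Z" "e = {u, z}" using e by (auto simp: F_def)
    moreover from this have "u \<in> nbrs G z \<inter> U" "e = {z, u}" using e by (auto simp: nbrs_def insert_commute)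
    ultimately show "e \<in> (\<Union>z\<in>Z. (\<lambda>u. {z, u}) ` (nbrs G z \<inter> U))" by blast
  qed
  then have "card (G \<inter> F) \<le> card (\<Union>z\<in>Z. (\<lambda>u. {z, u}) ` (nbrs G z \<inter> U))"
    using fin by (intro card_mono) auto
  also have "\<dots> \<le> (\<Sum>z\<in>Z. card ((\<lambda>u. {z, u}) ` (nbrs G z \<inter> U)))" using fin by (intro card_UN_le)
  also have "\<dots> \<le> (\<Sum>z\<in>Z. 1)"
    using fin W(8) by (intro sum_mono) (meson card_image_le finite_Int le_trans)
  also have "\<dots> \<le> card V" using W(2) finV card_mono[of V Z] by auto
  finally have few: "card (G \<inter> F) \<le> card V" .
  have cY: "card Y < k" using W(6) \<open>card M < k\<close> by linarith
  have "card U * (k - card Y) = (\<Sum>u\<in>U. k - card Y)" by simp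
  also have "\<dots> \<le> (\<Sum>u\<in>U. card (nbrs F u))"
  proof (intro sum_mono)
    fix u assume u: "u \<in> U"
    then have "u \<in> V" using W by auto
    have "nbrs E u \<subseteq> nbrs F u \<union> Y"
    proof
      fix x assume x: "x \<in> nbrs E u"
      then have "x \<in> V" using nbrs_subset by auto
      then show "x \<in> nbrs F u \<union> Y" using x u W(1,2) by (auto simp: nbrs_def F_def induced_def)
    qed
    then have "card (nbrs E u) \<le> card (nbrs F u \<union> Y)" using F.finite_nbrs fin by (intro card_mono) auto
    also have "\<dots> \<le> card (nbrs F u) + card Y" by (rule card_Un_le)
    finally show "k - card Y \<le> card (nbrs F u)" using deg[OF \<open>u \<in> V\<close>] by linarith
  qed
  also have "\<dots> \<le> 2 * card F" using W by (intro F.handshake_le) auto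
  finally have A: "card U * (k - card Y) \<le> 2 * card F" .
  have "card V \<le> 3 * card U" using W(5) \<open>card M < k\<close> k by linarith
  then have "card V * (k - card Y) \<le> 3 * card U * (k - card Y)" by (rule mult_right_mono) simp
  with A have "card V * (k - card Y) \<le> 6 * card F" by linarith
  moreover have "card V * card Z \<le> card V * (2 * (k - card Y))"
    using W(6) \<open>card M < k\<close> by (intro mult_left_mono) auto
  ultimately have B: "card V * card Z \<le> 12 * card F" by linarith
  have "induced E (V - Y) \<subseteq> F \<union> (\<Union>z\<in>Z. {e\<in>E. z \<in> e})"
  proof
    fix e assume e: "e \<in> induced E (V - Y)"
    show "e \<in> F \<union> (\<Union>z\<in>Z. {e\<in>E. z \<in> e})"
    proof (cases "e \<inter> Z = {}")
      case True
      then have "e \<subseteq> I" using e W(2) by (auto simp: induced_def)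
      then show ?thesis using e by (auto simp: F_def induced_def)
    next
      case False
      then show ?thesis using e by (auto simp: induced_def)
    qed
  qed
  then have "card (induced E (V - Y)) \<le> card (F \<union> (\<Union>z\<in>Z. {e\<in>E. z \<in> e}))"
    using F.finE finE fin by (intro card_mono) auto
  also have "\<dots> \<le> card F + card (\<Union>z\<in>Z. {e\<in>E. z \<in> e})" by (rule card_Un_le)
  also have "card (\<Union>z\<in>Z. {e\<in>E. z \<in> e}) \<le> (\<Sum>z\<in>Z. card {e\<in>E. z \<in> e})" using fin by (intro card_UN_le)
  also have "\<dots> \<le> (\<Sum>z\<in>Z. card V)"
    using nbrs_subset finV by (intro sum_mono) (auto simp: card_nbrs[symmetric] intro: card_mono)
  finally have "card (induced E (V - Y)) \<le> 13 * card F" using B by (simp add: mult.commute)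
  moreover have "card V ^ 2 < 30000 * card (induced E (V - Y))" using W(2) cY by (intro dense) auto
  ultimately have "card V ^ 2 < 390000 * card F" by linarith
  with few show thesis using that[of U I Z] W(1,2) by (auto simp: F_def)
qed

end

section \<open>Non-extremal case: matchings in random subgraphs\<close>

text \<open>Exponential Markov inequality: the indicator is at most
  \<open>2 ^ n * (1 / 2) ^ card (G \<inter> F)\<close>, and halving the weight of the elements of
  \<open>F\<close> turns the total weight 1 into \<open>(1 - p / 2) ^ card F\<close>.\<close>

lemma bin_prob_few:
  assumes X: "finite X" "F \<subseteq> X" and p: "0 \<le> p" "p \<le> 1"
  shows "bin_prob X p (\<lambda>G. card (G \<inter> F) \<le> n) \<le> 2 ^ n * exp (- p * real (card F) / 2)"
proof -
  have "bin_prob X p (\<lambda>G. card (G \<inter> F) \<le> n) \<le> (\<Sum>G\<in>Pow X. 2 ^ n * (bin_weight X p G * (1 / 2) ^ card (G \<inter> F)))"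
    unfolding bin_prob_def
  proof (intro sum_mono)
    fix G assume "G \<in> Pow X"
    have "(of_bool (card (G \<inter> F) \<le> n) :: real) \<le> 2 ^ n * (1 / 2) ^ card (G \<inter> F)"
    proof (cases "card (G \<inter> F) \<le> n")
      case True
      then have "(1 / 2 :: real) ^ n \<le> (1 / 2) ^ card (G \<inter> F)" by (intro power_decreasing) auto
      then have "2 ^ n * (1 / 2 :: real) ^ n \<le> 2 ^ n * (1 / 2) ^ card (G \<inter> F)" by (intro mult_left_mono) auto
      then show ?thesis using True by (simp add: power_mult_distrib[symmetric])
    qed simp
    then have "bin_weight X p G * of_bool (card (G \<inter> F) \<le> n) \<le> bin_weight X p G * (2 ^ n * (1 / 2) ^ card (G \<inter> F))"
      using p by (intro mult_left_mono bin_weight_nonneg) auto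
    then show "bin_weight X p G * of_bool (card (G \<inter> F) \<le> n) \<le> 2 ^ n * (bin_weight X p G * (1 / 2) ^ card (G \<inter> F))"
      by (simp add: mult_ac)
  qed
  also have "\<dots> = 2 ^ n * (\<Sum>G\<in>Pow X. (\<Prod>x\<in>G. if x \<in> F then p / 2 else p) * (\<Prod>x\<in>X - G. 1 - p))"
    unfolding sum_distrib_left
  proof (intro sum.cong refl)
    fix G assume "G \<in> Pow X"
    then have G: "finite G" using X finite_subset by auto
    have "(\<Prod>x\<in>G. if x \<in> F then p / 2 else p) = (\<Prod>x\<in>G. p * (if x \<in> F then 1 / 2 else 1))"
      by (intro prod.cong) auto
    also have "\<dots> = p ^ card G * (1 / 2) ^ card (G \<inter> F)"
      using G by (simp add: prod.distrib prod.If_cases)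
    finally have "(\<Prod>x\<in>G. if x \<in> F then p / 2 else p) = p ^ card G * (1 / 2) ^ card (G \<inter> F)" .
    then show "2 ^ n * (bin_weight X p G * (1 / 2) ^ card (G \<inter> F)) = 2 ^ n * ((\<Prod>x\<in>G. if x \<in> F then p / 2 else p) * (\<Prod>x\<in>X - G. 1 - p))"
      by (simp add: bin_weight_def mult_ac)
  qed
  also have "\<dots> = 2 ^ n * (\<Prod>x\<in>X. (if x \<in> F then p / 2 else p) + (1 - p))"
    by (subst sum_Pow_prod[OF X(1)]) simp
  also have "(\<Prod>x\<in>X. (if x \<in> F then p / 2 else p) + (1 - p)) = (\<Prod>x\<in>X. if x \<in> F then 1 - p / 2 else 1)"
    by (intro prod.cong) (auto simp: field_simps)
  also have "\<dots> = (1 - p / 2) ^ card F" using X by (simp add: prod.If_cases Int_absorb1)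
  also have "\<dots> \<le> exp (- p / 2) ^ card F"
    using p exp_ge_add_one_self[of "- p / 2"] by (intro power_mono) auto
  also have "\<dots> = exp (- p * real (card F) / 2)"
    by (simp add: exp_of_nat_mult[symmetric] mult_ac)
  finally show ?thesis by simp
qed

lemma pmf_of_weights:
  assumes A: "finite A" "\<And>x. x \<in> A \<Longrightarrow> 0 \<le> w x" "sum w A = 1"
  obtains p where "set_pmf p \<subseteq> A" "\<And>B. measure_pmf.prob p B = (\<Sum>x\<in>A \<inter> B. w x)"
proof -
  let ?f = "\<lambda>x. if x \<in> A then w x else 0"
  have nn: "\<And>x. 0 \<le> ?f x" using A by auto
  have "(\<integral>\<^sup>+x. ennreal (?f x) \<partial>count_space UNIV) = (\<Sum>x\<in>A. ennreal (?f x))"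
    using A by (subst nn_integral_count_space'[of A]) auto
  also have "\<dots> = ennreal (\<Sum>x\<in>A. w x)" using A by (subst sum_ennreal) auto
  finally have one: "(\<integral>\<^sup>+x. ennreal (?f x) \<partial>count_space UNIV) = 1" using A by simp
  define p where "p = embed_pmf ?f"
  have pmf: "pmf p x = ?f x" for x unfolding p_def by (rule pmf_embed_pmf[OF nn one])
  have set: "set_pmf p \<subseteq> A" using pmf by (auto simp: set_pmf_eq split: if_splits)
  show thesis
  proof
    show "set_pmf p \<subseteq> A" by fact
    fix B
    have "measure_pmf.prob p B = measure_pmf.prob p (A \<inter> B)"
      using set by (intro measure_eq_AE) (auto simp: AE_measure_pmf_iff)
    also have "\<dots> = sum (pmf p) (A \<inter> B)" using A by (intro measure_measure_pmf_finite) auto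
    also have "\<dots> = (\<Sum>x\<in>A \<inter> B. w x)" by (intro sum.cong) (auto simp: pmf)
    finally show "measure_pmf.prob p B = (\<Sum>x\<in>A \<inter> B. w x)" .
  qed
qed

context fin_graph begin

text \<open>A random subgraph of density \<open>q\<close> is conditioned on the event
  \<open>Good\<close> of containing a matching of size \<open>k\<close>, and one such matching is
  picked. Conditioning on an event of probability at least one half at most doubles the probability
  \<open>q ^ card S\<close> that \<open>S\<close> lies in the subgraph.\<close>

lemma nonextremal_spread_matching:
  fixes k :: nat
  assumes deg: "\<And>v. v \<in> V \<Longrightarrow> k \<le> card (nbrs E v)" and k: "3 * k \<le> card V" and big: "3900000 \<le> card V"
    and dense: "\<And>Y. Y \<subseteq> V \<Longrightarrow> card Y < k \<Longrightarrow> card V ^ 2 < 30000 * card (induced E (V - Y))"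
  shows "\<exists>P. set_pmf P \<subseteq> {M. M \<subseteq> E \<and> matching M \<and> card M = k} \<and> spread_pmf P (\<lambda>_. 7800000 / real (card V))"
proof -
  define n where "n = card V"
  \<comment> \<open>Ten times the 390000 of \<open>dense_witness\<close>, so that
    \<open>q * card F\<close> is at least \<open>10 * n\<close> for every witness. A fixed witness
    then occurs with probability at most \<open>2 ^ n * exp (- 5 * n)\<close>, which is below
    \<open>(1 / 16) ^ n\<close> and leaves \<open>(1 / 2) ^ n\<close> after the union bound over
    \<open>8 ^ n\<close> triples.\<close>
  define q where "q = 3900000 / real n"
  have n: "0 < n" and q: "0 < q" "q \<le> 1" using big by (auto simp: q_def n_def)
  define Good where "Good = {G. G \<subseteq> E \<and> (\<exists>M\<subseteq>G. matching M \<and> card M = k)}"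
  define Fset where "Fset U I Z = induced E I \<union> {e\<in>E. \<exists>u\<in>U. \<exists>z\<in>Z. e = {u, z}}" for U I Z
  define T where "T = {(U, I, Z) \<in> Pow V \<times> Pow V \<times> Pow V. n ^ 2 < 390000 * card (Fset U I Z)}"
  have FE: "Fset U I Z \<subseteq> E" for U I Z by (auto simp: Fset_def induced_def)
  have "T \<subseteq> Pow V \<times> Pow V \<times> Pow V" by (auto simp: T_def)
  then have finT: "finite T" by (rule finite_subset) (simp add: finV)
  have "card T \<le> card (Pow V \<times> Pow V \<times> Pow V)" unfolding T_def using finV by (intro card_mono) auto
  also have "\<dots> = 8 ^ n" using finV by (simp add: card_cartesian_product card_Pow n_def power_mult_distrib[symmetric])
  finally have "real (card T) \<le> real (8 ^ n)" by (simp only: of_nat_le_iff)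
  then have cT: "real (card T) \<le> 8 ^ n" by simp
  have single: "bin_prob E q (\<lambda>G. card (G \<inter> F) \<le> n) \<le> 2 ^ n * (1 / 32) ^ n" if F: "F \<subseteq> E" "n ^ 2 < 390000 * card F" for F
  proof -
    have "real (n ^ 2) \<le> real (390000 * card F)" using F(2) by (simp only: of_nat_le_iff)
    then have "real n ^ 2 \<le> 390000 * real (card F)" by simp
    then have "q * (real n * real n) \<le> q * (390000 * real (card F))" using q by (intro mult_left_mono) (auto simp: power2_eq_square)
    moreover have "q * (real n * real n) = 3900000 * real n" using n by (simp add: q_def)
    ultimately have "5 * real n \<le> q * real (card F) / 2" by simp
    then have "exp (- q * real (card F) / 2) \<le> exp (- (5 * real n))" by simp
    also have "\<dots> = exp (- 5) ^ n" using exp_of_nat_mult[of n "- 5 :: real"] by (simp add: mult.commute)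
    also have "\<dots> \<le> (1 / 32) ^ n"
    proof (intro power_mono)
      have "(2::real) ^ 5 \<le> exp 1 ^ 5" using exp_ge_add_one_self[of 1] by (intro power_mono) auto
      also have "\<dots> = exp 5" using exp_of_nat_mult[of 5 "1 :: real"] by simp
      finally show "exp (- 5) \<le> (1 / 32 :: real)" by (simp add: exp_minus inverse_eq_divide field_simps)
    qed auto
    finally have "2 ^ n * exp (- q * real (card F) / 2) \<le> 2 ^ n * (1 / 32) ^ n" by simp
    then show ?thesis using bin_prob_few[OF finE F(1), of q n] q by linarith
  qed
  have "bin_prob E q (\<lambda>G. G \<notin> Good) \<le> (\<Sum>t\<in>T. bin_prob E q (\<lambda>G. card (G \<inter> (case t of (U, I, Z) \<Rightarrow> Fset U I Z)) \<le> n))"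
  proof -
    have "bin_prob E q (\<lambda>G. G \<notin> Good) \<le> (\<Sum>G\<in>Pow E. \<Sum>t\<in>T. bin_weight E q G * of_bool (card (G \<inter> (case t of (U, I, Z) \<Rightarrow> Fset U I Z)) \<le> n))"
      unfolding bin_prob_def
    proof (intro sum_mono)
      fix G assume G: "G \<in> Pow E"
      show "bin_weight E q G * of_bool (G \<notin> Good) \<le> (\<Sum>t\<in>T. bin_weight E q G * of_bool (card (G \<inter> (case t of (U, I, Z) \<Rightarrow> Fset U I Z)) \<le> n))"
      proof (cases "G \<in> Good")
        case True
        then show ?thesis using q by (auto intro!: sum_nonneg simp: bin_weight_nonneg)
      next
        case False
        have "M \<subseteq> G \<Longrightarrow> matching M \<Longrightarrow> card M \<noteq> k" for M using False G by (auto simp: Good_def)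
        then obtain U I Z where W: "U \<subseteq> V" "I \<subseteq> V" "Z \<subseteq> V" "n ^ 2 < 390000 * card (Fset U I Z)"
          "card (G \<inter> Fset U I Z) \<le> n"
          using dense_witness[of G k] G deg k dense unfolding Fset_def n_def by blast
        then have "(U, I, Z) \<in> T" by (auto simp: T_def)
        then have "bin_weight E q G * of_bool (card (G \<inter> (case (U, I, Z) of (U, I, Z) \<Rightarrow> Fset U I Z)) \<le> n)
          \<le> (\<Sum>t\<in>T. bin_weight E q G * of_bool (card (G \<inter> (case t of (U, I, Z) \<Rightarrow> Fset U I Z)) \<le> n))"
          using finT q by (intro member_le_sum) (auto simp: bin_weight_nonneg)
        then show ?thesis using W(5) False by simp
      qed
    qed
    also have "\<dots> = (\<Sum>t\<in>T. bin_prob E q (\<lambda>G. card (G \<inter> (case t of (U, I, Z) \<Rightarrow> Fset U I Z)) \<le> n))"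
      unfolding bin_prob_def by (rule sum.swap)
    finally show ?thesis .
  qed
  also have "\<dots> \<le> (\<Sum>t\<in>T. 2 ^ n * (1 / 32) ^ n)"
    using FE by (intro sum_mono single) (auto simp: T_def)
  also have "\<dots> \<le> 8 ^ n * (2 ^ n * (1 / 32) ^ n)" using cT by (simp add: mult_right_mono)
  also have "\<dots> = (1 / 2) ^ n" by (simp add: power_mult_distrib[symmetric])
  also have "\<dots> \<le> (1 / 2) ^ 1" using n by (intro power_decreasing) auto
  finally have half: "1 / 2 \<le> bin_prob E q (\<lambda>G. G \<in> Good)"
    using bin_prob_not[OF finE, of q "\<lambda>G. G \<in> Good"] by simp
  define z where "z = bin_prob E q (\<lambda>G. G \<in> Good)"
  have GE: "Good \<subseteq> Pow E" by (auto simp: Good_def)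
  then have finG: "finite Good" by (rule finite_subset) (simp add: finE)
  have z: "z = (\<Sum>G\<in>Good. bin_weight E q G)"
    unfolding z_def bin_prob_def using finE GE
    by (intro sum.mono_neutral_cong_right) auto
  have z12: "1 / 2 \<le> z" using half by (simp add: z_def)
  obtain p where p: "set_pmf p \<subseteq> Good" "\<And>B. measure_pmf.prob p B = (\<Sum>G\<in>Good \<inter> B. bin_weight E q G / z)"
  proof (rule pmf_of_weights[OF finG, of "\<lambda>G. bin_weight E q G / z"])
    show "(\<Sum>G\<in>Good. bin_weight E q G / z) = 1" using z z12 by (simp add: sum_divide_distrib[symmetric])
  qed (use q z12 in \<open>auto simp: bin_weight_nonneg\<close>)
  define pick where "pick G = (SOME M. M \<subseteq> G \<and> matching M \<and> card M = k)" for G :: "'a set set"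
  have pick: "pick G \<subseteq> G \<and> matching (pick G) \<and> card (pick G) = k" if "G \<in> Good" for G
    using that someI_ex[of "\<lambda>M. M \<subseteq> G \<and> matching M \<and> card M = k"] unfolding pick_def Good_def by blast
  have supp: "set_pmf (map_pmf pick p) \<subseteq> {M. M \<subseteq> E \<and> matching M \<and> card M = k}"
    using p(1) pick GE by fastforce
  have "spread_pmf (map_pmf pick p) (\<lambda>_. 7800000 / real n)"
    unfolding spread_pmf_def
  proof (intro allI impI)
    fix S :: "'a set set" assume S: "finite S"
    have "measure_pmf.prob (map_pmf pick p) {M. S \<subseteq> M} \<le> (2 * q) ^ card S"
    proof (cases "S = {}")
      case True
      then show ?thesis by simp
    next
      case ne: False
      have "measure_pmf.prob (map_pmf pick p) {M. S \<subseteq> M} = (\<Sum>G\<in>Good \<inter> {G. S \<subseteq> pick G}. bin_weight E q G / z)"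
        using p(2) by (simp add: measure_map_pmf vimage_def)
      also have "\<dots> \<le> (\<Sum>G\<in>Good \<inter> {G. S \<subseteq> pick G}. 2 * bin_weight E q G)"
      proof (intro sum_mono)
        fix G
        have "bin_weight E q G / z \<le> bin_weight E q G / (1 / 2)"
          using z12 q by (intro divide_left_mono bin_weight_nonneg) auto
        then show "bin_weight E q G / z \<le> 2 * bin_weight E q G" by simp
      qed
      also have "\<dots> \<le> 2 * q ^ card S"
      proof (cases "S \<subseteq> E")
        case True
        have "(\<Sum>G\<in>Good \<inter> {G. S \<subseteq> pick G}. 2 * bin_weight E q G) \<le> (\<Sum>G\<in>{G\<in>Pow E. S \<subseteq> G}. 2 * bin_weight E q G)"
          using finE GE pick q by (intro sum_mono2) (fastforce simp: bin_weight_nonneg)+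
        also have "\<dots> = 2 * q ^ card S"
          using sum_bin_weight_superset[OF finE True, of q] by (simp add: sum_distrib_left[symmetric])
        finally show ?thesis .
      next
        case False
        then have "Good \<inter> {G. S \<subseteq> pick G} = {}" using pick GE by blast
        then show ?thesis using q by simp
      qed
      \<comment> \<open>For nonempty \<open>S\<close> the factor 2 from the conditioning is absorbed
        into the base, giving the bound 2q per edge.\<close>
      also have "\<dots> \<le> 2 ^ card S * q ^ card S"
      proof (intro mult_right_mono)
        have "(2::real) ^ 1 \<le> 2 ^ card S" using ne S by (intro power_increasing) (auto simp: Suc_le_eq card_gt_0_iff)
        then show "(2::real) \<le> 2 ^ card S" by simp
      qed (use q in auto)
      finally show ?thesis by (simp add: power_mult_distrib)
    qed
    also have "2 * q = 7800000 / real n" by (simp add: q_def)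
    finally show "measure_pmf.prob (map_pmf pick p) {M. S \<subseteq> M} \<le> (\<Prod>_\<in>S. 7800000 / real n)" by simp
  qed
  with supp show ?thesis unfolding n_def by blast
qed

theorem spread_matching:
  fixes k :: nat
  assumes deg: "\<And>v. v \<in> V \<Longrightarrow> k \<le> card (nbrs E v)" and k: "3 * k \<le> card V" and big: "3900000 \<le> card V"
  shows "\<exists>P. set_pmf P \<subseteq> {M. M \<subseteq> E \<and> matching M \<and> card M = k} \<and> spread_pmf P (\<lambda>_. 7800000 / real (card V))"
proof (cases "\<forall>Y. Y \<subseteq> V \<and> card Y < k \<longrightarrow> card V ^ 2 < 30000 * card (induced E (V - Y))")
  case True
  then show ?thesis using assms by (intro nonextremal_spread_matching) auto
next
  case False
  then obtain Y where Y: "Y \<subseteq> V" "card Y < k" "30000 * card (induced E (V - Y)) \<le> card V ^ 2" by auto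
  from Y(3) have "real (30000 * card (induced E (V - Y))) \<le> real (card V ^ 2)" by (simp only: of_nat_le_iff)
  then have "30000 * real (card (induced E (V - Y))) \<le> real (card V) ^ 2" by simp
  then obtain P where P: "set_pmf P \<subseteq> {M. M \<subseteq> E \<and> matching M \<and> card M = k}" "spread_pmf P (\<lambda>_. 100 / real (card V))"
    using extremal_spread_matching[OF deg k _ Y(1)] Y(2) big by fastforce
  have "spread_pmf P (\<lambda>_. 7800000 / real (card V))"
    by (rule spread_pmf_mono[OF P(2)]) (auto intro: divide_right_mono)
  with P(1) show ?thesis by blast
qed

end

section \<open>Closing a matching to cycles by random injections\<close>

definition injections :: "'a set \<Rightarrow> 'b set \<Rightarrow> ('a \<Rightarrow> 'b) set" where
  "injections A B = {f \<in> A \<rightarrow>\<^sub>E B. inj_on f A}"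

lemma finite_injections: "finite A \<Longrightarrow> finite B \<Longrightarrow> finite (injections A B)"
  unfolding injections_def by (rule finite_subset[of _ "A \<rightarrow>\<^sub>E B"]) (auto simp: finite_PiE)

lemma bij_injections_insert:
  assumes "a \<notin> A" "b \<in> B"
  shows "bij_betw (\<lambda>f. f(a := b)) (injections A (B - {b})) {f \<in> injections (insert a A) B. f a = b}"
proof (rule bij_betw_byWitness[where f' = "\<lambda>f. restrict f A"])
  show "(\<lambda>f. f(a := b)) ` injections A (B - {b}) \<subseteq> {f \<in> injections (insert a A) B. f a = b}"
  proof
    fix g assume "g \<in> (\<lambda>f. f(a := b)) ` injections A (B - {b})"
    then obtain f where f: "f \<in> A \<rightarrow>\<^sub>E B - {b}" "inj_on f A" "g = f(a := b)" by (auto simp: injections_def)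
    have "inj_on g (insert a A)" using f assms by (auto simp: inj_on_def PiE_def Pi_def)
    moreover have "g \<in> insert a A \<rightarrow>\<^sub>E B" using f assms by (auto simp: PiE_def Pi_def extensional_def)
    ultimately show "g \<in> {f \<in> injections (insert a A) B. f a = b}" using f(3) by (simp add: injections_def)
  qed
  show "(\<lambda>f. restrict f A) ` {f \<in> injections (insert a A) B. f a = b} \<subseteq> injections A (B - {b})"
    using assms by (auto simp: injections_def inj_on_def PiE_def Pi_def)
  show "\<forall>f\<in>injections A (B - {b}). restrict (f(a := b)) A = f"
    using assms by (auto simp: injections_def PiE_def extensional_def restrict_def fun_eq_iff)
  show "\<forall>f\<in>{f \<in> injections (insert a A) B. f a = b}. (restrict f A)(a := b) = f"
    using assms by (auto simp: injections_def PiE_def extensional_def restrict_def fun_eq_iff)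
qed

text \<open>Truncated subtraction makes the product vanish for \<open>k > N\<close>, in agreement
  with the absence of injections.\<close>

definition falling :: "nat \<Rightarrow> nat \<Rightarrow> nat" where
  "falling N k = (\<Prod>i<k. N - i)"

lemma falling_Suc: "falling N (Suc k) = N * falling (N - 1) k"
  unfolding falling_def by (subst prod.lessThan_Suc_shift) simp

lemma falling_add: "falling N (s + t) = falling N s * falling (N - s) t"
  by (induction t) (auto simp: falling_def)

lemma falling_fact: "s \<le> N \<Longrightarrow> falling N s * fact (N - s) = fact N"
proof (induction s)
  case (Suc s)
  then have "(fact (N - s) :: nat) = (N - s) * fact (N - Suc s)"
    using fact_reduce[of "N - s", where 'a = nat] by simp
  then show ?case using Suc by (simp add: falling_def mult.assoc)
qed (simp add: falling_def)

lemma card_injections: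
  assumes "finite A" "finite B"
  shows "card (injections A B) = falling (card B) (card A)"
  using assms
proof (induction A arbitrary: B rule: finite_induct)
  case empty
  then show ?case by (simp add: injections_def falling_def)
next
  case (insert a A)
  have "injections (insert a A) B = (\<Union>b\<in>B. {f \<in> injections (insert a A) B. f a = b})"
    by (auto simp: injections_def PiE_def)
  then have "card (injections (insert a A) B) = card (\<Union>b\<in>B. {f \<in> injections (insert a A) B. f a = b})" by simp
  also have "\<dots> = (\<Sum>b\<in>B. card {f \<in> injections (insert a A) B. f a = b})"
    using insert finite_injections[of "insert a A" B] by (intro card_UN_disjoint) auto
  also have "\<dots> = (\<Sum>b\<in>B. falling (card B - 1) (card A))"
  proof (intro sum.cong refl)
    fix b assume b: "b \<in> B"
    have "card {f \<in> injections (insert a A) B. f a = b} = card (injections A (B - {b}))"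
      using bij_injections_insert[OF insert(2) b] by (simp add: bij_betw_same_card)
    also have "\<dots> = falling (card B - 1) (card A)" using insert.IH[of "B - {b}"] insert.prems b by simp
    finally show "card {f \<in> injections (insert a A) B. f a = b} = falling (card B - 1) (card A)" .
  qed
  also have "\<dots> = falling (card B) (card (insert a A))" using insert by (simp add: falling_Suc)
  finally show ?case .
qed

text \<open>An inconsistent \<open>g\<close> admits no injection, so equality cannot be expected.
  Otherwise a solution \<open>f0\<close> shows that the remaining constraints avoid both
  \<open>a\<close> and \<open>b\<close>, and deleting \<open>a\<close> from the domain and
  \<open>b\<close> from the codomain reduces the problem.\<close>

lemma card_injections_constrained:
  assumes "finite g" "g \<subseteq> A \<times> B" "finite A" "finite B"
  shows "card {f \<in> injections A B. \<forall>(a, b)\<in>g. f a = b} \<le> falling (card B - card g) (card A - card g)"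
  using assms
proof (induction g arbitrary: A B rule: finite_induct)
  case empty
  then show ?case by (simp add: card_injections)
next
  case (insert ab g)
  obtain a b where ab: "ab = (a, b)" by (cases ab)
  let ?L = "{f \<in> injections A B. \<forall>(a, b)\<in>insert ab g. f a = b}"
  let ?R = "{f \<in> injections (A - {a}) (B - {b}). \<forall>(a, b)\<in>g. f a = b}"
  have AB: "a \<in> A" "b \<in> B" using insert.prems ab by auto
  show ?case
  proof (cases "?L = {}")
    case True
    then show ?thesis by (metis card.empty zero_le)
  next
    case False
    then obtain f0 where "f0 \<in> ?L" by blast
    then have f0: "f0 a = b" "inj_on f0 A" "\<And>a b. (a, b) \<in> g \<Longrightarrow> f0 a = b"
      by (auto simp: ab injections_def)
    have g: "a' \<in> A - {a} \<and> b' \<in> B - {b}" if "(a', b') \<in> g" for a' b'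
    proof -
      have "a' \<in> A" "b' \<in> B" "f0 a' = b'" using insert.prems f0 that by auto
      moreover have "a' \<noteq> a" using f0 that insert(2) ab calculation by auto
      ultimately show ?thesis using f0 AB by (auto dest: inj_onD)
    qed
    have "card ?L \<le> card ?R"
    proof (rule card_inj_on_le)
      show "inj_on (\<lambda>f. restrict f (A - {a})) ?L"
      proof (rule inj_onI)
        fix f h assume f: "f \<in> ?L" and h: "h \<in> ?L" and eq: "restrict f (A - {a}) = restrict h (A - {a})"
        show "f = h"
        proof
          fix x
          consider "x = a" | "x \<in> A - {a}" | "x \<notin> A" using AB by auto
          then show "f x = h x"
          proof cases
            case 1
            then show ?thesis using f h ab by auto
          next
            case 2
            then show ?thesis using fun_cong[OF eq, of x] by simp
          next
            case 3
            then show ?thesis using f h by (auto simp: injections_def PiE_def extensional_def)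
          qed
        qed
      qed
      show "(\<lambda>f. restrict f (A - {a})) ` ?L \<subseteq> ?R"
      proof
        fix h assume "h \<in> (\<lambda>f. restrict f (A - {a})) ` ?L"
        then obtain f where fL: "f \<in> ?L" and h: "h = restrict f (A - {a})" by blast
        then have f: "f \<in> injections A B" "f a = b" "\<And>a b. (a, b) \<in> g \<Longrightarrow> f a = b"
          by (auto simp: ab)
        have "f x \<in> B - {b}" if "x \<in> A - {a}" for x
          using f(1,2) AB that by (auto simp: injections_def dest: inj_onD)
        moreover have "inj_on f (A - {a})" using f(1) by (auto simp: injections_def intro: inj_on_subset)
        ultimately have "h \<in> injections (A - {a}) (B - {b})" by (auto simp: h injections_def inj_on_def)
        moreover have "h x = y" if "(x, y) \<in> g" for x y using g[OF that] f(3)[OF that] by (simp add: h)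
        ultimately show "h \<in> ?R" by auto
      qed
      show "finite ?R" using finite_injections[of "A - {a}" "B - {b}"] insert.prems by simp
    qed
    also have "\<dots> \<le> falling (card (B - {b}) - card g) (card (A - {a}) - card g)"
      using insert.prems g by (intro insert.IH) auto
    also have "\<dots> = falling (card B - card (insert ab g)) (card A - card (insert ab g))"
      using AB insert(1,2) insert.prems by simp
    finally show ?thesis .
  qed
qed

text \<open>\<open>real s ^ s / fact s\<close> is a single term of the series of
  \<open>exp (real s)\<close>, and \<open>exp 1\<close> is at most 3.\<close>

lemma power_le_fact_exp: "real s ^ s \<le> 3 ^ s * fact s"
proof -
  have sm: "summable (\<lambda>n. inverse (fact n) * real s ^ n)"
    using summable_exp[of "real s"] by simp
  have "inverse (fact s) * real s ^ s = (\<Sum>n\<in>{s}. inverse (fact n) * real s ^ n)" by simp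
  also have "\<dots> \<le> (\<Sum>n. inverse (fact n) * real s ^ n)"
    by (rule sum_le_suminf[OF sm]) auto
  also have "\<dots> = exp (real s)" by (simp add: exp_def scaleR_conv_of_real)
  also have "\<dots> = exp 1 ^ s" by (simp add: exp_of_nat_mult[symmetric])
  also have "\<dots> \<le> 3 ^ s" using exp_le by (intro power_mono) auto
  finally show ?thesis by (simp add: field_simps)
qed

text \<open>\<open>falling N s\<close> is \<open>fact s * (N choose s)\<close>, where the binomial
  is at least \<open>(N / s) ^ s\<close> and \<open>fact s\<close> at least
  \<open>(s / 3) ^ s\<close>. The loss stays at a factor 3 per element even for
  \<open>s = N\<close>, where the single factors \<open>N - i\<close> become small.\<close>

lemma falling_ge: "s \<le> N \<Longrightarrow> real N ^ s \<le> 3 ^ s * real (falling N s)"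
proof (cases "s = 0")
  case True
  then show ?thesis by (simp add: falling_def)
next
  case False
  assume s: "s \<le> N"
  have "falling N s * fact (N - s) = fact s * (N choose s) * fact (N - s)"
    using falling_fact[OF s] binomial_fact_lemma[OF s] by (simp add: mult_ac)
  then have f: "falling N s = fact s * (N choose s)" by simp
  have "real N ^ s = real s ^ s * (real N / real s) ^ s" using False by (simp add: power_divide)
  also have "\<dots> \<le> (3 ^ s * fact s) * real (N choose s)"
    using s binomial_ge_n_over_k_pow_k[of s N, where 'a = real] power_le_fact_exp[of s]
    by (intro mult_mono) auto
  also have "\<dots> = 3 ^ s * real (falling N s)" by (simp add: f)
  finally show ?thesis .
qed

text \<open>With N elements in \<open>B\<close> and s constraints the ratio of the two counts is at
  most \<open>1 / falling N s\<close>, so each prescribed value costs a factor \<open>3 / N\<close>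
  by \<open>falling_ge\<close>.\<close>

lemma prob_injections_constrained:
  assumes A: "finite A" "finite B" "card A \<le> card B" "B \<noteq> {}" and g: "finite g" "g \<subseteq> A \<times> B"
  shows "measure_pmf.prob (pmf_of_set (injections A B)) {f. \<forall>(a, b)\<in>g. f a = b} \<le> (3 / real (card B)) ^ card g"
proof -
  let ?L = "{f \<in> injections A B. \<forall>(a, b)\<in>g. f a = b}"
  let ?N = "card B" and ?s = "card g" and ?k = "card A"
  have N: "0 < ?N" using A by (simp add: card_gt_0_iff)
  have pos: "0 < falling ?N ?k"
    using falling_fact[OF A(3)] by (metis fact_nonzero gr0I mult_eq_0_iff)
  then have ne: "injections A B \<noteq> {}" using card_injections[OF A(1,2)] by auto
  have fin: "finite (injections A B)" using A by (simp add: finite_injections)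
  have p: "measure_pmf.prob (pmf_of_set (injections A B)) {f. \<forall>(a, b)\<in>g. f a = b} = real (card ?L) / real (falling ?N ?k)"
    using ne fin card_injections[OF A(1,2)] by (simp add: measure_pmf_of_set Int_def)
  show ?thesis
  proof (cases "?L = {}")
    case True
    then show ?thesis unfolding p by (metis card.empty div_0 of_nat_0 of_nat_0_le_iff zero_le_divide_iff zero_le_numeral zero_le_power)
  next
    case False
    then obtain f where "f \<in> ?L" by blast
    then have f: "f \<in> injections A B" "\<And>a b. (a, b) \<in> g \<Longrightarrow> f a = b" by auto
    have "inj_on fst g"
    proof (rule inj_onI)
      fix x y assume xy: "x \<in> g" "y \<in> g" "fst x = fst y"
      then obtain a b c where "x = (a, b)" "y = (a, c)" by (metis prod.collapse)
      then show "x = y" using xy f(2)[of a b] f(2)[of a c] by simp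
    qed
    then have "?s = card (fst ` g)" by (simp add: card_image)
    also have "\<dots> \<le> ?k" using g A by (intro card_mono) auto
    finally have sk: "?s \<le> ?k" .
    have "falling ?N ?k = falling ?N ?s * falling (?N - ?s) (?k - ?s)"
      using falling_add[of ?N ?s "?k - ?s"] sk by simp
    then have "falling ?N ?s * card ?L \<le> falling ?N ?k"
      using card_injections_constrained[OF g A(1,2)] by simp
    then have "real (falling ?N ?s * card ?L) \<le> real (falling ?N ?k)" by (simp only: of_nat_le_iff)
    then have le: "real (falling ?N ?s) * real (card ?L) \<le> real (falling ?N ?k)" by (simp only: of_nat_mult)
    have "real ?N ^ ?s * real (card ?L) \<le> 3 ^ ?s * real (falling ?N ?s) * real (card ?L)"
      using sk A by (intro mult_right_mono falling_ge) auto
    also have "\<dots> = 3 ^ ?s * (real (falling ?N ?s) * real (card ?L))" by (rule mult.assoc)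
    also have "\<dots> \<le> 3 ^ ?s * real (falling ?N ?k)" using le by (rule mult_left_mono) simp
    finally have "real ?N ^ ?s * real (card ?L) \<le> 3 ^ ?s * real (falling ?N ?k)" .
    then show ?thesis unfolding p using pos N by (simp add: power_divide field_simps)
  qed
qed

text \<open>
  The cycles are grown as lists \<open>[y, x, z\<^sub>1, z\<^sub>2, \<dots>]\<close>, where \<open>{x, y}\<close> is the edge of the matching. Besides the
  edges placed so far, the spread condition has to control the pairs formed by the two ends of a list:
  they are the matching itself at the start and the closing edges of the cycles at the end.
\<close>

definition path_system :: "'a set \<Rightarrow> nat \<Rightarrow> nat \<Rightarrow> 'a list set \<Rightarrow> bool" where
  "path_system V k L C \<longleftrightarrow> finite C \<and> card C = k \<and>
     (\<forall>c\<in>C. length c = L \<and> distinct c \<and> set c \<subseteq> V) \<and>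
     (\<forall>c\<in>C. \<forall>c'\<in>C. c \<noteq> c' \<longrightarrow> set c \<inter> set c' = {})"

text \<open>Position and orientation are recorded so that the edges added by one extension can be
  told apart from all earlier ones by their label.\<close>

definition inner_edges :: "'a list set \<Rightarrow> (nat \<times> 'a \<times> 'a) set" where
  "inner_edges C = {(i, c ! i, c ! Suc i) |c i. c \<in> C \<and> 1 \<le> i \<and> Suc i < length c}"

definition end_pairs :: "'a list set \<Rightarrow> ('a \<times> 'a) set" where
  "end_pairs C = (\<lambda>c. (last c, hd c)) ` C"

text \<open>Heads are distinct in a path system and never change while the lists grow at the other
  end, so they can index the random choice; the new end pair is
  \<open>(f (hd c), hd c)\<close>.\<close>

definition append_images :: "('a \<Rightarrow> 'a) \<Rightarrow> 'a list set \<Rightarrow> 'a list set" where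
  "append_images f C = (\<lambda>c. c @ [f (hd c)]) ` C"

definition spread_paths :: "real \<Rightarrow> 'a list set pmf \<Rightarrow> bool" where
  "spread_paths q P \<longleftrightarrow> (\<forall>S Q. finite S \<longrightarrow> finite Q \<longrightarrow>
     measure_pmf.prob P {C. S \<subseteq> inner_edges C \<and> Q \<subseteq> end_pairs C} \<le> q ^ (card S + card Q))"

lemma inner_edges_append:
  assumes "path_system V k L C" "2 \<le> L"
  shows "inner_edges (append_images f C) = inner_edges C \<union> (\<lambda>c. (L - 1, last c, f (hd c))) ` C"
proof (intro set_eqI iffI)
  fix t assume "t \<in> inner_edges (append_images f C)"
  then obtain c i where c: "c \<in> C" "1 \<le> i" "Suc i < Suc (length c)"
    and t: "t = (i, (c @ [f (hd c)]) ! i, (c @ [f (hd c)]) ! Suc i)"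
    by (auto simp: inner_edges_def append_images_def)
  have len: "length c = L" using assms c by (auto simp: path_system_def)
  show "t \<in> inner_edges C \<union> (\<lambda>c. (L - 1, last c, f (hd c))) ` C"
  proof (cases "Suc i < length c")
    case True
    then show ?thesis using c t by (auto simp: inner_edges_def nth_append)
  next
    case False
    then have i: "i = L - 1" "Suc i = L" using c len by auto
    have "c \<noteq> []" using len assms by auto
    then have "t = (L - 1, last c, f (hd c))" using t i len by (simp add: nth_append last_conv_nth)
    then show ?thesis using c by auto
  qed
next
  fix t assume t: "t \<in> inner_edges C \<union> (\<lambda>c. (L - 1, last c, f (hd c))) ` C"
  show "t \<in> inner_edges (append_images f C)"
  proof (cases "t \<in> inner_edges C")
    case True
    then obtain c i where c: "c \<in> C" "1 \<le> i" "Suc i < length c" "t = (i, c ! i, c ! Suc i)"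
      by (auto simp: inner_edges_def)
    then have "t = (i, (c @ [f (hd c)]) ! i, (c @ [f (hd c)]) ! Suc i)" by (simp add: nth_append)
    moreover have "c @ [f (hd c)] \<in> append_images f C" using c by (auto simp: append_images_def)
    ultimately show ?thesis using c(2,3) unfolding inner_edges_def by fastforce
  next
    case False
    then obtain c where c: "c \<in> C" "t = (L - 1, last c, f (hd c))" using t by auto
    have len: "length c = L" using assms c by (auto simp: path_system_def)
    have "c \<noteq> []" using len assms by auto
    then have "t = (L - 1, (c @ [f (hd c)]) ! (L - 1), (c @ [f (hd c)]) ! Suc (L - 1))"
      using c(2) len assms(2) by (simp add: nth_append last_conv_nth)
    moreover have "c @ [f (hd c)] \<in> append_images f C" using c by (auto simp: append_images_def)
    moreover have "1 \<le> L - 1" "Suc (L - 1) < length (c @ [f (hd c)])" using assms(2) len by auto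
    ultimately show ?thesis unfolding inner_edges_def by blast
  qed
qed

lemma end_pairs_append: "[] \<notin> C \<Longrightarrow> end_pairs (append_images f C) = (\<lambda>c. (f (hd c), hd c)) ` C"
  unfolding end_pairs_def append_images_def image_image
  by (intro image_cong refl) (metis Pair_inject hd_append2 last_snoc)

lemma card_split_label:
  assumes "finite T"
  shows "finite {(a, b). (m, a, b) \<in> T}"
    "card T = card {t\<in>T. fst t \<noteq> m} + card {(a, b). (m, a, b) \<in> T}"
proof -
  let ?Q = "{(a, b). (m, a, b) \<in> T}" and ?f = "Pair m"
  have img: "?f ` ?Q = {t\<in>T. fst t = m}" by force
  have inj: "inj_on ?f ?Q" by (auto simp: inj_on_def)
  show "finite ?Q" using assms by (intro finite_imageD[OF _ inj]) (simp add: img)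
  have "card T = card ({t\<in>T. fst t \<noteq> m} \<union> {t\<in>T. fst t = m})" by (intro arg_cong[where f = card]) auto
  also have "\<dots> = card {t\<in>T. fst t \<noteq> m} + card {t\<in>T. fst t = m}"
    using assms by (intro card_Un_disjoint) auto
  finally show "card T = card {t\<in>T. fst t \<noteq> m} + card ?Q"
    using card_image[OF inj] by (simp add: img)
qed

lemma path_system_hd_inj:
  assumes "path_system V k L C" "0 < L" "c \<in> C" "c' \<in> C" "hd c = hd c'"
  shows "c = c'"
proof (rule ccontr)
  assume "c \<noteq> c'"
  then have "set c \<inter> set c' = {}" using assms by (auto simp: path_system_def)
  moreover have "c \<noteq> []" "c' \<noteq> []" using assms by (auto simp: path_system_def)
  ultimately show False using assms(5) hd_in_set by (metis disjoint_iff)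
qed

lemma path_system_last_inj:
  assumes "path_system V k L C" "0 < L" "c \<in> C" "c' \<in> C" "last c = last c'"
  shows "c = c'"
proof (rule ccontr)
  assume "c \<noteq> c'"
  then have "set c \<inter> set c' = {}" using assms by (auto simp: path_system_def)
  moreover have "c \<noteq> []" "c' \<noteq> []" using assms by (auto simp: path_system_def)
  ultimately show False using assms(5) last_in_set by (metis disjoint_iff)
qed

lemma card_path_system_vertices:
  assumes "path_system V k L C"
  shows "card (\<Union>(set ` C)) = L * k"
proof -
  have "card (\<Union>c\<in>C. set c) = (\<Sum>c\<in>C. card (set c))"
    using assms by (intro card_UN_disjoint) (auto simp: path_system_def)
  also have "\<dots> = (\<Sum>c\<in>C. L)"
    using assms by (intro sum.cong) (auto simp: path_system_def distinct_card)
  finally show ?thesis using assms by (simp add: path_system_def)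
qed

lemma path_system_append:
  assumes C: "path_system V k L C" "0 < L" and f: "f \<in> injections (hd ` C) (V - \<Union>(set ` C))"
  shows "path_system V k (Suc L) (append_images f C)"
proof -
  have f': "f (hd c) \<in> V" "f (hd c) \<notin> set c'" if "c \<in> C" "c' \<in> C" for c c'
    using f that by (auto simp: injections_def PiE_def Pi_def)
  have fi: "f (hd c) \<noteq> f (hd c')" if "c \<in> C" "c' \<in> C" "c \<noteq> c'" for c c'
    using f that path_system_hd_inj[OF C that(1,2)] by (auto simp: injections_def inj_on_def)
  have inj: "inj_on (\<lambda>c. c @ [f (hd c)]) C" by (auto simp: inj_on_def)
  show ?thesis
    unfolding path_system_def
  proof (intro conjI ballI impI)
    show "finite (append_images f C)" using C by (auto simp: append_images_def path_system_def)
    show "card (append_images f C) = k" using C card_image[OF inj] by (simp add: append_images_def path_system_def)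
  next
    fix d assume "d \<in> append_images f C"
    then obtain c where c: "c \<in> C" "d = c @ [f (hd c)]" by (auto simp: append_images_def)
    then show "length d = Suc L" "distinct d" "set d \<subseteq> V" using C f'[OF c(1) c(1)] by (auto simp: path_system_def)
    fix d' assume "d' \<in> append_images f C" "d \<noteq> d'"
    then obtain c' where c': "c' \<in> C" "d' = c' @ [f (hd c')]" "c \<noteq> c'" using c by (auto simp: append_images_def)
    have "set c \<inter> set c' = {}" using C c c' by (auto simp: path_system_def)
    then show "set d \<inter> set d' = {}"
      using c(2) c'(2) f'(2)[OF c(1) c'(1)] f'(2)[OF c'(1) c(1)] fi[OF c(1) c'(1,3)] by auto
  qed
qed

text \<open>
  An end pair \<open>(z, y) \<in> Q\<close> whose last edge \<open>(u, z) \<in> A\<close> is prescribed as well does not constrain the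
  new vertex any further, but it prescribes the previous end pair \<open>(u, y) \<in> Q'\<close>.
\<close>

lemma prob_append_random:
  assumes C: "path_system V k L C" and L: "2 \<le> L" and V: "finite V" and room: "Suc L * k \<le> card V" "0 < k"
    and q: "3 / real (card V - L * k) \<le> q" "q \<le> 1"
    and fin: "finite A" "finite Q"
  defines "Q' \<equiv> {(u, y). \<exists>z. (u, z) \<in> A \<and> (z, y) \<in> Q}"
  shows "measure_pmf.prob (pmf_of_set (injections (hd ` C) (V - \<Union>(set ` C))))
       {f. (\<forall>(u, z)\<in>A. \<exists>c\<in>C. u = last c \<and> z = f (hd c)) \<and> (\<forall>(z, y)\<in>Q. \<exists>c\<in>C. z = f (hd c) \<and> y = hd c)}
     \<le> q ^ (card A + card Q - card Q') * indicator {C. Q' \<subseteq> end_pairs C} C"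
    (is "measure_pmf.prob ?p ?ev \<le> _")
proof -
  let ?H = "hd ` C" and ?B = "V - \<Union>(set ` C)"
  have L0: "0 < L" using L by simp
  have finC: "finite C" "card C = k" using C by (auto simp: path_system_def)
  have cB: "card ?B = card V - L * k"
  proof -
    have "\<Union>(set ` C) \<subseteq> V" using C by (auto simp: path_system_def)
    moreover have "finite (\<Union>(set ` C))" using finC by auto
    ultimately show ?thesis using card_path_system_vertices[OF C] by (simp add: card_Diff_subset)
  qed
  have "inj_on hd C" using path_system_hd_inj[OF C L0] by (auto simp: inj_on_def)
  then have cH: "card ?H = k" using finC by (simp add: card_image)
  have kB: "k \<le> card ?B" using room cB by simp
  have "card ?B \<noteq> 0" using kB room by simp
  then have B: "finite ?B" "?B \<noteq> {}" using V by (metis finite_Diff, metis card.empty)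
  have q0: "0 \<le> q" using q(1) by (meson divide_nonneg_nonneg le_trans of_nat_0_le_iff order.trans zero_le_numeral)
  have "injections ?H ?B \<noteq> {}"
  proof -
    have "falling (card ?B) (card ?H) * fact (card ?B - card ?H) = fact (card ?B)"
      using kB cH by (intro falling_fact) simp
    then have "falling (card ?B) (card ?H) \<noteq> 0" by (metis fact_nonzero mult_0)
    then show ?thesis using card_injections[of ?H ?B] finC B by fastforce
  qed
  then have set_p: "set_pmf ?p = injections ?H ?B" using finC B by (simp add: finite_injections)
  show ?thesis
  proof (cases "set_pmf ?p \<inter> ?ev = {}")
    case True
    then have "measure_pmf.prob ?p ?ev = 0" by (simp add: measure_pmf_zero_iff)
    then show ?thesis using q0 by simp
  next
    case False
    \<comment> \<open>One \<open>f\<close> in the event serves as a consistency witness: the claim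
      about \<open>Q'\<close> and the properties of the forced values below are read off from
      it.\<close>
    then obtain f where f: "f \<in> injections ?H ?B" and fA: "\<And>u z. (u, z) \<in> A \<Longrightarrow> \<exists>c\<in>C. u = last c \<and> z = f (hd c)"
      and fQ: "\<And>z y. (z, y) \<in> Q \<Longrightarrow> \<exists>c\<in>C. z = f (hd c) \<and> y = hd c"
      using set_p by blast
    have finj: "c = c'" if "c \<in> C" "c' \<in> C" "f (hd c) = f (hd c')" for c c'
      using f that path_system_hd_inj[OF C L0 that(1,2)] by (auto simp: injections_def dest: inj_onD)
    have fB: "f (hd c) \<in> ?B" if "c \<in> C" for c using f that by (auto simp: injections_def PiE_def Pi_def)
    have Q'end: "Q' \<subseteq> end_pairs C"
    proof
      fix t assume "t \<in> Q'"
      then obtain u y z where t: "t = (u, y)" "(u, z) \<in> A" "(z, y) \<in> Q" by (auto simp: Q'_def)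
      obtain c where c: "c \<in> C" "u = last c" "z = f (hd c)" using fA[OF t(2)] by auto
      obtain c' where c': "c' \<in> C" "z = f (hd c')" "y = hd c'" using fQ[OF t(3)] by auto
      have "c = c'" using finj c c' by metis
      then show "t \<in> end_pairs C" using t c c' by (auto simp: end_pairs_def)
    qed
    \<comment> \<open>\<open>g1\<close> collects the values forced by the prescribed last edges,
      \<open>g2\<close> those forced by the end pairs. A value forced twice determines an element of
      \<open>Q'\<close>, so at least \<open>card A + card Q - card Q'\<close> different values are
      prescribed.\<close>
    define g1 where "g1 = {(hd c, z) |c z. c \<in> C \<and> (last c, z) \<in> A}"
    define g2 where "g2 = (\<lambda>(z, y). (y, z)) ` Q"
    have fg: "f a = b" if "(a, b) \<in> g1 \<union> g2" for a b
    proof -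
      have "f (hd c) = z" if "c \<in> C" "(last c, z) \<in> A" for c z
        using fA[OF that(2)] path_system_last_inj[OF C L0 that(1)] by auto
      moreover have "f y = z" if "(z, y) \<in> Q" for z y using fQ[OF that] by auto
      ultimately show ?thesis using that by (auto simp: g1_def g2_def)
    qed
    have "g1 \<subseteq> ?H \<times> ?B"
    proof clarify
      fix a b assume ab: "(a, b) \<in> g1"
      then obtain c where "c \<in> C" "a = hd c" by (auto simp: g1_def)
      then show "a \<in> ?H \<and> b \<in> ?B" using fB fg[of a b] ab by auto
    qed
    moreover have "g2 \<subseteq> ?H \<times> ?B"
    proof clarify
      fix a b assume "(a, b) \<in> g2"
      then have "(b, a) \<in> Q" by (auto simp: g2_def)
      then show "a \<in> ?H \<and> b \<in> ?B" using fQ[of b a] fB by auto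
    qed
    ultimately have gsub: "g1 \<union> g2 \<subseteq> ?H \<times> ?B" by simp
    have fing: "finite (g1 \<union> g2)" using gsub finC B finite_subset by blast
    have "card A \<le> card g1"
    proof (rule card_inj_on_le)
      let ?m = "\<lambda>(u, z). (hd (THE c. c \<in> C \<and> last c = u), z)"
      have the: "(THE c. c \<in> C \<and> last c = last d) = d" if "d \<in> C" for d
        using that path_system_last_inj[OF C L0] by (intro the_equality) auto
      show "?m ` A \<subseteq> g1"
      proof clarify
        fix u z assume uz: "(u, z) \<in> A"
        then obtain c where "c \<in> C" "u = last c" using fA by blast
        then show "(hd (THE c. c \<in> C \<and> last c = u), z) \<in> g1" using uz the by (auto simp: g1_def)
      qed
      show "inj_on ?m A"
      proof (rule inj_onI)
        fix x y assume x: "x \<in> A" and y: "y \<in> A" and eq: "?m x = ?m y"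
        obtain u z u' z' where xy: "x = (u, z)" "y = (u', z')" by (cases x, cases y) auto
        obtain c c' where c: "c \<in> C" "u = last c" "c' \<in> C" "u' = last c'" using fA x y xy by blast
        have "z = z'" "hd c = hd c'" using eq the[OF c(1)] the[OF c(3)] c(2,4) by (auto simp: xy)
        then show "x = y" using path_system_hd_inj[OF C L0 c(1,3)] c xy by simp
      qed
      show "finite g1" using fing by simp
    qed
    moreover have "card g2 = card Q" unfolding g2_def by (intro card_image) (auto simp: inj_on_def)
    moreover have "card (g1 \<inter> g2) \<le> card Q'"
    proof (rule card_inj_on_le)
      let ?m = "\<lambda>(y, z). (last (THE c. c \<in> C \<and> hd c = y), y)"
      have the: "(THE c. c \<in> C \<and> hd c = hd d) = d" if "d \<in> C" for d
        using that path_system_hd_inj[OF C L0] by (intro the_equality) auto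
      show "?m ` (g1 \<inter> g2) \<subseteq> Q'"
      proof clarify
        fix y z assume yz: "(y, z) \<in> g1" "(y, z) \<in> g2"
        then obtain c where c: "c \<in> C" "y = hd c" "(last c, z) \<in> A" by (auto simp: g1_def)
        have "(z, y) \<in> Q" using yz by (auto simp: g2_def)
        then show "(last (THE c. c \<in> C \<and> hd c = y), y) \<in> Q'" using c the by (auto simp: Q'_def)
      qed
      show "inj_on ?m (g1 \<inter> g2)"
      proof (rule inj_onI)
        fix x y assume x: "x \<in> g1 \<inter> g2" and y: "y \<in> g1 \<inter> g2" and eq: "?m x = ?m y"
        obtain a b a' b' where xy: "x = (a, b)" "y = (a', b')" by (cases x, cases y) auto
        have "a = a'" using eq xy by simp
        moreover have "f a = b" "f a' = b'" using fg x y xy by auto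
        ultimately show "x = y" using xy by simp
      qed
      show "finite Q'"
      proof (rule finite_subset)
        show "Q' \<subseteq> fst ` A \<times> snd ` Q" by (force simp: Q'_def)
      qed (use fin in auto)
    qed
    moreover have "card g1 + card g2 = card (g1 \<union> g2) + card (g1 \<inter> g2)"
      using fing by (intro card_Un_Int) auto
    ultimately have cg: "card A + card Q - card Q' \<le> card (g1 \<union> g2)" by linarith
    have "measure_pmf.prob ?p ?ev \<le> measure_pmf.prob ?p {f. \<forall>(a, b)\<in>g1 \<union> g2. f a = b}"
    proof (rule measure_pmf.finite_measure_mono, rule subsetI)
      fix h assume h: "h \<in> ?ev"
      then have hA: "\<forall>(u, z)\<in>A. \<exists>c\<in>C. u = last c \<and> z = h (hd c)"
        and hQ: "\<forall>(z, y)\<in>Q. \<exists>c\<in>C. z = h (hd c) \<and> y = hd c" by simp_all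
      have "h (hd c) = z" if c: "c \<in> C" "(last c, z) \<in> A" for c z
      proof -
        obtain c' where c': "c' \<in> C" "last c = last c'" "z = h (hd c')" using bspec[OF hA c(2)] by auto
        have "c = c'" by (rule path_system_last_inj[OF C L0 c(1) c'(1,2)])
        then show ?thesis using c'(3) by simp
      qed
      moreover have "h y = z" if "(z, y) \<in> Q" for z y using bspec[OF hQ that] by auto
      ultimately show "h \<in> {f. \<forall>(a, b)\<in>g1 \<union> g2. f a = b}" by (auto simp: g1_def g2_def)
    qed simp
    also have "\<dots> \<le> (3 / real (card ?B)) ^ card (g1 \<union> g2)"
      using finC B kB cH fing gsub by (intro prob_injections_constrained) auto
    also have "\<dots> \<le> q ^ card (g1 \<union> g2)" using q cB by (intro power_mono) auto
    also have "\<dots> \<le> q ^ (card A + card Q - card Q')" using cg q q0 by (intro power_decreasing) auto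
    finally show ?thesis using Q'end by simp
  qed
qed

text \<open>The prescribed edges \<open>S'\<close> split into \<open>A\<close>, those of the new
  round, and the older ones \<open>S\<close>. The new vertices cost
  \<open>q ^ (card A + card Q - card Q')\<close> and the old paths
  \<open>q ^ (card S + card Q')\<close>; the inherited end pairs \<open>Q'\<close> cancel, so the
  same \<open>q\<close> serves for all lengths.\<close>

lemma spread_paths_extend:
  assumes P: "\<And>C. C \<in> set_pmf P \<Longrightarrow> path_system V k L C" and sp: "spread_paths q P"
    and L: "2 \<le> L" and V: "finite V" and room: "Suc L * k \<le> card V" "0 < k"
    and q: "3 / real (card V - L * k) \<le> q" "q \<le> 1"
  obtains P' where "spread_paths q P'"
    "\<And>D. D \<in> set_pmf P' \<Longrightarrow> path_system V k (Suc L) D \<and> (\<exists>C\<in>set_pmf P. \<exists>f. D = append_images f C)"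
proof
  let ?I = "\<lambda>C. injections (hd ` C) (V - \<Union>(set ` C))"
  let ?P' = "bind_pmf P (\<lambda>C. map_pmf (\<lambda>f. append_images f C) (pmf_of_set (?I C)))"
  have q0: "0 \<le> q" using q(1) by (meson divide_nonneg_nonneg le_trans of_nat_0_le_iff order.trans zero_le_numeral)
  have L0: "0 < L" using L by simp
  have I: "finite (?I C)" "?I C \<noteq> {}" if "C \<in> set_pmf P" for C
  proof -
    note C = P[OF that]
    have finC: "finite C" "card C = k" using C by (auto simp: path_system_def)
    have "\<Union>(set ` C) \<subseteq> V" using C by (auto simp: path_system_def)
    then have cB: "card (V - \<Union>(set ` C)) = card V - L * k"
      using finC card_path_system_vertices[OF C] by (simp add: card_Diff_subset)
    have "inj_on hd C" using path_system_hd_inj[OF C L0] by (auto simp: inj_on_def)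
    then have cH: "card (hd ` C) = k" using finC by (simp add: card_image)
    have "falling (card V - L * k) k * fact (card V - L * k - k) = fact (card V - L * k)"
      using room by (intro falling_fact) simp
    then have "falling (card V - L * k) k \<noteq> 0" by (metis fact_nonzero mult_0)
    then have "card (?I C) \<noteq> 0"
      using card_injections[of "hd ` C" "V - \<Union>(set ` C)"] finC V cB cH by simp
    then show "finite (?I C)" "?I C \<noteq> {}" by (auto simp: card_eq_0_iff)
  qed
  show "path_system V k (Suc L) D \<and> (\<exists>C\<in>set_pmf P. \<exists>f. D = append_images f C)" if "D \<in> set_pmf ?P'" for D
  proof -
    from that obtain C where C: "C \<in> set_pmf P"
      "D \<in> set_pmf (map_pmf (\<lambda>f. append_images f C) (pmf_of_set (?I C)))" by auto
    then obtain f where "f \<in> ?I C" "D = append_images f C" using I[OF C(1)] by auto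
    then show ?thesis using path_system_append[OF P L0] C(1) by blast
  qed
  show "spread_paths q ?P'"
    unfolding spread_paths_def
  proof (intro allI impI)
    fix S' :: "(nat \<times> 'a \<times> 'a) set" and Q :: "('a \<times> 'a) set"
    assume fin: "finite S'" "finite Q"
    define S where "S = {t\<in>S'. fst t \<noteq> L - 1}"
    define A where "A = {(u, z). (L - 1, u, z) \<in> S'}"
    define Q' where "Q' = {(u, y). \<exists>z. (u, z) \<in> A \<and> (z, y) \<in> Q}"
    have finS: "finite S" "finite A" and cS: "card S' = card S + card A"
      using fin card_split_label[OF fin(1), of "L - 1"] by (auto simp: S_def A_def)
    have finQ': "finite Q'"
    proof (rule finite_subset)
      show "Q' \<subseteq> fst ` A \<times> snd ` Q" by (force simp: Q'_def)
    qed (use fin finS in auto)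
    let ?e = "card A + card Q - card Q'"
    have "measure_pmf.prob ?P' {C. S' \<subseteq> inner_edges C \<and> Q \<subseteq> end_pairs C}
      \<le> (\<Sum>j\<in>{()}. q ^ ?e * measure_pmf.prob P {C. S \<subseteq> inner_edges C \<and> Q' \<subseteq> end_pairs C})"
    proof (rule prob_bind_pmf_le)
      fix C assume CP: "C \<in> set_pmf P"
      note C = P[OF CP]
      have "[] \<notin> C" using C L by (auto simp: path_system_def)
      \<comment> \<open>Old inner edges start at position \<open>L - 2\<close> or earlier, so the
        label \<open>L - 1\<close> belongs to the new edges alone.\<close>
      have noS: "fst t \<noteq> L - 1" if "t \<in> inner_edges C" for t
        using that C by (fastforce simp: inner_edges_def path_system_def)
      let ?ev = "{f. (\<forall>(u, z)\<in>A. \<exists>c\<in>C. u = last c \<and> z = f (hd c)) \<and> (\<forall>(z, y)\<in>Q. \<exists>c\<in>C. z = f (hd c) \<and> y = hd c)}"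
      have ev: "S \<subseteq> inner_edges C \<and> f \<in> ?ev"
        if f: "S' \<subseteq> inner_edges (append_images f C)" "Q \<subseteq> end_pairs (append_images f C)" for f
      proof (intro conjI CollectI)
        show "S \<subseteq> inner_edges C"
          using f(1) unfolding inner_edges_append[OF C L] by (auto simp: S_def)
        show "\<forall>(u, z)\<in>A. \<exists>c\<in>C. u = last c \<and> z = f (hd c)"
        proof clarify
          fix u z assume "(u, z) \<in> A"
          then have "(L - 1, u, z) \<in> inner_edges C \<union> (\<lambda>c. (L - 1, last c, f (hd c))) ` C"
            using f(1) unfolding inner_edges_append[OF C L] by (auto simp: A_def)
          then show "\<exists>c\<in>C. u = last c \<and> z = f (hd c)" using noS by fastforce
        qed
        show "\<forall>(z, y)\<in>Q. \<exists>c\<in>C. z = f (hd c) \<and> y = hd c"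
          using f(2) unfolding end_pairs_append[OF \<open>[] \<notin> C\<close>] by auto
      qed
      have "measure_pmf.prob (map_pmf (\<lambda>f. append_images f C) (pmf_of_set (?I C))) {C. S' \<subseteq> inner_edges C \<and> Q \<subseteq> end_pairs C}
         = measure_pmf.prob (pmf_of_set (?I C)) {f. S' \<subseteq> inner_edges (append_images f C) \<and> Q \<subseteq> end_pairs (append_images f C)}"
        by (simp add: measure_map_pmf vimage_def)
      also have "\<dots> \<le> q ^ ?e * indicator {C. S \<subseteq> inner_edges C \<and> Q' \<subseteq> end_pairs C} C"
      proof (cases "S \<subseteq> inner_edges C")
        case True
        have "measure_pmf.prob (pmf_of_set (?I C)) {f. S' \<subseteq> inner_edges (append_images f C) \<and> Q \<subseteq> end_pairs (append_images f C)}
          \<le> measure_pmf.prob (pmf_of_set (?I C)) ?ev"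
        proof (rule measure_pmf.finite_measure_mono, rule subsetI)
          fix f assume "f \<in> {f. S' \<subseteq> inner_edges (append_images f C) \<and> Q \<subseteq> end_pairs (append_images f C)}"
          then show "f \<in> ?ev" using ev[of f] by simp
        qed simp
        also have "\<dots> \<le> q ^ ?e * indicator {C. Q' \<subseteq> end_pairs C} C"
          unfolding Q'_def by (rule prob_append_random[OF C L V room q finS(2) fin(2)])
        finally show ?thesis using True by (auto simp: indicator_def)
      next
        case False
        then have "{f. S' \<subseteq> inner_edges (append_images f C) \<and> Q \<subseteq> end_pairs (append_images f C)} = {}"
          using ev by blast
        then show ?thesis using q0 by (simp only: measure_empty) simp
      qed
      finally show "measure_pmf.prob (map_pmf (\<lambda>f. append_images f C) (pmf_of_set (?I C))) {C. S' \<subseteq> inner_edges C \<and> Q \<subseteq> end_pairs C}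
        \<le> (\<Sum>j\<in>{()}. q ^ ?e * indicator {C. S \<subseteq> inner_edges C \<and> Q' \<subseteq> end_pairs C} C)" by simp
    qed (use q0 in auto)
    also have "\<dots> \<le> q ^ ?e * q ^ (card S + card Q')"
      using sp finS finQ' q0 unfolding spread_paths_def by (simp add: mult_left_mono)
    also have "\<dots> = q ^ (?e + (card S + card Q'))" by (simp add: power_add)
    \<comment> \<open>Only an inequality: truncated subtraction can make the exponent larger, which
      is harmless because \<open>q\<close> is at most 1.\<close>
    also have "\<dots> \<le> q ^ (card S' + card Q)" using cS q q0 by (intro power_decreasing) auto
    finally show "measure_pmf.prob ?P' {C. S' \<subseteq> inner_edges C \<and> Q \<subseteq> end_pairs C} \<le> q ^ (card S' + card Q)" .
  qed
qed

section \<open>Edges of the closed cycles as unordered pairs\<close>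

text \<open>Position 0 is left out: the edge between the first two vertices is the one supplied by
  \<open>G\<close>, all others have to come from the random graph.\<close>

definition cycle_edges :: "nat \<Rightarrow> 'a list set \<Rightarrow> 'a set set" where
  "cycle_edges l C = {{c ! i, c ! ((i + 1) mod l)} |c i. c \<in> C \<and> 1 \<le> i \<and> i < l}"

lemma card_cycle_edges_le:
  assumes "path_system V k l C"
  shows "finite (cycle_edges l C)" "card (cycle_edges l C) \<le> k * l"
proof -
  have eq: "cycle_edges l C = (\<lambda>(c, i). {c ! i, c ! ((i + 1) mod l)}) ` (C \<times> {1..<l})"
    unfolding cycle_edges_def by (force simp: image_iff)
  have fin: "finite C" "card C = k" using assms by (auto simp: path_system_def)
  then show "finite (cycle_edges l C)" unfolding eq by simp
  have "card (cycle_edges l C) \<le> card (C \<times> {1..<l})" unfolding eq using fin by (intro card_image_le) auto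
  also have "\<dots> \<le> k * l" using fin by (simp add: card_cartesian_product)
  finally show "card (cycle_edges l C) \<le> k * l" .
qed

lemma cycle_edges_all_pairs:
  assumes "path_system {0..<n} k l C" "2 \<le> l"
  shows "cycle_edges l C \<subseteq> all_pairs n"
proof
  fix e assume "e \<in> cycle_edges l C"
  then obtain c i where c: "c \<in> C" "1 \<le> i" "i < l" "e = {c ! i, c ! ((i + 1) mod l)}"
    by (auto simp: cycle_edges_def)
  have C: "length c = l" "distinct c" "set c \<subseteq> {0..<n}" using assms c by (auto simp: path_system_def)
  define j where "j = (i + 1) mod l"
  have j: "j < l" "j \<noteq> i"
  proof -
    show "j < l" using assms by (simp add: j_def)
    show "j \<noteq> i"
    proof (cases "i + 1 < l")
      case False
      then have "i + 1 = l" using c by simp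
      then show ?thesis using c by (simp add: j_def)
    qed (simp add: j_def)
  qed
  have "c ! i \<in> set c" "c ! j \<in> set c" using C c j by auto
  then have "c ! i \<in> {0..<n}" "c ! j \<in> {0..<n}" using C by auto
  moreover have "c ! i \<noteq> c ! j" using C c j by (simp add: nth_eq_iff_index_eq)
  moreover have "e = {c ! i, c ! j}" using c by (simp add: j_def)
  ultimately show "e \<in> all_pairs n" by (simp add: all_pairs_def)
qed

lemma has_disjoint_cycles_path_system:
  assumes C: "path_system V k l C" and l: "2 \<le> l"
    and G: "\<And>c. c \<in> C \<Longrightarrow> {c ! 0, c ! 1} \<in> G" and F: "cycle_edges l C \<subseteq> F"
  shows "has_disjoint_cycles (G \<union> F) l k"
proof -
  have "finite C" "card C = k" using C by (auto simp: path_system_def)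
  then obtain cs where cs: "bij_betw cs {0..<k} C" using ex_bij_betw_nat_finite by blast
  have csC: "cs j \<in> C" if "j < k" for j using cs that by (auto simp: bij_betw_def)
  show ?thesis
    unfolding has_disjoint_cycles_def
  proof (intro exI[of _ cs] conjI allI impI)
    fix j assume "j < k"
    note c = csC[OF this]
    have "{cs j ! i, cs j ! ((i + 1) mod l)} \<in> G \<union> F" if "i < l" for i
    proof (cases "i = 0")
      case True
      then show ?thesis using G[OF c] l by simp
    next
      case False
      then have "{cs j ! i, cs j ! ((i + 1) mod l)} \<in> cycle_edges l C"
        using c that unfolding cycle_edges_def by (intro CollectI exI[of _ "cs j"] exI[of _ i]) auto
      then show ?thesis using F by auto
    qed
    then show "is_cycle_copy (G \<union> F) l (cs j)"
      using C c by (auto simp: is_cycle_copy_def path_system_def)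
  next
    fix i j assume "i < k" "j < k" "i \<noteq> j"
    then have "cs i \<noteq> cs j" using cs by (auto simp: bij_betw_def inj_on_def)
    then show "set (cs i) \<inter> set (cs j) = {}"
      using C csC[OF \<open>i < k\<close>] csC[OF \<open>j < k\<close>] by (auto simp: path_system_def)
  qed
qed

text \<open>Two orientations and fewer than \<open>l\<close> positions per pair: the factor lost
  when the labels are dropped.\<close>

lemma card_labels_le: "card {(i, a, b). 1 \<le> i \<and> i < l \<and> {a, b} = e} \<le> 2 * l \<and>
    finite {(i :: nat, a :: 'a, b). 1 \<le> i \<and> i < l \<and> {a, b} = e}"
proof (cases "\<exists>x y. e = {x, y}")
  case True
  then obtain x y where e: "e = {x, y}" by auto
  have sub: "{(i :: nat, a, b). 1 \<le> i \<and> i < l \<and> {a, b} = e} \<subseteq> {..<l} \<times> {(x, y), (y, x)}"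
    by (auto simp: e doubleton_eq_iff)
  let ?B = "{..<l} \<times> {(x, y), (y, x)}"
  have "card {(x, y), (y, x)} \<le> 2" using card_length[of "[(x, y), (y, x)]"] by (simp only: list.set list.size numeral_2_eq_2 add_0 add_Suc_right add_0_right One_nat_def)
  then have "l * card {(x, y), (y, x)} \<le> l * 2" by (rule mult_le_mono2)
  moreover have "card ?B = l * card {(x, y), (y, x)}" by (simp only: card_cartesian_product card_lessThan)
  ultimately have B: "card ?B \<le> 2 * l" by linarith
  have B': "finite ?B" by simp
  show ?thesis using order.trans[OF card_mono[OF B' sub] B] finite_subset[OF sub B'] by (rule conjI)
next
  case False
  then have "{(i :: nat, a, b). 1 \<le> i \<and> i < l \<and> {a, b} = e} = {}" by auto
  then show ?thesis by (simp only: card.empty finite.emptyI zero_le simp_thms)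
qed

text \<open>Union bound over all ways to assign a position and an orientation to each pair in
  \<open>S\<close>. Distinct pairs receive distinct labels, so each of the at most
  \<open>(2 * l) ^ card S\<close> assignments has probability at most
  \<open>q ^ card S\<close>.\<close>

lemma spread_cycle_edges:
  fixes P :: "'a list set pmf"
  assumes P: "\<And>C. C \<in> set_pmf P \<Longrightarrow> path_system V k l C" and sp: "spread_paths q P" and l: "2 \<le> l"
    and q: "0 \<le> q" and S: "finite S"
  shows "measure_pmf.prob P {C. S \<subseteq> cycle_edges l C} \<le> (2 * real l * q) ^ card S"
proof -
  \<comment> \<open>Closing edges get the position \<open>l - 1\<close>, which no inner edge has, so
    a set of labelled edges splits uniquely into the two kinds that \<open>spread_paths\<close>
    controls.\<close>
  define lab where "lab C = inner_edges C \<union> (\<lambda>(a, b). (l - 1, a, b)) ` end_pairs C" for C :: "'a list set"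
  define Ph where "Ph = (\<Pi>\<^sub>E e\<in>S. {(i, a, b). 1 \<le> i \<and> i < l \<and> {a, b} = e})"
  have finPh: "finite Ph" unfolding Ph_def by (rule finite_PiE[OF S]) (rule card_labels_le[THEN conjunct2])
  have "card Ph = (\<Prod>e\<in>S. card {(i, a, b). 1 \<le> i \<and> i < l \<and> {a, b} = e})"
    unfolding Ph_def using S by (rule card_PiE)
  also have "\<dots> \<le> (\<Prod>e\<in>S. 2 * l)" by (rule prod_mono) (use card_labels_le[THEN conjunct1] in \<open>simp only: zero_le simp_thms\<close>)
  finally have cPh: "card Ph \<le> (2 * l) ^ card S" by simp
  have lab: "measure_pmf.prob P {C. \<phi> ` S \<subseteq> lab C} \<le> q ^ card S" if \<phi>: "\<phi> \<in> Ph" for \<phi>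
  proof -
    let ?T = "\<phi> ` S"
    have lbl: "\<exists>i a b. \<phi> e = (i, a, b) \<and> {a, b} = e" if "e \<in> S" for e
      using PiE_mem[OF \<phi>[unfolded Ph_def] that] by auto
    have "inj_on \<phi> S"
    proof (rule inj_onI)
      fix e e' assume "e \<in> S" "e' \<in> S" "\<phi> e = \<phi> e'"
      then show "e = e'" using lbl[of e] lbl[of e'] by auto
    qed
    then have cT: "card ?T = card S" by (rule card_image)
    define A where "A = {t\<in>?T. fst t \<noteq> l - 1}"
    define Q where "Q = {(a, b). (l - 1, a, b) \<in> ?T}"
    have finT: "finite ?T" using S by simp
    have fin: "finite A" "finite Q" and c: "card S = card A + card Q"
      using finT cT card_split_label[OF finT, of "l - 1"] by (auto simp: A_def Q_def)
    have "measure_pmf.prob P {C. ?T \<subseteq> lab C} = measure_pmf.prob P ({C. ?T \<subseteq> lab C} \<inter> set_pmf P)"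
      by (simp add: measure_Int_set_pmf)
    also have "\<dots> \<le> measure_pmf.prob P {C. A \<subseteq> inner_edges C \<and> Q \<subseteq> end_pairs C}"
    proof (rule measure_pmf.finite_measure_mono, rule subsetI)
      fix C assume C: "C \<in> {C. ?T \<subseteq> lab C} \<inter> set_pmf P"
      have T: "?T \<subseteq> lab C" using C by simp
      have ps: "path_system V k l C" using C P by simp
      have no: "fst t \<noteq> l - 1" if "t \<in> inner_edges C" for t
        using that ps by (fastforce simp: inner_edges_def path_system_def)
      have "A \<subseteq> inner_edges C" using T by (auto simp: A_def lab_def)
      moreover have "Q \<subseteq> end_pairs C"
      proof clarify
        fix a b assume "(a, b) \<in> Q"
        then have "(l - 1, a, b) \<in> lab C" using T by (auto simp: Q_def)
        moreover have "(l - 1, a, b) \<notin> inner_edges C" using no[of "(l - 1, a, b)"] by auto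
        ultimately show "(a, b) \<in> end_pairs C" by (auto simp: lab_def)
      qed
      ultimately show "C \<in> {C. A \<subseteq> inner_edges C \<and> Q \<subseteq> end_pairs C}" by simp
    qed simp
    also have "\<dots> \<le> q ^ card S" using sp fin unfolding spread_paths_def c by blast
    finally show ?thesis .
  qed
  have "measure_pmf.prob P {C. S \<subseteq> cycle_edges l C} = measure_pmf.prob P ({C. S \<subseteq> cycle_edges l C} \<inter> set_pmf P)"
    by (simp add: measure_Int_set_pmf)
  also have "\<dots> \<le> measure_pmf.prob P (\<Union>\<phi>\<in>Ph. {C. \<phi> ` S \<subseteq> lab C})"
  proof (rule measure_pmf.finite_measure_mono, rule subsetI)
    fix C assume C: "C \<in> {C. S \<subseteq> cycle_edges l C} \<inter> set_pmf P"
    have ps: "path_system V k l C" using C P by simp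
    have "\<exists>t. t \<in> lab C \<and> t \<in> {(i, a, b). 1 \<le> i \<and> i < l \<and> {a, b} = e}" if e: "e \<in> S" for e
    proof -
      have "e \<in> cycle_edges l C" using C e by blast
      then obtain c i where c: "c \<in> C" "1 \<le> i" "i < l" "e = {c ! i, c ! ((i + 1) mod l)}"
        unfolding cycle_edges_def by blast
      have len: "length c = l" using ps c by (auto simp: path_system_def)
      show ?thesis
      proof (cases "Suc i < l")
        case True
        then have "(i, c ! i, c ! Suc i) \<in> lab C" using c(1,2) len unfolding lab_def inner_edges_def
            by (intro UnI1 CollectI exI[of _ c] exI[of _ i]) simp
        moreover have "(i + 1) mod l = Suc i" using True by simp
        ultimately show ?thesis using c by (intro exI[of _ "(i, c ! i, c ! Suc i)"]) simp
      next
        case False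
        then have "Suc i = l" using c by simp
        then have i: "i = l - 1" "(i + 1) mod l = 0" by auto
        have "c \<noteq> []" using len l by auto
        then have "last c = c ! i" "hd c = c ! 0" using len i by (auto simp: last_conv_nth hd_conv_nth)
        moreover have "(last c, hd c) \<in> end_pairs C" using c(1) by (simp add: end_pairs_def)
        then have "(l - 1, last c, hd c) \<in> lab C"
          unfolding lab_def by (intro UnI2 image_eqI[of _ _ "(last c, hd c)"]) simp_all
        ultimately have "(i, c ! i, c ! 0) \<in> lab C" using i(1) by simp
        then show ?thesis using c i by (intro exI[of _ "(i, c ! i, c ! 0)"]) simp
      qed
    qed
    then have "\<exists>\<phi>. \<forall>e\<in>S. \<phi> e \<in> lab C \<and> \<phi> e \<in> {(i, a, b). 1 \<le> i \<and> i < l \<and> {a, b} = e}"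
      by (intro bchoice ballI)
    then obtain \<phi> where "\<forall>e\<in>S. \<phi> e \<in> lab C \<and> \<phi> e \<in> {(i, a, b). 1 \<le> i \<and> i < l \<and> {a, b} = e}"
      by (rule exE)
    note \<phi> = bspec[OF this]
    have "restrict \<phi> S \<in> Ph"
      unfolding Ph_def restrict_PiE_iff using \<phi>[THEN conjunct2] by (rule ballI)
    moreover have "restrict \<phi> S ` S \<subseteq> lab C"
    proof (rule image_subsetI)
      fix e assume "e \<in> S"
      then show "restrict \<phi> S e \<in> lab C" using \<phi>[THEN conjunct1] by simp
    qed
    ultimately show "C \<in> (\<Union>\<phi>\<in>Ph. {C. \<phi> ` S \<subseteq> lab C})" by blast
  qed simp
  also have "\<dots> \<le> (\<Sum>\<phi>\<in>Ph. measure_pmf.prob P {C. \<phi> ` S \<subseteq> lab C})"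
    using finPh by (intro measure_pmf.finite_measure_subadditive_finite) auto
  also have "\<dots> \<le> (\<Sum>\<phi>\<in>Ph. q ^ card S)" using lab by (intro sum_mono) auto
  also have "\<dots> = real (card Ph) * q ^ card S" by simp
  also have "\<dots> \<le> real ((2 * l) ^ card S) * q ^ card S" using cPh q by (intro mult_right_mono) (simp_all only: of_nat_le_iff zero_le_power)
  also have "\<dots> = (2 * real l * q) ^ card S" by (simp add: power_mult_distrib)
  finally show ?thesis .
qed

section \<open>Cycles in randomly perturbed graphs\<close>

text \<open>Listing an edge as \<open>[Max e, Min e]\<close> fixes its orientation: sets of
  increasing pairs correspond injectively to sets of edges, so no factor is lost. Any other
  prescription has probability 0, since lists of length 2 have no inner edges.\<close>

lemma spread_paths_base:
  fixes P :: "nat set set pmf"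
  assumes P: "set_pmf P \<subseteq> {M. M \<subseteq> E \<and> matching M \<and> card M = k}" and sp: "spread_pmf P (\<lambda>_. q)"
    and E: "\<And>e. e \<in> E \<Longrightarrow> e \<subseteq> V \<and> card e = 2" and fin: "finite E" and q: "0 \<le> q"
  obtains P' where "spread_paths q P'"
    "\<And>C. C \<in> set_pmf P' \<Longrightarrow> path_system V k 2 C \<and> (\<forall>c\<in>C. {c ! 0, c ! 1} \<in> E)"
proof
  define pr where "pr e = [Max e, Min e]" for e :: "nat set"
  have pr: "pr e = [y, x] \<and> x < y" if "e = {x, y}" "x < y" for e x y
    using that by (auto simp: pr_def)
  have ex: "\<exists>x y. e = {x, y} \<and> x < y" if e: "e \<in> E" for e
  proof -
    obtain a b where "e = {a, b}" "a \<noteq> b" using E[OF e] by (auto simp: card_2_iff)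
    then show ?thesis by (cases "a < b") (auto simp: insert_commute neq_iff)
  qed
  have set_pr: "set (pr e) = e" "length (pr e) = 2" "distinct (pr e)" "{pr e ! 0, pr e ! 1} = e"
    "hd (pr e) \<noteq> last (pr e)" "{last (pr e), hd (pr e)} = e" "last (pr e) < hd (pr e)" if e: "e \<in> E" for e
  proof -
    obtain x y where xy: "e = {x, y}" "x < y" using ex[OF e] by auto
    note p = pr[OF this, THEN conjunct1]
    show "set (pr e) = e" "length (pr e) = 2" "distinct (pr e)" "{pr e ! 0, pr e ! 1} = e"
      "hd (pr e) \<noteq> last (pr e)" "{last (pr e), hd (pr e)} = e" "last (pr e) < hd (pr e)"
      unfolding p using xy by auto
  qed
  let ?P' = "map_pmf (image pr) P"
  show "path_system V k 2 C \<and> (\<forall>c\<in>C. {c ! 0, c ! 1} \<in> E)" if C: "C \<in> set_pmf ?P'" for C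
  proof -
    obtain M where "M \<in> set_pmf P" and CM: "C = pr ` M" using C by auto
    then have M: "M \<subseteq> E" "matching M" "card M = k" using P by auto
    have inj: "inj_on pr M" using set_pr(1) M(1) by (intro inj_onI) (metis subsetD)
    have "path_system V k 2 C"
      unfolding path_system_def CM
    proof (intro conjI ballI impI)
      show "finite (pr ` M)" using M fin finite_subset by blast
      show "card (pr ` M) = k" using card_image[OF inj] M by simp
    next
      fix c c' assume c: "c \<in> pr ` M" "c' \<in> pr ` M" "c \<noteq> c'"
      then obtain e e' where e: "e \<in> M" "e' \<in> M" "c = pr e" "c' = pr e'" by auto
      then have "e \<inter> e' = {}" using c(3) M(2) unfolding matching_def by metis
      then show "set c \<inter> set c' = {}" using e M(1) set_pr(1) by (metis subsetD)
    next
      fix c assume "c \<in> pr ` M"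
      then obtain e where e: "e \<in> E" "c = pr e" using M by auto
      then show "length c = 2" "distinct c" "set c \<subseteq> V" using set_pr(1-3)[OF e(1)] E[OF e(1)] by simp_all
    qed
    moreover have "{c ! 0, c ! 1} \<in> E" if c: "c \<in> C" for c
    proof -
      obtain e where e: "e \<in> E" "c = pr e" using c CM M(1) by blast
      show ?thesis unfolding e(2) set_pr(4)[OF e(1)] by (rule e(1))
    qed
    ultimately show ?thesis by (intro conjI ballI)
  qed
  show "spread_paths q ?P'"
    unfolding spread_paths_def
  proof (intro allI impI)
    fix S :: "(nat \<times> nat \<times> nat) set" and Q :: "(nat \<times> nat) set"
    assume fS: "finite S" and fQ: "finite Q"
    let ?ev = "{C. S \<subseteq> inner_edges C \<and> Q \<subseteq> end_pairs C}"
    show "measure_pmf.prob ?P' ?ev \<le> q ^ (card S + card Q)"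
    proof (cases "S = {} \<and> Q \<subseteq> {(x, y). x < y}")
      case True
      let ?f = "\<lambda>(x, y). {x, y}"
      have "inj_on ?f Q"
      proof (rule inj_onI)
        fix s t assume st: "s \<in> Q" "t \<in> Q" "?f s = ?f t"
        obtain a b c d where ab: "s = (a, b)" "t = (c, d)" by (cases s, cases t)
        have "s \<in> {(x, y). x < y}" "t \<in> {(x, y). x < y}" using True st(1,2) by blast+
        then show "s = t" using st(3) by (auto simp: ab doubleton_eq_iff)
      qed
      then have cQ: "card (?f ` Q) = card Q" by (rule card_image)
      have "measure_pmf.prob ?P' ?ev = measure_pmf.prob P ({M. image pr M \<in> ?ev} \<inter> set_pmf P)"
        by (simp add: measure_map_pmf vimage_def measure_Int_set_pmf)
      also have "\<dots> \<le> measure_pmf.prob P {M. ?f ` Q \<subseteq> M}"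
      proof (rule measure_pmf.finite_measure_mono, rule subsetI)
        fix M assume M: "M \<in> {M. image pr M \<in> ?ev} \<inter> set_pmf P"
        then have ME: "M \<subseteq> E" using P by auto
        have Q: "Q \<subseteq> end_pairs (pr ` M)" using M by simp
        have "?f t \<in> M" if t: "t \<in> Q" for t
        proof -
          obtain e where "e \<in> M" "t = (last (pr e), hd (pr e))" using t Q by (auto simp: end_pairs_def)
          then show ?thesis using set_pr(6)[of e] ME by auto
        qed
        then show "M \<in> {M. ?f ` Q \<subseteq> M}" by blast
      qed simp
      also have "\<dots> \<le> q ^ card Q" using sp fQ unfolding spread_pmf_def by (metis cQ finite_imageI prod_constant)
      finally show ?thesis using True by simp
    next
      case False
      have "set_pmf ?P' \<inter> ?ev = {}"
      proof (rule ccontr)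
        assume "set_pmf ?P' \<inter> ?ev \<noteq> {}"
        then obtain M where "M \<in> set_pmf P" and M: "S \<subseteq> inner_edges (pr ` M)" "Q \<subseteq> end_pairs (pr ` M)" by auto
        then have ME: "M \<subseteq> E" using P by auto
        have "inner_edges (pr ` M) = {}" by (auto simp: inner_edges_def pr_def)
        moreover have "end_pairs (pr ` M) \<subseteq> {(x, y). x < y}" using ME set_pr(7) by (auto simp: end_pairs_def)
        ultimately show False using False M by auto
      qed
      then have "measure_pmf.prob ?P' ?ev = 0" by (simp only: measure_pmf_zero_iff)
      then show ?thesis using q by simp
    qed
  qed
qed

lemma spread_cycle_system:
  assumes l: "3 \<le> l" and E: "is_graph n E" and deg: "\<And>v. v < n \<Longrightarrow> k \<le> Defs.degree E v"
    and k: "l * k \<le> n" "0 < k" and n: "7800000 + 3 * l \<le> n"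
  obtains P where "spread_paths (real (7800000 + 3 * l) / real n) P"
    "\<And>C. C \<in> set_pmf P \<Longrightarrow> path_system {0..<n} k l C \<and> (\<forall>c\<in>C. {c ! 0, c ! 1} \<in> E)"
proof -
  define q where "q = real (7800000 + 3 * l) / real n"
  have q: "0 \<le> q" "q \<le> 1" using n by (auto simp: q_def)
  interpret fin_graph "{0..<n}" E
    using E by unfold_locales (auto simp: is_graph_def all_pairs_def)
  have k3: "3 * k \<le> n" using l k by (meson le_trans mult_le_mono1)
  have degs: "k \<le> card (nbrs E v)" if "v \<in> {0..<n}" for v
    using deg[of v] that by (simp add: card_nbrs Defs.degree_def)
  obtain P0 where P0: "set_pmf P0 \<subseteq> {M. M \<subseteq> E \<and> matching M \<and> card M = k}" "spread_pmf P0 (\<lambda>_. 7800000 / real n)"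
    using spread_matching[OF degs] k3 n by auto
  have sp0: "spread_pmf P0 (\<lambda>_. q)"
    by (rule spread_pmf_mono[OF P0(2)]) (auto simp: q_def intro: divide_right_mono)
  have "\<exists>P. spread_paths q P \<and> (\<forall>C\<in>set_pmf P. path_system {0..<n} k L C \<and> (\<forall>c\<in>C. {c ! 0, c ! 1} \<in> E))"
    if "2 \<le> L" "L \<le> l" for L
    using that
  proof (induction L rule: dec_induct)
    case base
    obtain P where "spread_paths q P"
      "\<And>C. C \<in> set_pmf P \<Longrightarrow> path_system {0..<n} k 2 C \<and> (\<forall>c\<in>C. {c ! 0, c ! 1} \<in> E)"
      using spread_paths_base[OF P0(1) sp0 edges finE q(1)] by blast
    then show ?case by blast
  next
    case (step L)
    then obtain P where P: "spread_paths q P"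
      "\<And>C. C \<in> set_pmf P \<Longrightarrow> path_system {0..<n} k L C \<and> (\<forall>c\<in>C. {c ! 0, c ! 1} \<in> E)" by auto
    have "Suc L * k \<le> l * k" using step by (intro mult_le_mono1) auto
    then have room: "Suc L * k \<le> n" using k(1) by linarith
    \<comment> \<open>With \<open>L < l\<close> and \<open>l * k \<le> n\<close>, the lists occupy
      at most a proportion \<open>(l - 1) / l\<close> of the vertices before the extension.\<close>
    have "n \<le> l * (n - L * k)"
    proof -
      have "L * k + k \<le> l * k" using \<open>Suc L * k \<le> l * k\<close> by simp
      then have Lk: "L * k \<le> (l - 1) * k" by (simp add: diff_mult_distrib)
      have "l * (L * k) \<le> l * ((l - 1) * k)" using Lk by (rule mult_le_mono2)
      also have "\<dots> = (l - 1) * (l * k)" by (simp add: mult_ac)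
      also have "\<dots> \<le> (l - 1) * n" using k(1) by (rule mult_le_mono2)
      finally have "l * (L * k) \<le> l * n - n" by (simp add: diff_mult_distrib)
      moreover have "n \<le> l * n" using l by simp
      ultimately have "n \<le> l * n - l * (L * k)" by linarith
      then show ?thesis by (simp add: diff_mult_distrib2)
    qed
    then have "real n \<le> real (l * (n - L * k))" by (simp only: of_nat_le_iff)
    then have nl: "real n \<le> real l * real (n - L * k)" by simp
    have "0 < n - L * k" using room k(2) by simp
    then have pos: "0 < real (n - L * k)" by (simp only: of_nat_0_less_iff)
    have "3 / real (n - L * k) \<le> 3 * real l / real n"
    proof -
      define N where "N = real (n - L * k)"
      have "real n \<le> real l * N" unfolding N_def by (rule nl)
      moreover have "0 < N" unfolding N_def by (rule pos)
      moreover have "0 < real n" using n by simp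
      ultimately have "3 / N \<le> 3 * real l / real n" by (simp add: field_simps)
      then show ?thesis by (simp add: N_def)
    qed
    also have "\<dots> \<le> q" unfolding q_def by (intro divide_right_mono) auto
    finally have q3: "3 / real (n - L * k) \<le> q" .
    obtain P' where P': "spread_paths q P'"
      "\<And>D. D \<in> set_pmf P' \<Longrightarrow> path_system {0..<n} k (Suc L) D \<and> (\<exists>C\<in>set_pmf P. \<exists>f. D = append_images f C)"
    proof (rule spread_paths_extend[where V = "{0..<n}" and k = k and L = L, OF _ P(1)])
      show "path_system {0..<n} k L C" if "C \<in> set_pmf P" for C using P(2)[OF that] by simp
    qed (use room q3 q k step in auto)
    have "{d ! 0, d ! 1} \<in> E" if D: "D \<in> set_pmf P'" and d: "d \<in> D" for D d
    proof -
      obtain C f where C: "C \<in> set_pmf P" "D = append_images f C" using P'(2)[OF D] by blast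
      then obtain c where c: "c \<in> C" "d = c @ [f (hd c)]" using d by (auto simp: append_images_def)
      have "length c = L" using P(2)[OF C(1)] c by (auto simp: path_system_def)
      then have "d ! 0 = c ! 0" "d ! 1 = c ! 1" using c step by (auto simp: nth_append)
      then show ?thesis using P(2)[OF C(1)] c by auto
    qed
    with P' show ?case by blast
  qed
  from this[of l] that show thesis using l unfolding q_def by auto
qed

section \<open>Applying the spread lemma\<close>

lemma gnp_prob_bin_prob: "gnp_prob n p Q = bin_prob (all_pairs n) p Q"
proof -
  have fin: "finite (all_pairs n)"
    unfolding all_pairs_def by (rule finite_subset[of _ "Pow {0..<n}"]) auto
  show ?thesis
    unfolding gnp_prob_def bin_prob_def bin_weight_def
  proof (intro sum.cong refl)
    fix F assume "F \<in> Pow (all_pairs n)"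
    then have "card (all_pairs n - F) = card (all_pairs n) - card F"
      using fin finite_subset by (intro card_Diff_subset) auto
    then show "(if Q F then p ^ card F * (1 - p) ^ (card (all_pairs n) - card F) else 0)
      = p ^ card F * (1 - p) ^ card (all_pairs n - F) * of_bool (Q F)" by simp
  qed
qed

text \<open>The random cycle systems have spread \<open>K / n\<close>, where the factor
  \<open>2 * l\<close> in \<open>K\<close> pays for unlabelled edges. The last round of the spread
  lemma has density \<open>q * ln n\<close> and at most \<open>3 * ln n\<close> halving rounds have
  density \<open>16 * q\<close> each: 49 = 1 + 3 * 16. Leaving \<open>s\<close> free allows it to be
  balanced between the two error terms afterwards.\<close>

lemma perturbed_cycles_lower_bound:
  assumes l: "3 \<le> l" and E: "is_graph n E" and n: "7800000 + 3 * l \<le> n"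
    and s: "1 \<le> s" and ln: "1 \<le> ln (real n)"
    and p: "49 * (2 * real l * real (7800000 + 3 * l)) * ln (real n) / real n \<le> p" "p \<le> 1"
  shows "1 - 3 * ln (real n) * (1 / 2) ^ s - ((1 + 1 / ln (real n)) ^ s - 1)
    \<le> gnp_prob n p (\<lambda>F. has_disjoint_cycles (E \<union> F) l (min (min_degree n E) (n div l)))"
proof -
  define k where "k = min (min_degree n E) (n div l)"
  define K where "K = 2 * real l * real (7800000 + 3 * l)"
  define q where "q = K / real n"
  have n0: "0 < n" using n by simp
  have K: "0 < K" using l by (simp add: K_def)
  have q: "0 < q" using K n0 by (simp add: q_def)
  have p0: "0 \<le> p" using p(1) ln n0 K by (intro order.trans[OF _ p(1)]) simp
  have fin: "finite (all_pairs n)"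
    unfolding all_pairs_def by (rule finite_subset[of _ "Pow {0..<n}"]) auto
  have err: "0 \<le> 3 * ln (real n) * (1 / 2) ^ s" "0 \<le> (1 + 1 / ln (real n)) ^ s - 1"
    using ln by (auto intro!: one_le_power)
  show ?thesis
  proof (cases "k = 0")
    case True
    then have "gnp_prob n p (\<lambda>F. has_disjoint_cycles (E \<union> F) l (min (min_degree n E) (n div l))) = 1"
      unfolding k_def[symmetric] gnp_prob_bin_prob bin_prob_def has_disjoint_cycles_def
      using sum_bin_weight[OF fin, of p] by simp
    then show ?thesis using err by simp
  next
    case False
    have deg: "k \<le> Defs.degree E v" if "v < n" for v
      using that by (simp add: k_def min_degree_def le_trans[OF _ Min_le] min.coboundedI1)
    have kl: "l * k \<le> n"
    proof -
      have "l * k \<le> l * (n div l)" by (intro mult_le_mono2) (simp add: k_def)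
      also have "\<dots> \<le> n" by simp
      finally show ?thesis .
    qed
    obtain P where P: "spread_paths (real (7800000 + 3 * l) / real n) P"
      "\<And>C. C \<in> set_pmf P \<Longrightarrow> path_system {0..<n} k l C \<and> (\<forall>c\<in>C. {c ! 0, c ! 1} \<in> E)"
      using spread_cycle_system[OF l E deg kl _ n] False by blast
    have ps: "path_system {0..<n} k l C" if "C \<in> set_pmf P" for C using P(2)[OF that] by simp
    have finP: "finite (set_pmf P)"
    proof (rule finite_subset)
      show "set_pmf P \<subseteq> Pow {c. set c \<subseteq> {0..<n} \<and> length c = l}"
        using ps by (auto simp: path_system_def)
      show "finite (Pow {c. set c \<subseteq> {0..<n} \<and> length c = l})" using finite_lists_length_eq[of "{0..<n}" l] by simp
    qed
    have sp: "spread (set_pmf P) (cycle_edges l) (pmf P) q"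
      unfolding spread_def
    proof (intro conjI allI impI ballI)
      fix S :: "nat set set" assume S: "finite S"
      have "(\<Sum>C\<in>{C\<in>set_pmf P. S \<subseteq> cycle_edges l C}. pmf P C) = measure_pmf.prob P {C\<in>set_pmf P. S \<subseteq> cycle_edges l C}"
        using finP by (subst measure_measure_pmf_finite) auto
      also have "\<dots> \<le> measure_pmf.prob P {C. S \<subseteq> cycle_edges l C}"
        by (intro measure_pmf.finite_measure_mono) auto
      also have "\<dots> \<le> (2 * real l * (real (7800000 + 3 * l) / real n)) ^ card S"
        using l by (intro spread_cycle_edges[OF ps P(1) _ _ S]) auto
      also have "\<dots> = q ^ card S" by (simp add: q_def K_def)
      finally show "(\<Sum>C\<in>{C\<in>set_pmf P. S \<subseteq> cycle_edges l C}. pmf P C) \<le> q ^ card S" .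
    qed (use finP in auto)
    \<comment> \<open>Enough halvings: \<open>2 ^ j\<close> is at least \<open>n\<close>, and the
      cycle systems have at most \<open>k * l \<le> n\<close> edges.\<close>
    define j where "j = nat \<lceil>log 2 (real n)\<rceil>"
    define d where "d = q * ln (real n)"
    have d: "0 < d" using q ln by (simp add: d_def)
    have "real n \<le> 2 ^ j"
    proof -
      have "log 2 (real n) \<le> real j" using n0 by (simp add: j_def real_nat_ceiling_ge)
      then have "2 powr (log 2 (real n)) \<le> 2 powr real j" by (intro powr_mono) auto
      then show ?thesis using n0 by (simp add: powr_realpow)
    qed
    then have "real n \<le> real (2 ^ j)" by simp
    then have nj: "n \<le> 2 ^ j" by (simp only: of_nat_le_iff)
    have j: "real j \<le> 3 * ln (real n)"
    proof -
      have "real j \<le> log 2 (real n) + 1" using n0 n by (simp add: j_def)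
      moreover have "log 2 (real n) \<le> 2 * ln (real n)"
      proof -
        have "1 / 2 \<le> ln (2 :: real)" using ln2_ge_two_thirds by simp
        then have "ln (real n) / ln 2 \<le> ln (real n) / (1 / 2)" using ln by (intro divide_left_mono) auto
        then show ?thesis by (simp add: log_def)
      qed
      ultimately show ?thesis using ln by linarith
    qed
    have mass: "sum (pmf P) (set_pmf P) = 1" using finP by (intro sum_pmf_eq_1) auto
    have qd: "q / d = 1 / ln (real n)" using q by (simp add: d_def)
    have "sum (pmf P) (set_pmf P) - real j * (1 / 2) ^ s - ((1 + q / d) ^ s - 1)
       \<le> bin_prob (all_pairs n) p (\<lambda>F. \<exists>C\<in>set_pmf P. cycle_edges l C \<subseteq> F)"
    proof (rule spread_lemma[OF sp fin _ _ d q _ p(2)])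
      show "cycle_edges l C \<subseteq> all_pairs n" if "C \<in> set_pmf P" for C
        using ps[OF that] l by (intro cycle_edges_all_pairs) auto
      show "card (cycle_edges l C) \<le> s * 2 ^ j" if "C \<in> set_pmf P" for C
      proof -
        have "card (cycle_edges l C) \<le> k * l" using card_cycle_edges_le(2)[OF ps[OF that]] .
        also have "\<dots> \<le> n" using kl by (simp add: mult.commute)
        also have "\<dots> \<le> 2 ^ j" by fact
        also have "\<dots> \<le> s * 2 ^ j" using s by simp
        finally show ?thesis .
      qed
      have "real j * (16 * q) \<le> 3 * ln (real n) * (16 * q)" using j q by (intro mult_right_mono) auto
      then have "d + real j * (16 * q) \<le> 49 * (q * ln (real n))" by (simp add: d_def)
      also have "\<dots> = 49 * K * ln (real n) / real n" by (simp add: q_def)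
      also have "\<dots> \<le> p" using p(1) by (simp add: K_def)
      finally show "d + real j * (16 * q) \<le> p" .
    qed
    then have "1 - real j * (1 / 2) ^ s - ((1 + 1 / ln (real n)) ^ s - 1)
       \<le> bin_prob (all_pairs n) p (\<lambda>F. \<exists>C\<in>set_pmf P. cycle_edges l C \<subseteq> F)"
      unfolding mass qd .
    moreover have "real j * (1 / 2) ^ s \<le> 3 * ln (real n) * (1 / 2) ^ s" using j by (intro mult_right_mono) auto
    moreover have "bin_prob (all_pairs n) p (\<lambda>F. \<exists>C\<in>set_pmf P. cycle_edges l C \<subseteq> F)
      \<le> bin_prob (all_pairs n) p (\<lambda>F. has_disjoint_cycles (E \<union> F) l k)"
    proof (rule bin_prob_mono[OF p0 p(2)])
      fix F assume "\<exists>C\<in>set_pmf P. cycle_edges l C \<subseteq> F"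
      then obtain C where C: "C \<in> set_pmf P" "cycle_edges l C \<subseteq> F" by auto
      show "has_disjoint_cycles (E \<union> F) l k"
        using P(2)[OF C(1)] C(2) l by (intro has_disjoint_cycles_path_system[of "{0..<n}" k l C]) auto
    qed
    ultimately show ?thesis unfolding gnp_prob_bin_prob k_def[symmetric] by linarith
  qed
qed

text \<open>The exponent \<open>s\<close> of order \<open>sqrt (ln n)\<close> suits both errors:
  \<open>2 ^ s\<close> outgrows \<open>ln n\<close>, while \<open>s / ln n\<close> tends to 0 and
  with it \<open>(1 + 1 / ln n) ^ s - 1\<close>.\<close>

lemma error_tendsto:
  "(\<lambda>n. 1 - 3 * ln (real n) * (1 / 2) ^ nat \<lfloor>sqrt (ln (real n))\<rfloor>
     - ((1 + 1 / ln (real n)) ^ nat \<lfloor>sqrt (ln (real n))\<rfloor> - 1)) \<longlonglongrightarrow> 1"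
proof (rule tendsto_sandwich[OF _ _ _ tendsto_const])
  let ?s = "\<lambda>n. nat \<lfloor>sqrt (ln (real n))\<rfloor>"
  \<comment> \<open>A lower bound without floors: the floor is at least
    \<open>sqrt (ln n) - 1\<close> and at most \<open>sqrt (ln n)\<close>, and \<open>1 + x\<close>
    is at most \<open>exp x\<close>.\<close>
  let ?g = "\<lambda>n. 1 - 3 * ln (real n) * (1 / 2) powr (sqrt (ln (real n)) - 1) - (exp (sqrt (ln (real n)) / ln (real n)) - 1)"
  show "?g \<longlonglongrightarrow> 1" by real_asymp
  have ev: "\<forall>\<^sub>F n in sequentially. 1 \<le> ln (real n)" by real_asymp
  show "\<forall>\<^sub>F n in sequentially. ?g n \<le> 1 - 3 * ln (real n) * (1 / 2) ^ ?s n - ((1 + 1 / ln (real n)) ^ ?s n - 1)"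
    using ev
  proof eventually_elim
    fix n assume ln: "1 \<le> ln (real n)"
    define x where "x = sqrt (ln (real n))"
    have x: "1 \<le> x" using ln by (simp add: x_def)
    have s: "real (nat \<lfloor>x\<rfloor>) \<le> x" "x - 1 \<le> real (nat \<lfloor>x\<rfloor>)" using x by linarith+
    have "(1 / 2 :: real) ^ nat \<lfloor>x\<rfloor> = (1 / 2) powr real (nat \<lfloor>x\<rfloor>)" by (simp add: powr_realpow)
    also have "\<dots> \<le> (1 / 2) powr (x - 1)" using s by (intro powr_mono') auto
    finally have a: "3 * ln (real n) * (1 / 2) ^ nat \<lfloor>x\<rfloor> \<le> 3 * ln (real n) * (1 / 2) powr (x - 1)"
      using ln by (intro mult_left_mono) auto
    have "(1 + 1 / ln (real n)) ^ nat \<lfloor>x\<rfloor> \<le> exp (1 / ln (real n)) ^ nat \<lfloor>x\<rfloor>"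
      using ln exp_ge_add_one_self[of "1 / ln (real n)"] by (intro power_mono) auto
    also have "\<dots> = exp (real (nat \<lfloor>x\<rfloor>) / ln (real n))" by (simp add: exp_of_nat_mult[symmetric])
    also have "\<dots> \<le> exp (x / ln (real n))" using s ln by (simp add: divide_right_mono)
    finally show "?g n \<le> 1 - 3 * ln (real n) * (1 / 2) ^ ?s n - ((1 + 1 / ln (real n)) ^ ?s n - 1)"
      using a unfolding x_def by linarith
  qed
  show "\<forall>\<^sub>F n in sequentially. 1 - 3 * ln (real n) * (1 / 2) ^ ?s n - ((1 + 1 / ln (real n)) ^ ?s n - 1) \<le> 1"
    using ev
  proof eventually_elim
    fix n assume ln: "1 \<le> ln (real n)"
    have "1 \<le> (1 + 1 / ln (real n)) ^ ?s n" using ln by (intro one_le_power) auto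
    moreover have "0 \<le> 3 * ln (real n) * (1 / 2) ^ ?s n" using ln by simp
    ultimately show "1 - 3 * ln (real n) * (1 / 2) ^ ?s n - ((1 + 1 / ln (real n)) ^ ?s n - 1) \<le> 1" by linarith
  qed
qed

theorem theorem1p2:
  fixes l :: nat
  assumes "l \<ge> 3"
  shows "\<exists>C>0. \<forall>(G :: nat \<Rightarrow> nat set set) (p :: nat \<Rightarrow> real).
     (\<forall>n. is_graph n (G n)) \<longrightarrow> (\<forall>n. 0 \<le> p n \<and> p n \<le> 1) \<longrightarrow>
     (\<forall>\<^sub>F n in sequentially. p n \<ge> C * ln (real n) / real n) \<longrightarrow>
     ((\<lambda>n. gnp_prob n (p n)
        (\<lambda>F. has_disjoint_cycles (G n \<union> F) l (min (min_degree n (G n)) (n div l))))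
      \<longlonglongrightarrow> 1)"
proof (intro exI[of _ "49 * (2 * real l * real (7800000 + 3 * l))"] conjI allI impI)
  show "0 < 49 * (2 * real l * real (7800000 + 3 * l))" using assms by simp
  fix G :: "nat \<Rightarrow> nat set set" and p :: "nat \<Rightarrow> real"
  assume G: "\<forall>n. is_graph n (G n)" and p: "\<forall>n. 0 \<le> p n \<and> p n \<le> 1"
    and large: "\<forall>\<^sub>F n in sequentially. p n \<ge> 49 * (2 * real l * real (7800000 + 3 * l)) * ln (real n) / real n"
  show "(\<lambda>n. gnp_prob n (p n)
        (\<lambda>F. has_disjoint_cycles (G n \<union> F) l (min (min_degree n (G n)) (n div l)))) \<longlonglongrightarrow> 1"
  proof (rule tendsto_sandwich[OF _ _ error_tendsto tendsto_const])
    have ev: "\<forall>\<^sub>F n in sequentially. 1 \<le> ln (real n)" by real_asymp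
    show "\<forall>\<^sub>F n in sequentially. 1 - 3 * ln (real n) * (1 / 2) ^ nat \<lfloor>sqrt (ln (real n))\<rfloor>
       - ((1 + 1 / ln (real n)) ^ nat \<lfloor>sqrt (ln (real n))\<rfloor> - 1)
      \<le> gnp_prob n (p n) (\<lambda>F. has_disjoint_cycles (G n \<union> F) l (min (min_degree n (G n)) (n div l)))"
      using ev large eventually_ge_at_top[of "7800000 + 3 * l"]
    proof eventually_elim
      case (elim n)
      have "1 \<le> sqrt (ln (real n))" using elim(1) by simp
      then have "1 \<le> nat \<lfloor>sqrt (ln (real n))\<rfloor>" by linarith
      then show ?case using elim assms G p by (intro perturbed_cycles_lower_bound) auto
    qed
    have "finite (all_pairs n)" for n
      unfolding all_pairs_def by (rule finite_subset[of _ "Pow {0..<n}"]) auto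
    then show "\<forall>\<^sub>F n in sequentially. gnp_prob n (p n)
        (\<lambda>F. has_disjoint_cycles (G n \<union> F) l (min (min_degree n (G n)) (n div l))) \<le> 1"
      using p by (intro always_eventually allI) (simp add: gnp_prob_bin_prob bin_prob_le_1)
  qed
qed

end
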